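(* Let $p$ be a prime, let $G$ be the Vilenkin group associated with $p$, $H$ its discrete subgroup, $G^*$ its dual group, $U^*$ the basic neighbourhood of $\theta$ in $G^*$, and $B$ the shift automorphism of $G^*$. Let $\Omega_1,\dots,\Omega_{p-1}$ be measurable subsets of $G^*$. Then $\{\Omega_1,\dots,\Omega_{p-1}\}$ forms a multiwavelet set if and only if both of the following conditions hold: (a) $\{B^n\Omega_i : n\in\mathbb{Z},\ 1\le i\le p-1\}$ tiles $G^*$ up to sets of measure zero (i.e. the sets $B^n\Omega_i$, indexed by pairs $(n,i)$, are pairwise disjoint up to null sets and their union is $G^*$ up to a null set); and (b) each $\Omega_i$, $1\le i\le p-1$, is $H^\perp$-translation congruent to $U^*$ up to sets of measure zero.
   Context: Vilenkin group: for a prime $p$, $G$ is the group of sequences $x=(x_j)_{j\in\mathbb{Z}}$ with $x_j\in\{0,\dots,p-1\}$ and $x_j=0$ for all $j<k(x)$, under coordinatewise addition mod $p$, denoted $\oplus$ (inverse operation $\ominus$); identity $\theta$. A basis of neighbourhoods of $\theta$ is $U_l=\{x\in G: x_j=0 \text{ for } j\le l\}$, $l\in\mathbb{Z}$; $U=U_0$; Haar measure $\mu$ is normalized by $\mu(U)=1$. The dual group $G^*$ consists of sequences $\omega=(\omega_j)_{j\in\mathbb{Z}}$ of the same form, with the same operations, neighbourhoods $U_l^*$, $U^*=U_0^*=\{\omega : \omega_j=0 \text{ for } j\le 0\}$, and Haar measure $\mu^*$ with $\mu^*(U^* )=1$. The pairing is $\chi(x,\omega)=\exp\big(\frac{2\pi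 i}{p}\sum_{j\in\mathbb{Z}}x_j\omega_{1-j}\big)$. $H=\{x\in G: x_j=0 \text{ for } j>0\}$; its annihilator is $H^\perp=\{\omega\in G^*:\omega_j=0\text{ for }j>0\}$. $A\in\mathrm{Aut}(G)$, $(Ax)_j=x_{j+1}$; $B\in\mathrm{Aut}(G^* )$, $(B\omega)_j=\omega_{j+1}$. The family $\{\Omega_1,\dots,\Omega_{p-1}\}$ is a multiwavelet set if, with $\psi_i=\check{1}_{\Omega_i}$ (the inverse Fourier transform of the characteristic function of $\Omega_i$), the functions $\psi_{i,j,h}(x)=p^{j/2}\psi_i(A^jx\ominus h)$, $1\le i\le p-1$, $j\in\mathbb{Z}$, $h\in H$, form an orthonormal basis of $L^2(G)$. Measurable sets $E,F\subset G^*$ are $H^\perp$-translation congruent if there is a measurable partition $\{E_h\}_{h\in H^\perp}$ of $E$ (pieces possibly empty) such that $\{E_h\oplus h\}_{h\in H^\perp}$ is a partition of $F$; "up to sets of measure zero" means that the partitions are understood modulo null sets. *)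

theory Defs
  imports "HOL-Analysis.Analysis" "HOL-Computational_Algebra.Primes"
begin

text \<open>
  The dual group consists of sequences of the same form as the group itself, with the same
  operations and neighbourhoods. The definitions of this section therefore serve for both;
  by convention \<open>x\<close>, \<open>h\<close>, \<open>\<mu>\<close> refer to the group and \<open>\<omega>\<close>, \<open>\<nu>\<close> to its dual.
\<close>

definition vilenkin :: "nat \<Rightarrow> (int \<Rightarrow> int) set" where
  "vilenkin p = {x. (\<forall>j. x j \<in> {0..<int p}) \<and> (\<exists>k. \<forall>j<k. x j = 0)}"

definition vadd :: "nat \<Rightarrow> (int \<Rightarrow> int) \<Rightarrow> (int \<Rightarrow> int) \<Rightarrow> int \<Rightarrow> int" where
  "vadd p x y = (\<lambda>j. (x j + y j) mod int p)"

definition vminus :: "nat \<Rightarrow> (int \<Rightarrow> int) \<Rightarrow> (int \<Rightarrow> int) \<Rightarrow> int \<Rightarrow> int" where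
  "vminus p x y = (\<lambda>j. (x j - y j) mod int p)"

definition nbhd :: "nat \<Rightarrow> int \<Rightarrow> (int \<Rightarrow> int) set" where
  "nbhd p l = {x \<in> vilenkin p. \<forall>j\<le>l. x j = 0}"

definition vilenkin_topology :: "nat \<Rightarrow> (int \<Rightarrow> int) topology" where
  "vilenkin_topology p = topology_generated_by {vadd p x ` nbhd p l |x l. x \<in> vilenkin p}"

text \<open>
  Local finiteness and regularity need not be demanded: the group is a countable union of
  translates of the compact open subgroup \<^term>\<open>nbhd p 0\<close>, so a translation invariant Borel
  measure with value 1 there is finite on compact sets, \<open>\<sigma>\<close>-finite and regular, and it is
  unique.
\<close>

definition normalized_haar :: "nat \<Rightarrow> (int \<Rightarrow> int) measure \<Rightarrow> bool" where
  "normalized_haar p \<mu> \<longleftrightarrow>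
     sets \<mu> = sets (sigma (vilenkin p) {S. openin (vilenkin_topology p) S}) \<and>
     (\<forall>x\<in>vilenkin p. \<forall>E\<in>sets \<mu>. emeasure \<mu> (vadd p x ` E) = emeasure \<mu> E) \<and>
     emeasure \<mu> (nbhd p 0) = 1"

text \<open>For elements of the group and its dual, only finitely many terms of the sum over all
  integers are nonzero; the sum is restricted to these.\<close>

definition pairing :: "nat \<Rightarrow> (int \<Rightarrow> int) \<Rightarrow> (int \<Rightarrow> int) \<Rightarrow> complex" where
  "pairing p x \<omega> =
     exp (2 * complex_of_real pi * \<i> / of_nat p *
          of_int (\<Sum>j | x j * \<omega> (1 - j) \<noteq> 0. x j * \<omega> (1 - j)))"

definition H :: "nat \<Rightarrow> (int \<Rightarrow> int) set" where
  "H p = {x \<in> vilenkin p. \<forall>j>0. x j = 0}"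

definition H_perp :: "nat \<Rightarrow> (int \<Rightarrow> int) set" where
  "H_perp p = {\<omega> \<in> vilenkin p. \<forall>j>0. \<omega> j = 0}"

text \<open>\<open>shift n\<close> is the \<open>n\<close>-th power, for an arbitrary integer \<open>n\<close>, of the automorphism \<open>A\<close> (on the
  group) and \<open>B\<close> (on the dual group), both of which move every entry one place to the left.\<close>

definition shift :: "int \<Rightarrow> (int \<Rightarrow> int) \<Rightarrow> int \<Rightarrow> int" where
  "shift n x = (\<lambda>j. x (j + n))"

definition inv_fourier ::
    "nat \<Rightarrow> (int \<Rightarrow> int) measure \<Rightarrow> ((int \<Rightarrow> int) \<Rightarrow> complex) \<Rightarrow> (int \<Rightarrow> int) \<Rightarrow> complex" where
  "inv_fourier p \<nu> g x = (\<integral>\<omega>. g \<omega> * pairing p x \<omega> \<partial>\<nu>)"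

definition L2 :: "'a measure \<Rightarrow> ('a \<Rightarrow> complex) set" where
  "L2 M = {f \<in> borel_measurable M. integrable M (\<lambda>x. (cmod (f x))\<^sup>2)}"

definition L2_inner :: "'a measure \<Rightarrow> ('a \<Rightarrow> complex) \<Rightarrow> ('a \<Rightarrow> complex) \<Rightarrow> complex" where
  "L2_inner M f g = (\<integral>x. f x * cnj (g x) \<partial>M)"

definition L2_norm :: "'a measure \<Rightarrow> ('a \<Rightarrow> complex) \<Rightarrow> real" where
  "L2_norm M f = sqrt (\<integral>x. (cmod (f x))\<^sup>2 \<partial>M)"

text \<open>An orthonormal family, indexed by \<open>I\<close>, whose finite linear combinations are dense.\<close>

definition L2_orthonormal_basis :: "'a measure \<Rightarrow> 'b set \<Rightarrow> ('b \<Rightarrow> 'a \<Rightarrow> complex) \<Rightarrow> bool" where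
  "L2_orthonormal_basis M I e \<longleftrightarrow>
     (\<forall>a\<in>I. e a \<in> L2 M) \<and>
     (\<forall>a\<in>I. \<forall>b\<in>I. L2_inner M (e a) (e b) = (if a = b then 1 else 0)) \<and>
     (\<forall>f\<in>L2 M. \<forall>\<epsilon>>0. \<exists>F c. finite F \<and> F \<subseteq> I \<and>
        L2_norm M (\<lambda>x. f x - (\<Sum>a\<in>F. c a * e a x)) < \<epsilon>)"

text \<open>
  If some \<open>\<Omega> i\<close> has infinite measure, its characteristic function is not square integrable and
  has no inverse Fourier transform in \<open>L\<^sup>2\<close>. The integral defining \<^const>\<open>inv_fourier\<close> is then 0
  by convention, so that \<open>\<psi>\<close> is not normalized and the family is not a multiwavelet set, as it
  should be. For finite measure the integral is the \<open>L\<^sup>2\<close> inverse Fourier transform.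
\<close>

definition multiwavelet ::
    "nat \<Rightarrow> (int \<Rightarrow> int) measure \<Rightarrow> (nat \<Rightarrow> (int \<Rightarrow> int) set) \<Rightarrow>
     nat \<times> int \<times> (int \<Rightarrow> int) \<Rightarrow> (int \<Rightarrow> int) \<Rightarrow> complex" where
  "multiwavelet p \<nu> \<Omega> = (\<lambda>(i, j, h) x.
     complex_of_real (real p powr (real_of_int j / 2)) *
     inv_fourier p \<nu> (indicator (\<Omega> i)) (vminus p (shift j x) h))"

definition multiwavelet_set ::
    "nat \<Rightarrow> (int \<Rightarrow> int) measure \<Rightarrow> (int \<Rightarrow> int) measure \<Rightarrow> (nat \<Rightarrow> (int \<Rightarrow> int) set) \<Rightarrow> bool" where
  "multiwavelet_set p \<mu> \<nu> \<Omega> \<longleftrightarrow>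
     L2_orthonormal_basis \<mu> ({1..p - 1} \<times> UNIV \<times> H p) (multiwavelet p \<nu> \<Omega>)"

definition ae_partition :: "'a measure \<Rightarrow> 'b set \<Rightarrow> ('b \<Rightarrow> 'a set) \<Rightarrow> 'a set \<Rightarrow> bool" where
  "ae_partition M I P S \<longleftrightarrow>
     (\<forall>a\<in>I. P a \<in> sets M) \<and>
     (\<forall>a\<in>I. \<forall>b\<in>I. a \<noteq> b \<longrightarrow> P a \<inter> P b \<in> null_sets M) \<and>
     sym_diff (\<Union>a\<in>I. P a) S \<in> null_sets M"

definition ae_H_perp_congruent ::
    "nat \<Rightarrow> (int \<Rightarrow> int) measure \<Rightarrow> (int \<Rightarrow> int) set \<Rightarrow> (int \<Rightarrow> int) set \<Rightarrow> bool" where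
  "ae_H_perp_congruent p \<nu> E F \<longleftrightarrow>
     (\<exists>P. ae_partition \<nu> (H_perp p) P E \<and>
          ae_partition \<nu> (H_perp p) (\<lambda>h. vadd p h ` P h) F)"

end

theory Submission
  imports Defs
begin

text \<open>
  Both Haar measures coincide, so a single measure \<open>M\<close> serves for the group and its dual. The
  inverse Fourier transform maps indicators of cylinders times characters to functions of the same
  kind and preserves their inner products; by density and Fatou's lemma it is isometric on
  \<open>L\<^sup>1 \<inter> L\<^sup>2\<close>. It turns the multiwavelet family into the functions
  \<open>p powr (- j / 2) * indicator (B\<^sup>j \<Omega> i) * cnj (\<chi> h (B\<^sup>-\<^sup>j \<omega>))\<close>, with \<open>h \<in> H\<close>. For fixed \<open>i\<close>, \<open>j\<close>
  these are orthonormal iff the indicator of \<open>\<Omega> i\<close> has the same Fourier coefficients on \<open>H\<close> as the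
  indicator of \<open>U\<^sup>*\<close>, that is, iff \<open>\<Omega> i\<close> is congruent to \<open>U\<^sup>*\<close> modulo the annihilator of \<open>H\<close>; they
  then span a dense subspace of the \<open>L\<^sup>2\<close> functions supported in \<open>B\<^sup>j \<Omega> i\<close>. Hence the full family is
  orthonormal and complete iff moreover the sets \<open>B\<^sup>j \<Omega> i\<close> are almost disjoint and cover almost
  everything.
\<close>

section \<open>Square-integrable functions\<close>

text \<open>\<open>inv_fourier\<close> is a pointwise Bochner integral, meaningful only for
  integrable functions, so no operator on all of \<open>L2\<close> is at hand. What is transformed
  is kept integrable and square integrable, approximations control both norms at once, and the place
  of an inversion theorem is taken by the fact that every step function is the transform of a step
  function. Congruence is awkward to use: its partition is existential and fits only up to null
  sets. It is replaced by a property of measures, \<open>frac_uniform\<close>. Characters from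
  \<open>H p\<close> see a point only through its reduction modulo the annihilator, so the Fourier
  coefficients determine exactly the image under reduction of the measure on
  \<open>\<Omega> i\<close>. A partition is recovered from it because a doubly covered set would be
  counted twice. Almost disjointness of the dilated sets comes from density: every measurable subset
  of one of them has its indicator in the closed span of the functions living on that set, so the
  indicator of an overlap lies in two mutually orthogonal spaces.\<close>

definition sqn :: "'a measure \<Rightarrow> ('a \<Rightarrow> complex) \<Rightarrow> ennreal" where
  "sqn M f = (\<integral>\<^sup>+x. ennreal ((cmod (f x))\<^sup>2) \<partial>M)"

lemma sqn_cong: "(\<And>x. x \<in> space M \<Longrightarrow> f x = g x) \<Longrightarrow> sqn M f = sqn M g"
  unfolding sqn_def by (rule nn_integral_cong) auto

lemma sqn_commute: "sqn M (\<lambda>x. f x - g x) = sqn M (\<lambda>x. g x - f x)"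
  by (simp add: sqn_def norm_minus_commute)

lemma sqn_scale:
  assumes "f \<in> borel_measurable M"
  shows "sqn M (\<lambda>x. c * f x) = ennreal ((cmod c)\<^sup>2) * sqn M f"
proof -
  have "sqn M (\<lambda>x. c * f x) = (\<integral>\<^sup>+x. ennreal ((cmod c)\<^sup>2) * ennreal ((cmod (f x))\<^sup>2) \<partial>M)"
    unfolding sqn_def
    by (rule nn_integral_cong) (simp add: norm_mult power_mult_distrib ennreal_mult)
  also have "\<dots> = ennreal ((cmod c)\<^sup>2) * sqn M f"
    unfolding sqn_def using assms by (intro nn_integral_cmult) measurable
  finally show ?thesis .
qed

text \<open>Expansion of \<open>(t * cmod a - cmod b)\<^sup>2 \<ge> 0\<close>. As \<open>t\<close>
  tends to 0 the factor of \<open>a\<close> tends to 1, so exact equalities of norms survive a limit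
  without Minkowski's inequality for square integrals.\<close>

lemma norm_add_square_le:
  fixes a b :: complex
  assumes "t > 0"
  shows "(cmod (a + b))\<^sup>2 \<le> (1 + t) * (cmod a)\<^sup>2 + (1 + 1 / t) * (cmod b)\<^sup>2"
proof -
  have "0 \<le> (t * cmod a - cmod b)\<^sup>2 / t"
    using assms by simp
  also have "\<dots> = t * (cmod a)\<^sup>2 - 2 * (cmod a * cmod b) + (cmod b)\<^sup>2 / t"
    using assms by (simp add: field_simps power2_eq_square)
  finally have "2 * (cmod a * cmod b) \<le> t * (cmod a)\<^sup>2 + (cmod b)\<^sup>2 / t" by simp
  moreover have "(cmod (a + b))\<^sup>2 \<le> (cmod a + cmod b)\<^sup>2"
    by (intro power_mono norm_triangle_ineq) simp
  ultimately show ?thesis by (simp add: algebra_simps power2_sum)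
qed

lemma sqn_add_le_weighted:
  assumes [measurable]: "f \<in> borel_measurable M" "g \<in> borel_measurable M" and t: "t > 0"
  shows "sqn M (\<lambda>x. f x + g x) \<le> ennreal (1 + t) * sqn M f + ennreal (1 + 1 / t) * sqn M g"
proof -
  have "sqn M (\<lambda>x. f x + g x) \<le>
      (\<integral>\<^sup>+x. ennreal (1 + t) * ennreal ((cmod (f x))\<^sup>2) +
        ennreal (1 + 1 / t) * ennreal ((cmod (g x))\<^sup>2) \<partial>M)"
    unfolding sqn_def using norm_add_square_le[OF t] t
    by (intro nn_integral_mono)
       (simp flip: ennreal_mult ennreal_plus add: ennreal_leI del: ennreal_plus)
  also have "\<dots> = ennreal (1 + t) * sqn M f + ennreal (1 + 1 / t) * sqn M g"
    unfolding sqn_def by (subst nn_integral_add) (auto simp: nn_integral_cmult)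
  finally show ?thesis .
qed

lemma sqn_add_le:
  assumes "f \<in> borel_measurable M" "g \<in> borel_measurable M"
  shows "sqn M (\<lambda>x. f x + g x) \<le> 2 * sqn M f + 2 * sqn M g"
  using sqn_add_le_weighted[OF assms, of 1] by simp

lemma sqn_triangle:
  assumes "f \<in> borel_measurable M" "g \<in> borel_measurable M" "h \<in> borel_measurable M"
  shows "sqn M (\<lambda>x. f x - h x) \<le> 2 * sqn M (\<lambda>x. f x - g x) + 2 * sqn M (\<lambda>x. g x - h x)"
  using sqn_add_le[of "\<lambda>x. f x - g x" M "\<lambda>x. g x - h x"] assms by simp

lemma sqn_indicator:
  assumes "A \<in> sets M"
  shows "sqn M (indicator A) = emeasure M A"
proof -
  have "sqn M (indicator A) = (\<integral>\<^sup>+x. indicator A x \<partial>M)"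
    unfolding sqn_def by (rule nn_integral_cong) (simp split: split_indicator)
  then show ?thesis using assms by simp
qed

text \<open>\<open>sqn\<close> is an extended nonnegative integral, so estimates with it carry no
  integrability side conditions; \<open>L2_norm\<close> rests on a Bochner integral that defaults to
  0.\<close>

lemma L2_iff: "f \<in> L2 M \<longleftrightarrow> f \<in> borel_measurable M \<and> sqn M f < \<infinity>"
proof -
  have "integrable M (\<lambda>x. (cmod (f x))\<^sup>2) \<longleftrightarrow> sqn M f < \<infinity>" if "f \<in> borel_measurable M"
    using that unfolding integrable_iff_bounded sqn_def by simp
  then show ?thesis by (auto simp: L2_def)
qed

lemma sqn_eq_integral: "f \<in> L2 M \<Longrightarrow> sqn M f = ennreal (\<integral>x. (cmod (f x))\<^sup>2 \<partial>M)"
  unfolding sqn_def L2_def by (subst nn_integral_eq_integral) auto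

lemma L2_norm_less_iff:
  assumes "f \<in> L2 M" "\<epsilon> > 0"
  shows "L2_norm M f < \<epsilon> \<longleftrightarrow> sqn M f < ennreal (\<epsilon>\<^sup>2)"
proof -
  have "L2_norm M f < \<epsilon> \<longleftrightarrow> (\<integral>x. (cmod (f x))\<^sup>2 \<partial>M) < \<epsilon>\<^sup>2"
    unfolding L2_norm_def using assms by (metis real_sqrt_less_iff real_sqrt_unique less_imp_le)
  then show ?thesis using assms by (simp add: sqn_eq_integral ennreal_less_iff)
qed

lemma L2_add: "f \<in> L2 M \<Longrightarrow> g \<in> L2 M \<Longrightarrow> (\<lambda>x. f x + g x) \<in> L2 M"
  using sqn_add_le[of f M g]
  by (auto simp: L2_iff ennreal_mult_less_top intro: le_less_trans)

lemma L2_scale: "f \<in> L2 M \<Longrightarrow> (\<lambda>x. c * f x) \<in> L2 M"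
  by (auto simp: L2_iff sqn_scale ennreal_mult_less_top)

lemma L2_diff: "f \<in> L2 M \<Longrightarrow> g \<in> L2 M \<Longrightarrow> (\<lambda>x. f x - g x) \<in> L2 M"
  using L2_add[of f M "\<lambda>x. (-1) * g x"] L2_scale[of g M "-1"] by simp

lemma L2_sum: "(\<And>a. a \<in> F \<Longrightarrow> f a \<in> L2 M) \<Longrightarrow> (\<lambda>x. \<Sum>a\<in>F. c a * f a x) \<in> L2 M"
  by (induction F rule: infinite_finite_induct) (auto simp: L2_add L2_scale, auto simp: L2_iff sqn_def)

lemma integrable_mult_cnj:
  assumes "f \<in> L2 M" "g \<in> L2 M"
  shows "integrable M (\<lambda>x. f x * cnj (g x))"
proof (rule Bochner_Integration.integrable_bound)
  show "integrable M (\<lambda>x. (cmod (f x))\<^sup>2 + (cmod (g x))\<^sup>2)"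
    using assms by (auto simp: L2_def)
  have "cnj \<in> borel_measurable borel"
    by (intro borel_measurable_continuous_onI continuous_intros)
  then show "(\<lambda>x. f x * cnj (g x)) \<in> borel_measurable M"
    using assms by (auto simp: L2_def intro!: borel_measurable_times measurable_compose[of g M borel cnj])
  have "cmod a * cmod b \<le> (cmod a)\<^sup>2 + (cmod b)\<^sup>2" for a b
    using sum_squares_bound[of "cmod a" "cmod b"] mult_nonneg_nonneg[OF norm_ge_zero[of a] norm_ge_zero[of b]]
    unfolding mult.assoc by linarith
  then show "AE x in M. norm (f x * cnj (g x)) \<le> norm ((cmod (f x))\<^sup>2 + (cmod (g x))\<^sup>2)"
    by (simp add: norm_mult)
qed

lemma L2_inner_self: "L2_inner M f f = complex_of_real (\<integral>x. (cmod (f x))\<^sup>2 \<partial>M)"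
  unfolding L2_inner_def by (simp add: complex_norm_square[symmetric] flip: of_real_power)

lemma L2_inner_commute: "L2_inner M g f = cnj (L2_inner M f g)"
proof -
  have "cnj (L2_inner M f g) = (\<integral>x. cnj (f x * cnj (g x)) \<partial>M)"
    unfolding L2_inner_def by (rule Bochner_Integration.integral_cnj[symmetric])
  then show ?thesis by (simp add: L2_inner_def mult.commute)
qed

lemma L2_inner_add_left:
  assumes "f \<in> L2 M" "f' \<in> L2 M" "g \<in> L2 M"
  shows "L2_inner M (\<lambda>x. f x + c * f' x) g = L2_inner M f g + c * L2_inner M f' g"
  using assms unfolding L2_inner_def
  by (simp add: algebra_simps integrable_mult_cnj Bochner_Integration.integral_add)

lemma L2_inner_add_right:
  assumes "f \<in> L2 M" "f' \<in> L2 M" "g \<in> L2 M"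
  shows "L2_inner M g (\<lambda>x. f x + c * f' x) = L2_inner M g f + cnj c * L2_inner M g f'"
  using L2_inner_add_left[OF assms] by (metis L2_inner_commute complex_cnj_add complex_cnj_mult)

text \<open>In the expansion of \<open>N c\<close> the product \<open>L2_inner M f g\<close> has the
  coefficient \<open>cnj c\<close>; summing \<open>c * N c\<close> over the fourth roots of unity
  removes all other terms. Equality of norms thereby yields equality of inner products.\<close>

lemma L2_inner_polarization:
  assumes f: "f \<in> L2 M" and g: "g \<in> L2 M"
  defines "N \<equiv> \<lambda>c. L2_inner M (\<lambda>x. f x + c * g x) (\<lambda>x. f x + c * g x)"
  shows "4 * L2_inner M f g = N 1 - N (-1) + \<i> * N \<i> - \<i> * N (-\<i>)"
proof -
  have "N c = L2_inner M f f + cnj c * L2_inner M f g +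
      c * (L2_inner M g f + cnj c * L2_inner M g g)" for c
  proof -
    have "(\<lambda>x. f x + c * g x) \<in> L2 M" using f g by (intro L2_add L2_scale)
    then show ?thesis unfolding N_def
      using f g by (simp add: L2_inner_add_left L2_inner_add_right)
  qed
  then show ?thesis by (simp add: algebra_simps)
qed

text \<open>Pythagoras. It also bounds distances from below: a function orthogonal to a span is at
  least its own norm away from it.\<close>

lemma sqn_diff_orthogonal:
  assumes f: "f \<in> L2 M" and g: "g \<in> L2 M" and orth: "L2_inner M f g = 0"
  shows "sqn M (\<lambda>x. f x - g x) = sqn M f + sqn M g"
proof -
  have fg: "(\<lambda>x. f x + (-1) * g x) \<in> L2 M" using f g by (intro L2_add L2_scale)
  have gf: "L2_inner M g f = 0" using orth by (subst L2_inner_commute) simp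
  have "L2_inner M (\<lambda>x. f x + (-1) * g x) (\<lambda>x. f x + (-1) * g x) = L2_inner M f f + L2_inner M g g"
    by (subst L2_inner_add_left[OF f g fg], (subst L2_inner_add_right[OF f g], fact)+)
       (simp add: orth gf)
  then have "(\<integral>x. (cmod (f x - g x))\<^sup>2 \<partial>M) = (\<integral>x. (cmod (f x))\<^sup>2 \<partial>M) + (\<integral>x. (cmod (g x))\<^sup>2 \<partial>M)"
    unfolding L2_inner_self by (simp flip: of_real_add)
  then show ?thesis using f g by (simp add: sqn_eq_integral L2_diff)
qed

text \<open>The passage from \<open>f\<close> to \<open>f'\<close> and from \<open>g'\<close> to
  \<open>g\<close> costs two weighted inequalities. With weight \<open>t\<close> and accuracy
  \<open>t\<^sup>2\<close> the error terms carry
  \<open>(1 + 1 / t) * t\<^sup>2 = (1 + t) * t\<close> and vanish with \<open>t\<close>, while the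
  main factor \<open>(1 + t)\<^sup>2\<close> tends to 1.\<close>

lemma sqn_le_of_approx:
  assumes [measurable]: "f \<in> borel_measurable M" "g \<in> borel_measurable N"
    and approx: "\<And>\<epsilon>. \<epsilon> > 0 \<Longrightarrow> \<exists>f' g'. f' \<in> borel_measurable M \<and> g' \<in> borel_measurable N \<and>
      sqn M (\<lambda>x. f x - f' x) \<le> ennreal \<epsilon> \<and> sqn N (\<lambda>x. g x - g' x) \<le> ennreal \<epsilon> \<and> sqn M f' = sqn N g'"
  shows "sqn M f \<le> sqn N g"
proof (cases "sqn N g")
  case (real G)
  define h where "h = (\<lambda>t::real. (1 + t)\<^sup>2 * G + (1 + t)\<^sup>2 * t + (1 + t) * t)"
  have bound: "sqn M f \<le> ennreal (h t)" if t: "t > 0" for t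
  proof -
    obtain f' g' where [measurable]: "f' \<in> borel_measurable M" "g' \<in> borel_measurable N"
      and f': "sqn M (\<lambda>x. f x - f' x) \<le> ennreal (t\<^sup>2)"
      and g': "sqn N (\<lambda>x. g x - g' x) \<le> ennreal (t\<^sup>2)" and eq: "sqn M f' = sqn N g'"
      using approx[of "t\<^sup>2"] t by auto
    have tt: "(1 + 1 / t) * t\<^sup>2 = (1 + t) * t" using t by (simp add: field_simps power2_eq_square)
    have "sqn N g' \<le> ennreal (1 + t) * sqn N g + ennreal (1 + 1 / t) * sqn N (\<lambda>x. g' x - g x)"
      using sqn_add_le_weighted[of g N "\<lambda>x. g' x - g x", OF _ _ t] by simp
    also have "\<dots> \<le> ennreal (1 + t) * ennreal G + ennreal (1 + 1 / t) * ennreal (t\<^sup>2)"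
      using g' real by (intro add_mono mult_left_mono) (auto simp: sqn_commute[of N g'])
    also have "\<dots> = ennreal ((1 + t) * G + (1 + t) * t)"
      using t real by (simp flip: ennreal_mult ennreal_plus add: tt del: ennreal_plus)
    finally have *: "sqn M f' \<le> ennreal ((1 + t) * G + (1 + t) * t)" using eq by simp
    have "sqn M f \<le> ennreal (1 + t) * sqn M f' + ennreal (1 + 1 / t) * sqn M (\<lambda>x. f x - f' x)"
      using sqn_add_le_weighted[of f' M "\<lambda>x. f x - f' x", OF _ _ t] by simp
    also have "\<dots> \<le> ennreal (1 + t) * ennreal ((1 + t) * G + (1 + t) * t) +
        ennreal (1 + 1 / t) * ennreal (t\<^sup>2)"
      using f' * by (intro add_mono mult_left_mono) auto
    also have "\<dots> = ennreal (h t)"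
      using t real
      by (simp flip: ennreal_mult ennreal_plus add: tt del: ennreal_plus)
         (simp add: h_def algebra_simps power2_eq_square)
    finally show ?thesis .
  qed
  have "((\<lambda>t. ennreal (h t)) \<longlongrightarrow> ennreal (h 0)) (at_right 0)"
    unfolding h_def by (rule tendsto_ennrealI) (auto intro!: tendsto_eq_intros)
  moreover have "eventually (\<lambda>t. sqn M f \<le> ennreal (h t)) (at_right 0)"
    using bound eventually_at_right_less[of "0::real"] by (auto elim: eventually_mono)
  ultimately have "sqn M f \<le> ennreal (h 0)"
    by (rule tendsto_lowerbound) simp
  then show ?thesis using real by (simp add: h_def)
qed auto

section \<open>Finite linear combinations\<close>

inductive_set lspan :: "('a \<Rightarrow> complex) set \<Rightarrow> ('a \<Rightarrow> complex) set" for S where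
  lspan_zero: "(\<lambda>x. 0) \<in> lspan S"
| lspan_step: "f \<in> lspan S \<Longrightarrow> g \<in> S \<Longrightarrow> (\<lambda>x. f x + c * g x) \<in> lspan S"

lemma lspan_base: "g \<in> S \<Longrightarrow> g \<in> lspan S"
  using lspan_step[OF lspan_zero, of g S 1] by simp

lemma lspan_add:
  assumes "f \<in> lspan S" "g \<in> lspan S"
  shows "(\<lambda>x. f x + g x) \<in> lspan S"
  using assms(2)
proof induction
  case (lspan_step g k c)
  then show ?case using lspan.lspan_step[of "\<lambda>x. f x + g x" S k c] by (simp add: add.assoc)
qed (use assms in simp)

lemma lspan_scale: "f \<in> lspan S \<Longrightarrow> (\<lambda>x. d * f x) \<in> lspan S"
proof (induction rule: lspan.induct)
  case (lspan_step g k c)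
  then show ?case using lspan.lspan_step[of "\<lambda>x. d * g x" S k "d * c"] by (simp add: algebra_simps)
qed (simp add: lspan_zero)

lemma lspan_diff: "f \<in> lspan S \<Longrightarrow> g \<in> lspan S \<Longrightarrow> (\<lambda>x. f x - g x) \<in> lspan S"
  using lspan_add[of f S "\<lambda>x. (-1) * g x"] lspan_scale[of g S "-1"] by simp

lemma lspan_sum: "(\<And>a. a \<in> F \<Longrightarrow> f a \<in> lspan S) \<Longrightarrow> (\<lambda>x. \<Sum>a\<in>F. c a * f a x) \<in> lspan S"
  by (induction F rule: infinite_finite_induct) (auto simp: lspan_zero lspan_add lspan_scale)

lemma lspan_mult:
  assumes "f \<in> lspan S" and "\<And>g. g \<in> S \<Longrightarrow> (\<lambda>x. g x * k x) \<in> lspan T"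
  shows "(\<lambda>x. f x * k x) \<in> lspan T"
  using assms(1)
proof induction
  case (lspan_step f g c)
  then show ?case
    using lspan_add[of "\<lambda>x. f x * k x" T "\<lambda>x. c * (g x * k x)"] lspan_scale[OF assms(2)[of g], of c]
    by (simp add: algebra_simps)
qed (simp add: lspan_zero)

text \<open>\<open>lspan\<close> adds one multiple at a time and forgets indices. As
  \<open>e\<close> need not be injective and a generator may recur, an index is chosen for each
  summand and coefficients at the same index are merged.\<close>

lemma lspan_image_eq_sum:
  assumes "f \<in> lspan (e ` I)"
  shows "\<exists>F c. finite F \<and> F \<subseteq> I \<and> f = (\<lambda>x. \<Sum>a\<in>F. c a * e a x)"
  using assms
proof induction
  case lspan_zero
  show ?case by (intro exI[of _ "{}"]) auto
next
  case (lspan_step f g c)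
  then obtain F d a where F: "finite F" "F \<subseteq> I" "f = (\<lambda>x. \<Sum>a\<in>F. d a * e a x)"
    and a: "a \<in> I" "g = e a" by auto
  have "(\<lambda>x. f x + c * g x) =
      (\<lambda>x. \<Sum>b\<in>insert a F. ((if b \<in> F then d b else 0) + (if b = a then c else 0)) * e b x)"
  proof
    fix x
    have "(\<Sum>b\<in>insert a F. ((if b \<in> F then d b else 0) + (if b = a then c else 0)) * e b x) =
        (\<Sum>b\<in>insert a F. (if b \<in> F then d b * e b x else 0)) +
        (\<Sum>b\<in>insert a F. (if b = a then c * e b x else 0))"
      unfolding sum.distrib[symmetric] by (rule sum.cong) (auto simp: algebra_simps)
    also have "(\<Sum>b\<in>insert a F. (if b \<in> F then d b * e b x else 0)) = (\<Sum>b\<in>F. d b * e b x)"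
      using F(1) by (intro sum.mono_neutral_cong_right) auto
    also have "(\<Sum>b\<in>insert a F. (if b = a then c * e b x else 0)) = c * e a x"
      using F(1) by (simp add: sum.delta)
    finally show "f x + c * g x =
        (\<Sum>b\<in>insert a F. ((if b \<in> F then d b else 0) + (if b = a then c else 0)) * e b x)"
      using F a by simp
  qed
  then show ?case using F a
    by (intro exI[of _ "insert a F"]
        exI[of _ "\<lambda>b. (if b \<in> F then d b else 0) + (if b = a then c else 0)"]) auto
qed

lemma lspan_L2: "f \<in> lspan S \<Longrightarrow> S \<subseteq> L2 M \<Longrightarrow> f \<in> L2 M"
  by (induction rule: lspan.induct) (auto simp: L2_add L2_scale, auto simp: L2_iff sqn_def)

lemma lspan_integrable: "f \<in> lspan S \<Longrightarrow> S \<subseteq> {g. integrable M g} \<Longrightarrow> integrable M f"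
  by (induction rule: lspan.induct) auto

lemma lspan_inner_zero:
  assumes "f \<in> lspan S" "S \<subseteq> L2 M" "g \<in> L2 M" "\<And>k. k \<in> S \<Longrightarrow> L2_inner M k g = 0"
  shows "L2_inner M f g = 0"
  using assms(1)
proof induction
  case (lspan_step f k c)
  then show ?case using assms lspan_L2[of f S M] by (subst L2_inner_add_left) auto
qed (simp add: L2_inner_def)

text \<open>The factors 2 come from \<open>sqn_triangle\<close>: two errors of a quarter add up to
  \<open>\<epsilon>\<close>, and one strict bound makes the total strict.\<close>

lemma ennreal_quarters_less:
  assumes "a < ennreal (\<epsilon> / 4)" "b \<le> ennreal (\<epsilon> / 4)" "\<epsilon> > 0"
  shows "2 * a + 2 * b < ennreal \<epsilon>"
proof -
  obtain r where r: "a = ennreal r" "r \<ge> 0" using assms(1) by (cases a) auto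
  obtain s where s: "b = ennreal s" "s \<ge> 0" using assms(2) by (cases b) (auto simp: top_unique)
  have "2 * a + 2 * b = ennreal (2 * r + 2 * s)"
    using r s ennreal_mult[of 2 r] ennreal_mult[of 2 s] by simp
  moreover have "r < \<epsilon> / 4" "s \<le> \<epsilon> / 4" using assms r s by (auto simp: ennreal_less_iff)
  ultimately show ?thesis using r s assms(3) by (simp add: ennreal_less_iff del: ennreal_plus)
qed

section \<open>Closures of spans in the square norm\<close>

definition l2cl :: "'a measure \<Rightarrow> ('a \<Rightarrow> complex) set \<Rightarrow> ('a \<Rightarrow> complex) set" where
  "l2cl M S = {f \<in> borel_measurable M. \<forall>\<epsilon>>0. \<exists>s\<in>lspan S. sqn M (\<lambda>x. f x - s x) < ennreal \<epsilon>}"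

text \<open>The errors of \<open>f - g\<close> and \<open>g - s\<close> combine, so the closure is
  closed. This permits approximation in stages, through functions that are themselves only
  limits.\<close>

lemma l2clI:
  assumes "f \<in> borel_measurable M" "S \<subseteq> L2 M"
    and "\<And>\<epsilon>. \<epsilon> > 0 \<Longrightarrow> \<exists>g\<in>l2cl M S. sqn M (\<lambda>x. f x - g x) < ennreal \<epsilon>"
  shows "f \<in> l2cl M S"
  unfolding l2cl_def
proof (intro CollectI conjI allI impI assms(1))
  fix \<epsilon> :: real assume e: "\<epsilon> > 0"
  obtain g where g: "g \<in> l2cl M S" and fg: "sqn M (\<lambda>x. f x - g x) < ennreal (\<epsilon> / 4)"
    using assms(3)[of "\<epsilon> / 4"] e by auto
  obtain s where s: "s \<in> lspan S" and gs: "sqn M (\<lambda>x. g x - s x) < ennreal (\<epsilon> / 4)"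
    using g e by (auto simp: l2cl_def dest: spec[of _ "\<epsilon> / 4"])
  have "sqn M (\<lambda>x. f x - s x) \<le> 2 * sqn M (\<lambda>x. f x - g x) + 2 * sqn M (\<lambda>x. g x - s x)"
    using assms g lspan_L2[OF s assms(2)] by (intro sqn_triangle) (auto simp: l2cl_def L2_def)
  also have "\<dots> < ennreal \<epsilon>"
    using fg gs e by (intro ennreal_quarters_less) auto
  finally show "\<exists>s\<in>lspan S. sqn M (\<lambda>x. f x - s x) < ennreal \<epsilon>" using s by blast
qed

lemma lspan_subset_l2cl: "S \<subseteq> L2 M \<Longrightarrow> lspan S \<subseteq> l2cl M S"
proof
  fix s assume "S \<subseteq> L2 M" "s \<in> lspan S"
  moreover from this have "s \<in> L2 M" by (rule lspan_L2[rotated])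
  ultimately show "s \<in> l2cl M S"
    unfolding l2cl_def by (auto simp: L2_def sqn_def intro!: bexI[of _ s])
qed

lemma l2cl_add_scale:
  assumes f: "f \<in> l2cl M S" and g: "g \<in> l2cl M S" and S: "S \<subseteq> L2 M"
  shows "(\<lambda>x. f x + c * g x) \<in> l2cl M S"
  unfolding l2cl_def
proof (intro CollectI conjI allI impI)
  show "(\<lambda>x. f x + c * g x) \<in> borel_measurable M" using f g by (auto simp: l2cl_def)
  fix \<epsilon> :: real assume e: "\<epsilon> > 0"
  \<comment> \<open>Leaves \<open>(cmod c)\<^sup>2 * d \<le> \<epsilon> / 4\<close>; the summand 1
    covers \<open>c = 0\<close>.\<close>
  define d where "d = \<epsilon> / (4 * (1 + (cmod c)\<^sup>2))"
  have d: "d > 0" using e by (auto simp: d_def add_pos_nonneg)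
  obtain s where s: "s \<in> lspan S" and fs: "sqn M (\<lambda>x. f x - s x) < ennreal (\<epsilon> / 4)"
    using f e by (auto simp: l2cl_def dest: spec[of _ "\<epsilon> / 4"])
  obtain t where t: "t \<in> lspan S" and gt: "sqn M (\<lambda>x. g x - t x) < ennreal d"
    using g d by (auto simp: l2cl_def)
  have [measurable]: "s \<in> borel_measurable M" "t \<in> borel_measurable M"
      "f \<in> borel_measurable M" "g \<in> borel_measurable M"
    using f g lspan_L2[OF s S] lspan_L2[OF t S] by (auto simp: l2cl_def L2_def)
  have "sqn M (\<lambda>x. (f x + c * g x) - (s x + c * t x)) =
      sqn M (\<lambda>x. (f x - s x) + c * (g x - t x))" by (simp add: algebra_simps)
  also have "\<dots> \<le> 2 * sqn M (\<lambda>x. f x - s x) + 2 * (ennreal ((cmod c)\<^sup>2) * sqn M (\<lambda>x. g x - t x))"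
    by (subst sqn_scale[symmetric], simp, rule sqn_add_le) auto
  also have "\<dots> \<le> 2 * sqn M (\<lambda>x. f x - s x) + 2 * (ennreal ((cmod c)\<^sup>2) * ennreal d)"
    using gt by (intro add_mono mult_left_mono) auto
  also have "\<dots> \<le> 2 * sqn M (\<lambda>x. f x - s x) + 2 * ennreal (\<epsilon> / 4)"
  proof -
    have "(cmod c)\<^sup>2 * d \<le> \<epsilon> / 4"
      using e unfolding d_def by (simp add: divide_simps add_pos_nonneg)
    then show ?thesis using d
      by (intro add_mono mult_left_mono order_refl) (auto simp flip: ennreal_mult intro!: ennreal_leI)
  qed
  also have "\<dots> < ennreal \<epsilon>"
    using fs e by (intro ennreal_quarters_less) auto
  finally show "\<exists>s\<in>lspan S. sqn M (\<lambda>x. f x + c * g x - s x) < ennreal \<epsilon>"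
    using lspan_add[OF s lspan_scale[OF t, of c]] by (intro bexI[of _ "\<lambda>x. s x + c * t x"])
qed

lemma lspan_l2cl:
  assumes "f \<in> lspan T" "T \<subseteq> l2cl M S" "S \<subseteq> L2 M"
  shows "f \<in> l2cl M S"
  using assms(1)
proof induction
  case lspan_zero
  then show ?case using lspan_subset_l2cl[OF assms(3)] lspan.lspan_zero by blast
qed (use assms l2cl_add_scale in blast)

section \<open>Approximation by simple functions\<close>

definition fin_inds :: "'a measure \<Rightarrow> ('a \<Rightarrow> complex) set" where
  "fin_inds M = {indicator A | A. A \<in> sets M \<and> emeasure M A < \<infinity>}"

lemma fin_inds_L2: "fin_inds M \<subseteq> L2 M"
  by (auto simp: fin_inds_def L2_iff sqn_indicator)

lemma fin_inds_integrable: "fin_inds M \<subseteq> {f. integrable M f}"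
proof -
  have "integrable M (indicator A :: 'a \<Rightarrow> complex)" if "A \<in> sets M" "emeasure M A < \<infinity>" for A
  proof (rule integrableI_bounded)
    have "(\<integral>\<^sup>+x. ennreal (norm (indicator A x :: complex)) \<partial>M) = (\<integral>\<^sup>+x. indicator A x \<partial>M)"
      by (rule nn_integral_cong) (simp split: split_indicator)
    then show "(\<integral>\<^sup>+x. ennreal (norm (indicator A x :: complex)) \<partial>M) < \<infinity>" using that by simp
  qed (use that in auto)
  then show ?thesis by (auto simp: fin_inds_def)
qed

text \<open>One sequence of simple functions, dominated by \<open>2 * cmod (f x)\<close>, converges
  in both norms by dominated convergence. A common approximant is wanted because the Fourier
  integral is continuous for the integral norm, while isometry concerns the square norm.\<close>

lemma L2_approx_fin_inds:
  assumes f: "f \<in> L2 M" and e: "\<epsilon> > 0"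
  shows "\<exists>s\<in>lspan (fin_inds M). sqn M (\<lambda>x. f x - s x) < ennreal \<epsilon> \<and>
    (integrable M f \<longrightarrow> (\<integral>\<^sup>+x. norm (f x - s x) \<partial>M) < ennreal \<epsilon>)"
proof -
  have fm[measurable]: "f \<in> borel_measurable M" using f by (simp add: L2_def)
  obtain F where F: "\<And>i. simple_function M (F i)"
    and lim: "\<And>x. x \<in> space M \<Longrightarrow> (\<lambda>i. F i x) \<longlonglongrightarrow> f x"
    and bd: "\<And>i x. x \<in> space M \<Longrightarrow> dist (F i x) 0 \<le> 2 * dist (f x) 0"
    using borel_measurable_implies_sequence_metric[OF fm, of 0] by blast
  have Fm[measurable]: "F i \<in> borel_measurable M" for i
    using F by (rule borel_measurable_simple_function)
  have bd3: "cmod (f x - F i x) \<le> 3 * cmod (f x)" if "x \<in> space M" for i x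
    using bd[OF that, of i] norm_triangle_ineq4[of "f x" "F i x"] by simp
  have lim0: "(\<lambda>i. cmod (f x - F i x)) \<longlonglongrightarrow> 0" if "x \<in> space M" for x
    using tendsto_norm[OF tendsto_diff[OF tendsto_const[of "f x"] lim[OF that]]] by simp
  have "(\<lambda>i. \<integral>\<^sup>+x. ennreal ((cmod (f x - F i x))\<^sup>2) \<partial>M) \<longlonglongrightarrow> (\<integral>\<^sup>+x. 0 \<partial>M)"
  proof (rule nn_integral_dominated_convergence[where w = "\<lambda>x. ennreal (9 * (cmod (f x))\<^sup>2)"])
    show "AE x in M. ennreal ((cmod (f x - F i x))\<^sup>2) \<le> ennreal (9 * (cmod (f x))\<^sup>2)" for i
    proof (intro AE_I2 ennreal_leI)
      fix x assume "x \<in> space M"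
      then have "(cmod (f x - F i x))\<^sup>2 \<le> (3 * cmod (f x))\<^sup>2" using bd3 by (intro power_mono) auto
      then show "(cmod (f x - F i x))\<^sup>2 \<le> 9 * (cmod (f x))\<^sup>2" by (simp add: power_mult_distrib)
    qed
    have "(\<integral>\<^sup>+x. ennreal (9 * (cmod (f x))\<^sup>2) \<partial>M) = 9 * sqn M f"
      unfolding sqn_def by (simp add: ennreal_mult nn_integral_cmult)
    then show "(\<integral>\<^sup>+x. ennreal (9 * (cmod (f x))\<^sup>2) \<partial>M) < \<infinity>"
      using f by (simp add: L2_iff ennreal_mult_less_top)
    show "AE x in M. (\<lambda>i. ennreal ((cmod (f x - F i x))\<^sup>2)) \<longlonglongrightarrow> 0"
    proof (intro AE_I2)
      fix x assume "x \<in> space M"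
      from tendsto_power[OF lim0[OF this], of 2]
      show "(\<lambda>i. ennreal ((cmod (f x - F i x))\<^sup>2)) \<longlonglongrightarrow> 0" by (simp flip: ennreal_0)
    qed
  qed auto
  then have ev2: "eventually (\<lambda>i. sqn M (\<lambda>x. f x - F i x) < ennreal \<epsilon>) sequentially"
    unfolding sqn_def using e by (intro order_tendstoD(2)) auto
  have ev1: "eventually (\<lambda>i. integrable M f \<longrightarrow> (\<integral>\<^sup>+x. norm (f x - F i x) \<partial>M) < ennreal \<epsilon>) sequentially"
  proof (cases "integrable M f")
    case True
    have "(\<lambda>i. \<integral>\<^sup>+x. ennreal (cmod (f x - F i x)) \<partial>M) \<longlonglongrightarrow> (\<integral>\<^sup>+x. 0 \<partial>M)"
    proof (rule nn_integral_dominated_convergence[where w = "\<lambda>x. ennreal (3 * cmod (f x))"])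
      show "AE x in M. ennreal (cmod (f x - F i x)) \<le> ennreal (3 * cmod (f x))" for i
        using bd3 by (intro AE_I2 ennreal_leI) auto
      have "integrable M (\<lambda>x. 3 * f x)" using True by auto
      then show "(\<integral>\<^sup>+x. ennreal (3 * cmod (f x)) \<partial>M) < \<infinity>"
        by (simp add: integrable_iff_bounded norm_mult)
      show "AE x in M. (\<lambda>i. ennreal (cmod (f x - F i x))) \<longlonglongrightarrow> 0"
        using lim0 by (intro AE_I2) (simp flip: ennreal_0)
    qed auto
    then have "eventually (\<lambda>i. (\<integral>\<^sup>+x. norm (f x - F i x) \<partial>M) < ennreal \<epsilon>) sequentially"
      using e by (intro order_tendstoD(2)) auto
    then show ?thesis by (auto elim: eventually_mono)
  qed auto
  obtain i where i: "sqn M (\<lambda>x. f x - F i x) < ennreal \<epsilon>"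
      "integrable M f \<longrightarrow> (\<integral>\<^sup>+x. norm (f x - F i x) \<partial>M) < ennreal \<epsilon>"
    using eventually_conj[OF ev1 ev2] eventually_happens'[OF sequentially_bot] by blast
  \<comment> \<open>The value 0 is left out: its level set may have infinite measure.\<close>
  define Y where "Y = F i ` space M - {0}"
  define s where "s = (\<lambda>x. \<Sum>y\<in>Y. y * indicator (F i -` {y} \<inter> space M) x :: complex)"
  have finY: "finite Y" using F[of i] by (simp add: Y_def simple_function_def)
  have s_eq: "s x = F i x" if x: "x \<in> space M" for x
  proof -
    have "s x = (\<Sum>y\<in>Y. if F i x = y then y else 0)"
      unfolding s_def using x by (intro sum.cong) (auto simp: indicator_def)
    then show ?thesis using finY x by (auto simp: Y_def)
  qed
  have "s \<in> lspan (fin_inds M)"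
    unfolding s_def
  proof (rule lspan_sum)
    fix y assume y: "y \<in> Y"
    have meas: "F i -` {y} \<inter> space M \<in> sets M" using F[of i] by (simp add: simple_functionD)
    \<comment> \<open>Chebyshev: on the level set of \<open>y\<close> the value
      \<open>cmod y\<close> is at most \<open>2 * cmod (f x)\<close>, so this set has finite
      measure, \<open>y\<close> being nonzero.\<close>
    have "ennreal ((cmod y)\<^sup>2) * emeasure M (F i -` {y} \<inter> space M) =
        sqn M (\<lambda>x. y * indicator (F i -` {y} \<inter> space M) x)"
      using meas by (simp add: sqn_scale sqn_indicator)
    also have "\<dots> \<le> (\<integral>\<^sup>+x. ennreal (4 * (cmod (f x))\<^sup>2) \<partial>M)"
      unfolding sqn_def
    proof (intro nn_integral_mono ennreal_leI)
      fix x assume x: "x \<in> space M"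
      have "(cmod (F i x))\<^sup>2 \<le> (2 * cmod (f x))\<^sup>2" using bd[OF x, of i] by (intro power_mono) auto
      then show "(cmod (y * indicator (F i -` {y} \<inter> space M) x))\<^sup>2 \<le> 4 * (cmod (f x))\<^sup>2"
        by (auto simp: indicator_def power_mult_distrib)
    qed
    also have "\<dots> = 4 * sqn M f" unfolding sqn_def by (simp add: ennreal_mult nn_integral_cmult)
    also have "\<dots> < \<infinity>" using f by (simp add: L2_iff ennreal_mult_less_top)
    finally have "emeasure M (F i -` {y} \<inter> space M) < \<infinity>"
      using y by (auto simp: Y_def ennreal_mult_less_top)
    then show "indicator (F i -` {y} \<inter> space M) \<in> lspan (fin_inds M)"
      using meas by (intro lspan_base) (auto simp: fin_inds_def)
  qed
  moreover have "sqn M (\<lambda>x. f x - s x) = sqn M (\<lambda>x. f x - F i x)"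
    by (rule sqn_cong) (simp add: s_eq)
  moreover have "(\<integral>\<^sup>+x. norm (f x - s x) \<partial>M) = (\<integral>\<^sup>+x. norm (f x - F i x) \<partial>M)"
    by (rule nn_integral_cong) (simp add: s_eq)
  ultimately show ?thesis using i by (intro bexI[of _ s]) auto
qed

lemma L2_subset_l2cl:
  assumes "S \<subseteq> L2 M" "fin_inds M \<subseteq> l2cl M S"
  shows "L2 M \<subseteq> l2cl M S"
proof
  fix f assume f: "f \<in> L2 M"
  show "f \<in> l2cl M S"
  proof (rule l2clI[OF _ assms(1)])
    show "f \<in> borel_measurable M" using f by (simp add: L2_def)
    fix \<epsilon> :: real assume "\<epsilon> > 0"
    from L2_approx_fin_inds[OF f this] obtain s where
      "s \<in> lspan (fin_inds M)" "sqn M (\<lambda>x. f x - s x) < ennreal \<epsilon>" by auto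
    then show "\<exists>g\<in>l2cl M S. sqn M (\<lambda>x. f x - g x) < ennreal \<epsilon>"
      using lspan_l2cl[OF _ assms(2,1)] by (intro bexI[of _ s]) auto
  qed
qed

text \<open>The squared distance of two indicators is the measure of the symmetric
  difference.\<close>

lemma indicator_in_l2clI:
  assumes A: "A \<in> sets M" and S: "S \<subseteq> L2 M"
    and ap: "\<And>\<epsilon>. \<epsilon> > 0 \<Longrightarrow> \<exists>D\<in>sets M. (indicator D :: 'a \<Rightarrow> complex) \<in> l2cl M S \<and>
      emeasure M (sym_diff A D) < ennreal \<epsilon>"
  shows "(indicator A :: 'a \<Rightarrow> complex) \<in> l2cl M S"
proof (rule l2clI[OF _ S])
  fix \<epsilon> :: real assume "\<epsilon> > 0"
  from ap[OF this] obtain D where D: "D \<in> sets M" "(indicator D :: 'a \<Rightarrow> complex) \<in> l2cl M S"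
    "emeasure M (sym_diff A D) < ennreal \<epsilon>" by auto
  have "sqn M (\<lambda>x. indicator A x - indicator D x) = sqn M (indicator (sym_diff A D))"
    unfolding sqn_def by (rule nn_integral_cong) (auto simp: indicator_def)
  also have "\<dots> = emeasure M (sym_diff A D)" using A D by (intro sqn_indicator) auto
  finally show "\<exists>g\<in>l2cl M S. sqn M (\<lambda>x. indicator A x - g x) < ennreal \<epsilon>"
    using D by (intro bexI[of _ "indicator D"]) auto
qed (use A in auto)

lemma lspan_mono: "S \<subseteq> T \<Longrightarrow> lspan S \<subseteq> lspan T"
proof
  fix f assume "f \<in> lspan S" "S \<subseteq> T"
  then show "f \<in> lspan T"
    by induction (auto intro!: lspan.intros)
qed

lemma l2cl_mono: "S \<subseteq> T \<Longrightarrow> l2cl M S \<subseteq> l2cl M T"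
  using lspan_mono[of S T] unfolding l2cl_def by blast

lemma l2clD:
  "f \<in> l2cl M S \<Longrightarrow> \<epsilon> > 0 \<Longrightarrow> \<exists>s\<in>lspan S. sqn M (\<lambda>x. f x - s x) < ennreal \<epsilon>"
  by (simp add: l2cl_def)

lemma ennreal_eq_0I: "(\<And>\<epsilon>::real. \<epsilon> > 0 \<Longrightarrow> a \<le> ennreal \<epsilon>) \<Longrightarrow> a = 0"
  by (rule antisym[OF ennreal_le_epsilon]) auto

section \<open>The Vilenkin group\<close>

text \<open>For \<open>x\<close> in the group this is the coset of \<open>nbhd p l\<close> through
  \<open>x\<close> (see \<open>vadd_image_nbhd\<close>), described by digits rather than by addition
  so that nesting and intersection are immediate.\<close>

definition cyl :: "nat \<Rightarrow> (int \<Rightarrow> int) \<Rightarrow> int \<Rightarrow> (int \<Rightarrow> int) set" where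
  "cyl p x l = {y \<in> vilenkin p. \<forall>j\<le>l. y j = x j}"

text \<open>The standard character of the integers modulo \<open>p\<close>. With integer arguments,
  identities for pairings reduce to congruences modulo \<open>p\<close>.\<close>

definition ep :: "nat \<Rightarrow> int \<Rightarrow> complex" where
  "ep p n = exp (2 * complex_of_real pi * \<i> / of_nat p * of_int n)"

lemma pairing_ep: "pairing p x \<omega> = ep p (\<Sum>j | x j * \<omega> (1 - j) \<noteq> 0. x j * \<omega> (1 - j))"
  by (simp add: pairing_def ep_def)

lemma ep_add: "ep p (m + n) = ep p m * ep p n"
  by (simp add: ep_def distrib_left exp_add)

lemma ep_0 [simp]: "ep p 0 = 1"
  by (simp add: ep_def)

lemma norm_ep [simp]: "cmod (ep p n) = 1"
proof -
  have "ep p n = exp (\<i> * of_real (2 * pi / real p * real_of_int n))"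
    by (simp add: ep_def field_simps)
  then show ?thesis by (simp only: norm_exp_i_times)
qed

lemma ep_eq_1_iff:
  assumes "p > 0"
  shows "ep p n = 1 \<longleftrightarrow> int p dvd n"
proof -
  have "ep p n = 1 \<longleftrightarrow> (\<exists>m::int. 2 * pi / real p * real_of_int n = of_int (2 * m) * pi)"
    unfolding ep_def exp_eq_1 by simp
  also have "\<dots> \<longleftrightarrow> (\<exists>m. real_of_int n = real_of_int (m * int p))"
    using assms by (simp add: field_simps)
  also have "\<dots> \<longleftrightarrow> int p dvd n"
    unfolding of_int_eq_iff by (auto simp: dvd_def mult.commute)
  finally show ?thesis .
qed

lemma ep_mod:
  assumes "p > 0"
  shows "ep p (n mod int p) = ep p n"
proof -
  have "ep p n = ep p (int p * (n div int p)) * ep p (n mod int p)"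
    by (simp flip: ep_add)
  also have "ep p (int p * (n div int p)) = 1"
    using assms by (simp add: ep_eq_1_iff)
  finally show ?thesis by simp
qed

lemma ep_cong: "p > 0 \<Longrightarrow> a mod int p = b mod int p \<Longrightarrow> ep p a = ep p b"
  by (metis ep_mod)

lemma norm_pairing [simp]: "cmod (pairing p x \<omega>) = 1"
  by (simp add: pairing_ep)

lemma pairing_mult_cnj [simp]: "pairing p x \<omega> * cnj (pairing p x \<omega>) = 1"
  by (simp add: complex_norm_square[symmetric])

lemma pairing_cong:
  "(\<And>j. x j * \<omega> (1 - j) = x' j * \<omega>' (1 - j)) \<Longrightarrow> pairing p x \<omega> = pairing p x' \<omega>'"
  by (simp add: pairing_def)

text \<open>The reflection \<open>j \<mapsto> 1 - j\<close> of the summation index exchanges the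
  roles of the group and its dual.\<close>

lemma pairing_commute: "pairing p x \<omega> = pairing p \<omega> x"
  unfolding pairing_ep
  by (intro arg_cong[where f = "ep p"] sum.reindex_bij_witness[of _ "\<lambda>j. 1 - j" "\<lambda>j. 1 - j"])
     (auto simp: mult.commute)

text \<open>Translating the summation index moves the shift to the other argument: \<open>A\<close>
  and \<open>B\<close> are adjoint for the pairing.\<close>

lemma pairing_shift: "pairing p (shift n x) \<omega> = pairing p x (shift n \<omega>)"
  unfolding pairing_ep shift_def
  by (intro arg_cong[where f = "ep p"] sum.reindex_bij_witness[of _ "\<lambda>j. j - n" "\<lambda>j. j + n"])
     (auto simp: algebra_simps)

lemma vilenkin_bound: "x \<in> vilenkin p \<Longrightarrow> \<exists>k. \<forall>j<k. x j = 0"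
  by (simp add: vilenkin_def)

lemma vilenkin_mod: "x \<in> vilenkin p \<Longrightarrow> x j mod int p = x j"
  by (auto simp: vilenkin_def intro: mod_pos_pos_trivial)

lemma vilenkin_ltD: "x \<in> vilenkin p \<Longrightarrow> 0 \<le> x j \<and> x j < int p"
  by (auto simp: vilenkin_def)

lemma shift_vilenkin [simp]: "shift n x \<in> vilenkin p \<longleftrightarrow> x \<in> vilenkin p"
proof -
  have *: "shift n x \<in> vilenkin p" if "x \<in> vilenkin p" for x n
  proof -
    from vilenkin_bound[OF that] obtain k where "\<forall>j<k. x j = 0" ..
    then have "\<forall>j<k - n. shift n x j = 0" by (simp add: shift_def)
    then show ?thesis using that unfolding vilenkin_def by (auto simp: shift_def)
  qed
  have "shift (- n) (shift n x) = x" by (simp add: shift_def)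
  then show ?thesis using *[of x n] *[of "shift n x" "- n"] by auto
qed

lemma shift_shift [simp]: "shift m (shift n x) = shift (m + n) x"
  by (simp add: shift_def add_ac)

lemma shift_0 [simp]: "shift 0 x = x"
  by (simp add: shift_def)

lemma shift_image_eq: "shift n ` E = shift (- n) -` E"
proof (intro equalityI subsetI)
  fix y assume "y \<in> shift (- n) -` E"
  then show "y \<in> shift n ` E" by (intro image_eqI[of _ _ "shift (- n) y"]) simp_all
qed auto

lemma nbhd_eq_cyl: "nbhd p l = cyl p (\<lambda>_. 0) l"
  by (simp add: nbhd_def cyl_def)

lemma cyl_subset: "cyl p x l \<subseteq> vilenkin p"
  by (auto simp: cyl_def)

lemma self_in_cyl: "x \<in> vilenkin p \<Longrightarrow> x \<in> cyl p x l"
  by (simp add: cyl_def)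

lemma cyl_eq: "y \<in> cyl p x l \<Longrightarrow> cyl p y l = cyl p x l"
  by (auto simp: cyl_def)

lemma cyl_mono: "l \<le> m \<Longrightarrow> cyl p x m \<subseteq> cyl p x l"
  by (auto simp: cyl_def)

lemma cyl_Int:
  assumes "l \<ge> m" "x \<in> vilenkin p"
  shows "cyl p x l \<inter> cyl p y m = (if x \<in> cyl p y m then cyl p x l else {})"
  using assms by (auto simp: cyl_def)

lemma shift_in_cyl: "shift n y \<in> cyl p x l \<longleftrightarrow> y \<in> cyl p (shift (- n) x) (l + n)"
proof -
  have "(\<forall>j\<le>l. shift n y j = x j) \<longleftrightarrow> (\<forall>j\<le>l + n. y j = shift (- n) x j)"
  proof safe
    fix j assume "\<forall>j\<le>l. shift n y j = x j" "j \<le> l + n"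
    then show "y j = shift (- n) x j" by (auto simp: shift_def dest: spec[of _ "j - n"])
  next
    fix j assume "\<forall>j\<le>l + n. y j = shift (- n) x j" "j \<le> l"
    then show "shift n y j = x j" by (auto simp: shift_def dest: spec[of _ "j + n"])
  qed
  then show ?thesis by (simp add: cyl_def)
qed

text \<open>A first argument vanishing below \<open>k\<close> meets only the digits of
  \<open>\<omega>\<close> at places up to \<open>1 - k\<close>. Hence characters are locally
  constant.\<close>

lemma pairing_cyl:
  assumes "\<forall>j<k. x j = 0" "l \<ge> 1 - k" "\<omega>' \<in> cyl p \<omega> l"
  shows "pairing p x \<omega>' = pairing p x \<omega>"
proof (rule pairing_cong)
  fix j show "x j * \<omega>' (1 - j) = x j * \<omega> (1 - j)"
    using assms by (cases "j < k") (auto simp: cyl_def)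
qed

text \<open>The representative in \<open>nbhd p 0\<close> of a coset modulo \<open>H_perp p\<close>;
  together with \<open>int_part\<close> it splits a sequence into its components in
  \<open>nbhd p 0\<close> and \<open>H p\<close>.\<close>

definition frac_part :: "(int \<Rightarrow> int) \<Rightarrow> int \<Rightarrow> int" where
  "frac_part x = (\<lambda>j. if j > 0 then x j else 0)"

definition int_part :: "(int \<Rightarrow> int) \<Rightarrow> int \<Rightarrow> int" where
  "int_part x = (\<lambda>j. if j > 0 then 0 else x j)"

lemma frac_part_idem: "x \<in> nbhd p 0 \<Longrightarrow> frac_part x = x"
  by (auto simp: nbhd_def frac_part_def)

locale vilenkin_group =
  fixes p :: nat
  assumes prime_p: "prime p"
begin

abbreviation "V \<equiv> vilenkin p"

lemma p_pos: "p > 0" and p_gt_1: "p > 1"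
  using prime_p prime_gt_0_nat prime_gt_1_nat by auto

lemma zero_in_V [simp]: "(\<lambda>_. 0) \<in> V"
  using p_pos by (simp add: vilenkin_def)

lemma vadd_in_V [simp]: assumes "x \<in> V" "y \<in> V" shows "vadd p x y \<in> V"
proof -
  obtain k l where "\<forall>j<k. x j = 0" "\<forall>j<l. y j = 0"
    using assms vilenkin_bound by metis
  then have "\<forall>j<min k l. vadd p x y j = 0" by (simp add: vadd_def)
  then have "\<exists>k. \<forall>j<k. vadd p x y j = 0" by (rule exI)
  then show ?thesis using p_pos by (simp add: vilenkin_def) (simp add: vadd_def)
qed

lemma vminus_in_V [simp]: assumes "x \<in> V" "y \<in> V" shows "vminus p x y \<in> V"
proof -
  obtain k l where "\<forall>j<k. x j = 0" "\<forall>j<l. y j = 0"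
    using assms vilenkin_bound by metis
  then have "\<forall>j<min k l. vminus p x y j = 0" by (simp add: vminus_def)
  then have "\<exists>k. \<forall>j<k. vminus p x y j = 0" by (rule exI)
  then show ?thesis using p_pos by (simp add: vilenkin_def) (simp add: vminus_def)
qed

lemma frac_part_in_V [simp]: "x \<in> V \<Longrightarrow> frac_part x \<in> V"
  by (auto simp: vilenkin_def frac_part_def)

lemma frac_part_in_nbhd: "x \<in> V \<Longrightarrow> frac_part x \<in> nbhd p 0"
  by (simp add: nbhd_def) (simp add: frac_part_def)

lemma int_part_in_V [simp]: "x \<in> V \<Longrightarrow> int_part x \<in> V"
  by (auto simp: vilenkin_def int_part_def)

lemma int_part_in_H: "x \<in> V \<Longrightarrow> int_part x \<in> H p"
  by (simp add: H_def) (simp add: int_part_def)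

lemma H_subset_V: "H p \<subseteq> V"
  by (auto simp: H_def)

lemma H_perp_eq_H: "H_perp p = H p"
  by (simp add: H_perp_def H_def)

lemma zero_in_H [simp]: "(\<lambda>_. 0) \<in> H p"
  by (simp add: H_def)

lemma vadd_in_H: "h \<in> H p \<Longrightarrow> k \<in> H p \<Longrightarrow> vadd p h k \<in> H p"
  by (simp add: H_def, simp add: vadd_def)

lemma vminus_in_H: "h \<in> H p \<Longrightarrow> k \<in> H p \<Longrightarrow> vminus p h k \<in> H p"
  by (simp add: H_def, simp add: vminus_def)

lemma vadd_vminus: "x \<in> V \<Longrightarrow> vadd p y (vminus p x y) = x"
  by (auto simp: vadd_def vminus_def mod_simps vilenkin_mod)

lemma vminus_vadd: "x \<in> V \<Longrightarrow> vminus p (vadd p y x) y = x"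
  by (auto simp: vadd_def vminus_def mod_simps vilenkin_mod)

lemma vminus_vminus_0: "x \<in> V \<Longrightarrow> vminus p (\<lambda>_. 0) (vminus p (\<lambda>_. 0) x) = x"
  by (auto simp: vminus_def mod_simps vilenkin_mod)

lemma vminus_eq_0_iff: "x \<in> V \<Longrightarrow> y \<in> V \<Longrightarrow> vminus p x y = (\<lambda>_. 0) \<longleftrightarrow> x = y"
  using vadd_vminus[of x y] by (auto simp: vadd_def vilenkin_mod vminus_def fun_eq_iff)

lemma vadd_image_eq:
  assumes "E \<subseteq> V" "x \<in> V"
  shows "vadd p x ` E = {y \<in> V. vminus p y x \<in> E}"
proof (intro equalityI subsetI)
  fix y assume "y \<in> {y \<in> V. vminus p y x \<in> E}"
  then show "y \<in> vadd p x ` E" by (intro image_eqI[of _ _ "vminus p y x"]) (auto simp: vadd_vminus)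
next
  fix y assume "y \<in> vadd p x ` E"
  then obtain z where "z \<in> E" "y = vadd p x z" by auto
  then show "y \<in> {y \<in> V. vminus p y x \<in> E}"
    using assms vminus_vadd[of z x] by (simp add: subset_iff)
qed

lemma vadd_inj: "x \<in> V \<Longrightarrow> inj_on (vadd p x) V"
  by (metis inj_onI vminus_vadd)

lemma vadd_in_cyl:
  assumes "h \<in> V" "y \<in> V" "x \<in> V"
  shows "vadd p h y \<in> cyl p x l \<longleftrightarrow> y \<in> cyl p (vminus p x h) l"
proof -
  have "vadd p h y j = x j \<longleftrightarrow> y j = vminus p x h j" for j
  proof -
    have "(h j + y j) mod int p = x j \<longleftrightarrow> (x j - h j) mod int p = y j"
      using vilenkin_mod[OF assms(2), of j] vilenkin_mod[OF assms(3), of j]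
      by (smt (verit) mod_add_right_eq mod_diff_left_eq)
    then show ?thesis by (auto simp: vadd_def vminus_def)
  qed
  then show ?thesis using assms by (simp add: cyl_def)
qed

lemma vminus_in_cyl_0:
  assumes "x \<in> V" "y \<in> V"
  shows "vminus p y x \<in> cyl p (\<lambda>_. 0) l \<longleftrightarrow> y \<in> cyl p x l"
proof -
  have "vminus p y x j = 0 \<longleftrightarrow> y j = x j" for j
  proof -
    have "(y j - x j) mod int p = 0 \<longleftrightarrow> y j mod int p = x j mod int p"
      by (simp add: mod_eq_dvd_iff dvd_eq_mod_eq_0)
    then show ?thesis using vilenkin_mod assms by (simp add: vminus_def)
  qed
  then show ?thesis using assms by (simp add: cyl_def)
qed

lemma vadd_image_nbhd:
  assumes "x \<in> V"
  shows "vadd p x ` nbhd p l = cyl p x l"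
proof -
  have "nbhd p l \<subseteq> V" by (auto simp: nbhd_def)
  then have "vadd p x ` nbhd p l = {y \<in> V. vminus p y x \<in> cyl p (\<lambda>_. 0) l}"
    using assms by (simp add: vadd_image_eq nbhd_eq_cyl)
  also have "\<dots> = cyl p x l"
    using vminus_in_cyl_0[OF assms] cyl_subset by blast
  finally show ?thesis .
qed

text \<open>The defining sum runs over a support that changes with the arguments; a common interval
  of summation makes the exponents of different pairings comparable.\<close>

lemma pairing_eq_sum:
  assumes "\<forall>j<k. x j = 0" "\<forall>j<l. \<omega> j = 0"
  shows "pairing p x \<omega> = ep p (\<Sum>j\<in>{k..1 - l}. x j * \<omega> (1 - j))"
proof -
  have "x j * \<omega> (1 - j) = 0" if "j \<notin> {k..1 - l}" for j
    using that assms by (cases "j < k") auto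
  then have "{j. x j * \<omega> (1 - j) \<noteq> 0} \<subseteq> {k..1 - l}" by blast
  then have "(\<Sum>j | x j * \<omega> (1 - j) \<noteq> 0. x j * \<omega> (1 - j)) = (\<Sum>j\<in>{k..1 - l}. x j * \<omega> (1 - j))"
    by (intro sum.mono_neutral_left) auto
  then show ?thesis by (simp add: pairing_ep)
qed

lemma pairing_vadd:
  assumes "x \<in> V" "y \<in> V" "\<omega> \<in> V"
  shows "pairing p (vadd p x y) \<omega> = pairing p x \<omega> * pairing p y \<omega>"
proof -
  obtain k k' l where k: "\<forall>j<k. x j = 0" "\<forall>j<k'. y j = 0" and l: "\<forall>j<l. \<omega> j = 0"
    using assms vilenkin_bound by metis
  define m where "m = min k k'"
  have m: "\<forall>j<m. x j = 0" "\<forall>j<m. y j = 0" "\<forall>j<m. vadd p x y j = 0"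
    using k by (auto simp: m_def vadd_def)
  have "(\<Sum>j\<in>{m..1 - l}. vadd p x y j * \<omega> (1 - j)) mod int p =
      (\<Sum>j\<in>{m..1 - l}. (x j + y j) * \<omega> (1 - j)) mod int p"
    by (subst (1 2) mod_sum_eq[symmetric]) (simp add: vadd_def mod_mult_left_eq)
  also have "(\<Sum>j\<in>{m..1 - l}. (x j + y j) * \<omega> (1 - j)) =
      (\<Sum>j\<in>{m..1 - l}. x j * \<omega> (1 - j)) + (\<Sum>j\<in>{m..1 - l}. y j * \<omega> (1 - j))"
    by (simp add: distrib_right sum.distrib)
  finally show ?thesis
    using m l p_pos by (simp add: pairing_eq_sum flip: ep_add cong: ep_cong)
qed

lemma pairing_0_left [simp]: "pairing p (\<lambda>_. 0) \<omega> = 1"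
  by (simp add: pairing_ep)

lemma pairing_vminus:
  assumes "x \<in> V" "y \<in> V" "\<omega> \<in> V"
  shows "pairing p (vminus p x y) \<omega> = pairing p x \<omega> * cnj (pairing p y \<omega>)"
proof -
  have "pairing p x \<omega> = pairing p y \<omega> * pairing p (vminus p x y) \<omega>"
    using assms by (simp flip: pairing_vadd add: vadd_vminus)
  then have "pairing p x \<omega> * cnj (pairing p y \<omega>) =
      pairing p (vminus p x y) \<omega> * (pairing p y \<omega> * cnj (pairing p y \<omega>))"
    by (simp add: mult_ac)
  then show ?thesis by simp
qed

lemma pairing_vadd_right:
  "x \<in> V \<Longrightarrow> y \<in> V \<Longrightarrow> \<omega> \<in> V \<Longrightarrow> pairing p \<omega> (vadd p x y) = pairing p \<omega> x * pairing p \<omega> y"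
  using pairing_vadd by (simp add: pairing_commute[of p \<omega>])

lemma pairing_vminus_right:
  "x \<in> V \<Longrightarrow> y \<in> V \<Longrightarrow> \<omega> \<in> V \<Longrightarrow> pairing p \<omega> (vminus p x y) = pairing p \<omega> x * cnj (pairing p \<omega> y)"
  using pairing_vminus by (simp add: pairing_commute[of p \<omega>])

text \<open>For \<open>j > l\<close> the matching place satisfies \<open>1 - j \<le> - l\<close>, so
  one factor of each product vanishes: the two subgroups annihilate each other.\<close>

lemma pairing_eq_1:
  assumes "x \<in> nbhd p l" "\<omega> \<in> nbhd p (- l)"
  shows "pairing p x \<omega> = 1"
proof -
  have "x j * \<omega> (1 - j) = 0" for j using assms by (cases "j \<le> l") (auto simp: nbhd_def)
  then show ?thesis by (simp add: pairing_ep)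
qed

text \<open>\<open>h\<close> vanishes at positive places, so only places
  \<open>1 - j \<ge> 1\<close> of \<open>\<omega>\<close> are read. Characters from
  \<open>H p\<close> are thus functions on the quotient by \<open>H_perp p\<close>.\<close>

lemma pairing_frac_part:
  assumes "h \<in> H p" "\<omega> \<in> V"
  shows "pairing p h (frac_part \<omega>) = pairing p h \<omega>"
  using assms by (intro pairing_cong) (auto simp: H_def frac_part_def)

lemma pairing_frac_part_int_part:
  assumes "k \<in> V" "\<omega> \<in> V"
  shows "pairing p k (frac_part \<omega>) = pairing p (int_part k) \<omega>"
  by (intro pairing_cong) (auto simp: int_part_def frac_part_def)

lemma frac_part_vadd:
  assumes "h \<in> H p" "\<omega> \<in> V"
  shows "frac_part (vadd p h \<omega>) = frac_part \<omega>"
  using assms vilenkin_mod[OF assms(2)] by (auto simp: frac_part_def vadd_def H_def)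

definition single :: "int \<Rightarrow> int \<Rightarrow> int \<Rightarrow> int" where
  "single i a = (\<lambda>j. if j = i then a else 0)"

lemma single_in_V [simp]: "0 \<le> a \<Longrightarrow> a < int p \<Longrightarrow> single i a \<in> V"
proof -
  assume "0 \<le> a" "a < int p"
  moreover have "\<forall>j<i. single i a j = 0" by (simp add: single_def)
  ultimately show ?thesis using p_pos by (auto simp: vilenkin_def single_def)
qed

lemma pairing_single: "pairing p x (single (1 - i) a) = ep p (x i * a)"
proof -
  have "{j. x j * single (1 - i) a (1 - j) \<noteq> 0} \<subseteq> {i}" by (auto simp: single_def)
  then have "(\<Sum>j | x j * single (1 - i) a (1 - j) \<noteq> 0. x j * single (1 - i) a (1 - j)) =
      (\<Sum>j\<in>{i}. x j * single (1 - i) a (1 - j))"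
    by (intro sum.mono_neutral_left) auto
  then show ?thesis by (simp add: pairing_ep single_def)
qed

text \<open>Some digit \<open>x j\<close> with \<open>j \<le> l\<close> is nonzero. The sequence
  with the single digit 1 at place \<open>1 - j\<close>, which exceeds \<open>- l\<close>, reads off
  this digit, and \<open>ep p (x j)\<close> differs from 1 because
  \<open>0 < x j < p\<close>.\<close>

lemma nontrivial_character:
  assumes "x \<in> V" "x \<notin> nbhd p l"
  shows "\<exists>u\<in>nbhd p (- l). pairing p x u \<noteq> 1"
proof -
  obtain j where j: "j \<le> l" "x j \<noteq> 0" using assms by (auto simp: nbhd_def)
  have "single (1 - j) 1 \<in> V" using p_gt_1 by simp
  moreover have "\<forall>i\<le>- l. single (1 - j) 1 i = 0" using j by (simp add: single_def)
  ultimately have "single (1 - j) 1 \<in> nbhd p (- l)" by (simp add: nbhd_def)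
  moreover have "\<not> int p dvd x j"
    using vilenkin_ltD[OF assms(1), of j] j zdvd_not_zless[of "x j" "int p"] by auto
  then have "pairing p x (single (1 - j) 1) \<noteq> 1"
    using p_pos by (simp add: pairing_single ep_eq_1_iff)
  ultimately show ?thesis by blast
qed

section \<open>The topology and its Borel sets\<close>

lemma openin_vilenkin:
  "openin (vilenkin_topology p) U \<longleftrightarrow> U \<subseteq> V \<and> (\<forall>x\<in>U. \<exists>l. cyl p x l \<subseteq> U)"
proof
  assume "openin (vilenkin_topology p) U"
  then have "generate_topology_on {vadd p x ` nbhd p l |x l. x \<in> V} U"
    by (simp add: vilenkin_topology_def openin_topology_generated_by_iff)
  then show "U \<subseteq> V \<and> (\<forall>x\<in>U. \<exists>l. cyl p x l \<subseteq> U)"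
  proof induction
    case (Int a b)
    show ?case
    proof (intro conjI ballI)
      fix x assume x: "x \<in> a \<inter> b"
      obtain l m where lm: "cyl p x l \<subseteq> a" "cyl p x m \<subseteq> b" using Int x by blast
      have "cyl p x (max l m) \<subseteq> cyl p x l" "cyl p x (max l m) \<subseteq> cyl p x m"
        by (auto intro!: cyl_mono)
      then show "\<exists>l. cyl p x l \<subseteq> a \<inter> b" using lm by blast
    qed (use Int in auto)
  next
    \<comment> \<open>Every point of a cylinder is a centre of it, as in an ultrametric
      space.\<close>
    case (Basis s)
    then obtain x l where s: "s = cyl p x l" "x \<in> V" using vadd_image_nbhd by auto
    then show ?case using cyl_subset cyl_eq by (metis order_refl)
  qed blast+
next
  assume U: "U \<subseteq> V \<and> (\<forall>x\<in>U. \<exists>l. cyl p x l \<subseteq> U)"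
  then obtain l where l: "\<And>x. x \<in> U \<Longrightarrow> cyl p x (l x) \<subseteq> U" by metis
  have "U = (\<Union>x\<in>U. cyl p x (l x))" using l U self_in_cyl[of _ p] by blast
  moreover have "openin (vilenkin_topology p) (cyl p x (l x))" if "x \<in> U" for x
    unfolding vilenkin_topology_def
    by (rule topology_generated_by_Basis) (use that U vadd_image_nbhd in blast)
  ultimately show "openin (vilenkin_topology p) U"
    by (metis (mono_tags, lifting) imageE openin_Union)
qed

definition cyls :: "(int \<Rightarrow> int) set set" where
  "cyls = {cyl p x l | x l. x \<in> V}"

lemma countable_truncations: "countable {x \<in> V. \<forall>j>l. x j = 0}"
proof -
  have "{x \<in> V. \<forall>j>l. x j = 0} \<subseteq>
      (\<Union>k. {x. \<forall>j. (j \<in> {k..l} \<longrightarrow> x j \<in> {0..<int p}) \<and> (j \<notin> {k..l} \<longrightarrow> x j = 0)})"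
  proof
    fix x assume x: "x \<in> {x \<in> V. \<forall>j>l. x j = 0}"
    then obtain k where "\<forall>j<k. x j = 0" using vilenkin_bound by blast
    then show "x \<in> (\<Union>k. {x. \<forall>j. (j \<in> {k..l} \<longrightarrow> x j \<in> {0..<int p}) \<and> (j \<notin> {k..l} \<longrightarrow> x j = 0)})"
      using x by (intro UN_I[of k]) (auto simp: vilenkin_def)
  qed
  moreover have "finite {x. \<forall>j. (j \<in> {k..l} \<longrightarrow> x j \<in> {0..<int p}) \<and> (j \<notin> {k..l} \<longrightarrow> x j = 0)}" for k
    by (rule finite_set_of_finite_funs) auto
  ultimately show ?thesis
    by (meson countable_UN countable_finite countable_subset uncountable_def countableI_type)
qed

lemma countable_H: "countable (H p)"
  using countable_truncations[of 0] by (simp add: H_def)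

lemma countable_cyls: "countable cyls"
proof -
  have "cyls \<subseteq> (\<Union>l. (\<lambda>x. cyl p x l) ` {x \<in> V. \<forall>j>l. x j = 0})"
  proof
    fix C assume "C \<in> cyls"
    then obtain x l where C: "C = cyl p x l" "x \<in> V" by (auto simp: cyls_def)
    \<comment> \<open>Digits beyond \<open>l\<close> do not affect the cylinder; erasing them leaves
      countably many centres.\<close>
    define y where "y = (\<lambda>j. if j \<le> l then x j else 0)"
    have "y \<in> V" using C(2) by (auto simp: y_def vilenkin_def)
    moreover have "C = cyl p y l" by (auto simp: C y_def cyl_def)
    ultimately show "C \<in> (\<Union>l. (\<lambda>x. cyl p x l) ` {x \<in> V. \<forall>j>l. x j = 0})"
      by (intro UN_I[of l]) (auto simp: y_def)
  qed
  moreover have "countable (\<Union>l. (\<lambda>x. cyl p x l) ` {x \<in> V. \<forall>j>l. x j = 0})"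
    by (intro countable_UN countable_image countable_truncations) auto
  ultimately show ?thesis by (rule countable_subset)
qed

lemma cyl_open: "x \<in> V \<Longrightarrow> openin (vilenkin_topology p) (cyl p x l)"
  by (metis cyl_eq cyl_subset openin_vilenkin order_refl)

text \<open>An open set is the union of the cylinders inside it, and there are only countably many
  cylinders.\<close>

lemma sigma_sets_open: "sigma_sets V {S. openin (vilenkin_topology p) S} = sigma_sets V cyls"
proof (rule sigma_sets_eqI)
  fix U assume "U \<in> {S. openin (vilenkin_topology p) S}"
  then have U: "U \<subseteq> V" "\<forall>x\<in>U. \<exists>l. cyl p x l \<subseteq> U" by (auto simp: openin_vilenkin)
  have "U = \<Union>{C \<in> cyls. C \<subseteq> U}"
  proof (intro equalityI subsetI)
    fix x assume x: "x \<in> U"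
    then obtain l where "cyl p x l \<subseteq> U" using U by blast
    moreover have "cyl p x l \<in> cyls" "x \<in> cyl p x l"
      using x U self_in_cyl by (auto simp: cyls_def)
    ultimately show "x \<in> \<Union>{C \<in> cyls. C \<subseteq> U}" by blast
  qed auto
  moreover have "countable {C \<in> cyls. C \<subseteq> U}" using countable_cyls by simp
  then have "\<Union>{C \<in> cyls. C \<subseteq> U} \<in> sigma_sets V cyls"
    by (rule sigma_sets_UNION) auto
  ultimately show "U \<in> sigma_sets V cyls" by simp
next
  fix C assume "C \<in> cyls"
  then show "C \<in> sigma_sets V {S. openin (vilenkin_topology p) S}"
    using cyl_open by (auto simp: cyls_def)
qed

text \<open>Two cylinders are nested or disjoint, which is why the empty set is added. Uniqueness of
  measures and Dynkin induction rest on this.\<close>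

lemma Int_stable_cyls: "Int_stable (insert {} cyls)"
proof (rule Int_stableI)
  have *: "cyl p x l \<inter> cyl p y m \<in> insert {} cyls" if "x \<in> V" "y \<in> V" "l \<ge> m" for x y l m
    using that by (auto simp: cyl_Int cyls_def)
  fix A B assume "A \<in> insert {} cyls" "B \<in> insert {} cyls"
  then consider "A = {} \<or> B = {}" | x l y m where "A = cyl p x l" "B = cyl p y m" "x \<in> V" "y \<in> V"
    by (auto simp: cyls_def)
  then show "A \<inter> B \<in> insert {} cyls"
  proof cases
    case 2
    then show ?thesis using *[of x y m l] *[of y x l m] by (cases "l \<ge> m") (auto simp: Int_commute)
  qed auto
qed

lemma sigma_sets_insert_empty: "sigma_sets V (insert {} cyls) = sigma_sets V cyls"
  by (rule sigma_sets_eqI) (auto intro: sigma_sets.Empty)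

lemma V_eq_Union_nbhd: "V = (\<Union>i::nat. nbhd p (- int i))"
proof (intro equalityI subsetI)
  fix x assume x: "x \<in> V"
  then obtain k where k: "\<forall>j<k. x j = 0" using vilenkin_bound by blast
  then have "\<forall>j\<le>- int (nat (1 - k)). x j = 0" by auto
  then show "x \<in> (\<Union>i::nat. nbhd p (- int i))" using x
    unfolding nbhd_def by blast
qed (auto simp: nbhd_def)

end

section \<open>Haar measure\<close>

text \<open>A cylinder with a modulation: position \<open>w\<close> and frequency \<open>k\<close>
  enter symmetrically, so that the Fourier transform maps atoms to multiples of atoms by an explicit
  formula.\<close>

definition atom :: "nat \<Rightarrow> (int \<Rightarrow> int) \<Rightarrow> int \<Rightarrow> (int \<Rightarrow> int) \<Rightarrow> (int \<Rightarrow> int) \<Rightarrow> complex" where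
  "atom p w l k = (\<lambda>\<omega>. indicator (cyl p w l) \<omega> * pairing p k \<omega>)"

definition atoms :: "nat \<Rightarrow> ((int \<Rightarrow> int) \<Rightarrow> complex) set" where
  "atoms p = {atom p w l k | w l k. w \<in> vilenkin p \<and> k \<in> vilenkin p}"

locale vilenkin_haar = vilenkin_group +
  fixes M :: "(int \<Rightarrow> int) measure"
  assumes haar: "normalized_haar p M"
begin

lemma sets_M: "sets M = sigma_sets V cyls"
proof -
  have "{S. openin (vilenkin_topology p) S} \<subseteq> Pow V" by (auto simp: openin_vilenkin)
  then show ?thesis using haar by (simp add: normalized_haar_def sets_measure_of sigma_sets_open)
qed

lemma cyls_subset: "cyls \<subseteq> Pow V"
  using cyl_subset by (auto simp: cyls_def)

lemma space_M [simp]: "space M = V"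
  using sets_M cyls_subset by (metis sets_measure_of sets_eq_imp_space_eq space_measure_of)

lemma sets_M_subset: "E \<in> sets M \<Longrightarrow> E \<subseteq> V"
  using sets.sets_into_space by force

lemma cyl_sets [simp]: "x \<in> V \<Longrightarrow> cyl p x l \<in> sets M"
  unfolding sets_M by (auto simp: cyls_def)

lemma nbhd_sets [simp]: "nbhd p l \<in> sets M"
  by (simp add: nbhd_eq_cyl)

lemma open_sets: "U \<subseteq> V \<Longrightarrow> (\<And>x. x \<in> U \<Longrightarrow> \<exists>l. cyl p x l \<subseteq> U) \<Longrightarrow> U \<in> sets M"
  unfolding sets_M sigma_sets_open[symmetric] by (auto simp: openin_vilenkin)

section \<open>Measurability of characters, translations, shifts and reduction\<close>

lemma measurable_locally_constant:
  assumes "\<And>x. x \<in> V \<Longrightarrow> f x \<in> space N" and "\<And>x. x \<in> V \<Longrightarrow> \<exists>l. \<forall>y\<in>cyl p x l. f y = f x"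
  shows "f \<in> measurable M N"
proof (rule measurableI)
  fix A assume "A \<in> sets N"
  show "f -` A \<inter> space M \<in> sets M"
  proof (rule open_sets)
    fix x assume x: "x \<in> f -` A \<inter> space M"
    then obtain l where "\<forall>y\<in>cyl p x l. f y = f x" using assms(2)[of x] by auto
    then have "cyl p x l \<subseteq> f -` A \<inter> space M" using x cyl_subset by fastforce
    then show "\<exists>l. cyl p x l \<subseteq> f -` A \<inter> space M" ..
  qed auto
qed (use assms in auto)

lemma measurable_pairing [measurable (raw)]: "k \<in> V \<Longrightarrow> pairing p k \<in> borel_measurable M"
proof (rule measurable_locally_constant)
  fix x assume "k \<in> V" "x \<in> V"
  then obtain l where "\<forall>j<l. k j = 0" using vilenkin_bound by blast
  then show "\<exists>l. \<forall>y\<in>cyl p x l. pairing p k y = pairing p k x"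
    by (intro exI[of _ "1 - l"] ballI pairing_cyl[where k = l]) simp_all
qed simp

lemma measurable_into_M:
  assumes "\<And>x. x \<in> V \<Longrightarrow> f x \<in> V" and "\<And>x l. x \<in> V \<Longrightarrow> \<exists>m. \<forall>y\<in>cyl p x m. f y \<in> cyl p (f x) l"
  shows "f \<in> measurable M M"
proof (rule measurable_sigma_sets[OF sets_M cyls_subset])
  fix C assume "C \<in> cyls"
  then obtain z l where C: "C = cyl p z l" "z \<in> V" by (auto simp: cyls_def)
  show "f -` C \<inter> space M \<in> sets M"
  proof (rule open_sets)
    fix x assume x: "x \<in> f -` C \<inter> space M"
    then obtain m where "\<forall>y\<in>cyl p x m. f y \<in> cyl p (f x) l" using assms(2)[of x l] by auto
    moreover have "cyl p (f x) l = C" using x C cyl_eq by auto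
    ultimately have "cyl p x m \<subseteq> f -` C \<inter> space M" using cyl_subset by fastforce
    then show "\<exists>l. cyl p x l \<subseteq> f -` C \<inter> space M" ..
  qed auto
qed (use assms in auto)

lemma measurable_vadd [measurable (raw)]: "x \<in> V \<Longrightarrow> vadd p x \<in> measurable M M"
proof (rule measurable_into_M)
  fix y l assume "x \<in> V" "y \<in> V"
  then have "\<forall>z\<in>cyl p y l. vadd p x z \<in> cyl p (vadd p x y) l"
    by (auto simp: cyl_def) (auto simp: vadd_def)
  then show "\<exists>m. \<forall>z\<in>cyl p y m. vadd p x z \<in> cyl p (vadd p x y) l" ..
qed simp

lemma measurable_shift [measurable (raw)]: "shift n \<in> measurable M M"
proof (rule measurable_into_M)
  fix y l assume "y \<in> V"
  then have "\<forall>z\<in>cyl p y (l + n). shift n z \<in> cyl p (shift n y) l"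
    by (auto simp: shift_in_cyl)
  then show "\<exists>m. \<forall>z\<in>cyl p y m. shift n z \<in> cyl p (shift n y) l" ..
qed simp

lemma measurable_frac_part [measurable (raw)]: "frac_part \<in> measurable M M"
proof (rule measurable_into_M)
  fix y l assume "y \<in> V"
  then have "\<forall>z\<in>cyl p y l. frac_part z \<in> cyl p (frac_part y) l"
    by (auto simp: cyl_def) (auto simp: frac_part_def)
  then show "\<exists>m. \<forall>z\<in>cyl p y m. frac_part z \<in> cyl p (frac_part y) l" ..
qed simp

lemma vadd_image_sets:
  assumes "x \<in> V" "E \<in> sets M"
  shows "vadd p x ` E \<in> sets M"
proof -
  have E: "E \<subseteq> V" using assms by (simp add: sets_M_subset)
  \<comment> \<open>Translation by the inverse \<open>u\<close> undoes translation by
    \<open>x\<close>, so the image is a preimage under a measurable map.\<close>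
  define u where "u = vminus p (\<lambda>_. 0) x"
  have u: "u \<in> V" using assms by (simp add: u_def)
  have eq: "vminus p y x = vadd p u y" for y
    by (simp add: u_def vminus_def vadd_def mod_simps algebra_simps)
  have "vadd p x ` E = vadd p u -` E \<inter> space M"
    unfolding vadd_image_eq[OF E assms(1)] eq by auto
  then show ?thesis using assms measurable_sets[OF measurable_vadd[OF u]] by simp
qed

lemma emeasure_vadd: "x \<in> V \<Longrightarrow> E \<in> sets M \<Longrightarrow> emeasure M (vadd p x ` E) = emeasure M E"
  using haar by (simp add: normalized_haar_def)

lemma shift_image_sets: "E \<in> sets M \<Longrightarrow> shift n ` E \<in> sets M"
proof -
  assume "E \<in> sets M"
  moreover from this have "shift n ` E = shift (- n) -` E \<inter> space M"
    using sets_M_subset by (fastforce simp: shift_image_eq)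
  ultimately show ?thesis using measurable_sets[OF measurable_shift] by simp
qed

text \<open>By invariance the measure depends on the level only. Sorting by the digit at place
  \<open>l + 1\<close> cuts level \<open>l\<close> into \<open>p\<close> cylinders of level
  \<open>l + 1\<close>; the normalization at level 0 then propagates in both directions.\<close>

lemma emeasure_cyl:
  assumes "x \<in> V"
  shows "emeasure M (cyl p x l) = ennreal (real p powi (- l))"
proof -
  define m where "m l = emeasure M (nbhd p l)" for l
  have trans: "emeasure M (cyl p x l) = m l" if "x \<in> V" for x l
    using emeasure_vadd[OF that nbhd_sets[of l]] that by (simp add: vadd_image_nbhd m_def)
  have split: "m l = of_nat p * m (l + 1)" for l
  proof -
    have "nbhd p l = (\<Union>a\<in>{0..<int p}. cyl p (single (l + 1) a) (l + 1))"
    proof (intro equalityI subsetI)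
      fix y assume y: "y \<in> nbhd p l"
      then have "y (l + 1) \<in> {0..<int p}" by (auto simp: nbhd_def vilenkin_def)
      moreover have "y \<in> cyl p (single (l + 1) (y (l + 1))) (l + 1)"
        using y by (auto simp: nbhd_def cyl_def single_def)
      ultimately show "y \<in> (\<Union>a\<in>{0..<int p}. cyl p (single (l + 1) a) (l + 1))" by blast
    qed (auto simp: nbhd_def cyl_def single_def)
    moreover have "emeasure M (\<Union>a\<in>{0..<int p}. cyl p (single (l + 1) a) (l + 1)) =
        (\<Sum>a\<in>{0..<int p}. emeasure M (cyl p (single (l + 1) a) (l + 1)))"
    proof (rule sum_emeasure[symmetric])
      show "disjoint_family_on (\<lambda>a. cyl p (single (l + 1) a) (l + 1)) {0..<int p}"
      proof (unfold disjoint_family_on_def, intro ballI impI equals0I)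
        fix a b y assume "a \<noteq> b" "y \<in> cyl p (single (l + 1) a) (l + 1) \<inter> cyl p (single (l + 1) b) (l + 1)"
        then have "y (l + 1) = a" "y (l + 1) = b" by (auto simp: cyl_def single_def)
        with \<open>a \<noteq> b\<close> show False by simp
      qed
    qed auto
    ultimately show ?thesis by (simp add: m_def[of l] trans)
  qed
  have "m l = ennreal (real p powi (- l))"
  proof (induction l rule: int_induct[where k = 0])
    case base
    then show ?case using haar by (simp add: m_def normalized_haar_def)
  next
    case (step1 i)
    have eq: "ennreal (real p) * m (i + 1) = ennreal (real p powi (- i))"
      using step1 split[of i] by (simp add: ennreal_of_nat_eq_real_of_nat)
    \<comment> \<open>\<open>m (i + 1)\<close> cannot be infinite, since \<open>p\<close> times it
      equals a finite power.\<close>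
    then obtain r where r: "m (i + 1) = ennreal r" "r \<ge> 0"
      using p_pos by (cases "m (i + 1)") (auto simp: ennreal_mult_top)
    have "real p * r = real p powi (- i)"
      using eq r p_pos by (simp flip: ennreal_mult)
    also have "\<dots> = real p * real p powi (- (i + 1))"
      using p_pos power_int_add[of "real p" 1 "- (i + 1)"] by simp
    finally show ?case using r p_pos by simp
  next
    case (step2 i)
    have "m (i - 1) = ennreal (real p) * ennreal (real p powi (- i))"
      using step2 split[of "i - 1"] by (simp add: ennreal_of_nat_eq_real_of_nat)
    also have "\<dots> = ennreal (real p powi (- (i - 1)))"
      using p_pos power_int_add[of "real p" 1 "- i"] by (simp flip: ennreal_mult)
    finally show ?case .
  qed
  then show ?thesis using trans assms by simp
qed

lemma emeasure_nbhd: "emeasure M (nbhd p l) = ennreal (real p powi (- l))"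
  by (simp add: nbhd_eq_cyl emeasure_cyl)

lemma emeasure_cyl_finite: "x \<in> V \<Longrightarrow> emeasure M (cyl p x l) < \<infinity>"
  by (simp add: emeasure_cyl)

section \<open>Uniqueness on cylinders; translations and dilations\<close>

lemma measure_eqI_cyl_finite:
  assumes "sets N = sets M" "sets N' = sets M"
    and eq: "\<And>x l. x \<in> V \<Longrightarrow> emeasure N (cyl p x l) = emeasure N' (cyl p x l)"
    and fin: "\<And>x l. x \<in> V \<Longrightarrow> emeasure N' (cyl p x l) < \<infinity>"
  shows "N = N'"
\<comment> \<open>The sets \<open>nbhd p (- int i)\<close>, written as cylinders around 0, have
  finite measure and exhaust the group.\<close>
proof (rule measure_eqI_generator_eq[OF Int_stable_cyls,
      where \<Omega> = V and A = "\<lambda>i::nat. cyl p (\<lambda>_. 0) (- int i)"])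
  show "insert {} cyls \<subseteq> Pow V" using cyls_subset by auto
  show "emeasure N X = emeasure N' X" if "X \<in> insert {} cyls" for X
    using that eq by (auto simp: cyls_def)
  show "range (\<lambda>i::nat. cyl p (\<lambda>_. 0) (- int i)) \<subseteq> insert {} cyls"
    by (auto simp: cyls_def)
  show "(\<Union>i::nat. cyl p (\<lambda>_. 0) (- int i)) = V"
    using V_eq_Union_nbhd by (simp add: nbhd_eq_cyl)
  show "emeasure N (cyl p (\<lambda>_. 0) (- int i)) \<noteq> \<infinity>" for i
    using eq[of "\<lambda>_. 0"] fin[of "\<lambda>_. 0" "- int i"] by auto
qed (use assms(1,2) in \<open>auto simp: sets_M sigma_sets_insert_empty\<close>)

lemma measure_eqI_cyl:
  assumes "sets N = sets M" and "\<And>x l. x \<in> V \<Longrightarrow> emeasure N (cyl p x l) = emeasure M (cyl p x l)"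
  shows "N = M"
  using assms emeasure_cyl_finite by (intro measure_eqI_cyl_finite) auto

lemma distr_vadd:
  assumes "x \<in> V"
  shows "distr M M (vadd p x) = M"
proof (rule measure_eqI)
  fix E assume "E \<in> sets (distr M M (vadd p x))"
  then have E: "E \<in> sets M" by simp
  have pre: "vadd p x -` E \<inter> V \<in> sets M"
    using measurable_sets[OF measurable_vadd[OF assms] E] by simp
  have "vadd p x ` (vadd p x -` E \<inter> V) = E"
  proof (intro equalityI subsetI)
    fix y assume "y \<in> E"
    then show "y \<in> vadd p x ` (vadd p x -` E \<inter> V)"
      using sets_M_subset[OF E] assms
      by (intro image_eqI[of _ _ "vminus p y x"]) (auto simp: vadd_vminus)
  qed auto
  then have "emeasure M (vadd p x -` E \<inter> V) = emeasure M E"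
    using emeasure_vadd[OF assms pre] by simp
  then show "emeasure (distr M M (vadd p x)) E = emeasure M E"
    using E assms by (simp add: emeasure_distr)
qed simp

lemma integral_vadd:
  fixes f :: "(int \<Rightarrow> int) \<Rightarrow> complex"
  assumes "x \<in> V" "f \<in> borel_measurable M"
  shows "(\<integral>\<omega>. f (vadd p x \<omega>) \<partial>M) = (\<integral>\<omega>. f \<omega> \<partial>M)"
  using integral_distr[of "vadd p x" M M f] assms by (simp add: distr_vadd)

text \<open>The preimage of a cylinder of level \<open>l\<close> has level \<open>l + n\<close>,
  which scales its measure by \<open>p\<close> to the power \<open>- n\<close>.\<close>

lemma distr_shift: "distr M M (shift n) = density M (\<lambda>_. ennreal (real p powi (- n)))"
proof -
  \<comment> \<open>The factor is first moved to the left, so that the comparison on cylinders is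
    with \<open>M\<close> itself; it is divided out afterwards.\<close>
  have "density (distr M M (shift n)) (\<lambda>_. ennreal (real p powi n)) = M"
  proof (rule measure_eqI_cyl)
    fix x l assume x: "x \<in> V"
    have "emeasure (distr M M (shift n)) (cyl p x l) = emeasure M (shift n -` cyl p x l \<inter> V)"
      using x by (simp add: emeasure_distr)
    also have "shift n -` cyl p x l \<inter> V = cyl p (shift (- n) x) (l + n)"
      using cyl_subset by (auto simp: shift_in_cyl)
    finally have "emeasure (density (distr M M (shift n)) (\<lambda>_. ennreal (real p powi n))) (cyl p x l) =
        ennreal (real p powi n) * ennreal (real p powi (- (l + n)))"
      using x by (subst emeasure_density) (simp_all add: nn_integral_cmult_indicator emeasure_cyl)
    also have "\<dots> = emeasure M (cyl p x l)"
      using x p_pos power_int_add[of "real p" n "- (l + n)"]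
      by (simp add: emeasure_cyl flip: ennreal_mult)
    finally show "emeasure (density (distr M M (shift n)) (\<lambda>_. ennreal (real p powi n))) (cyl p x l) =
        emeasure M (cyl p x l)" .
  qed simp
  then have "density M (\<lambda>_. ennreal (real p powi (- n))) =
      density (density (distr M M (shift n)) (\<lambda>_. ennreal (real p powi n)))
        (\<lambda>_. ennreal (real p powi (- n)))" by simp
  also have "\<dots> = density (distr M M (shift n)) (\<lambda>_. ennreal (real p powi n) * ennreal (real p powi (- n)))"
    by (rule density_density_eq) auto
  also have "\<dots> = distr M M (shift n)"
    using p_pos by (simp flip: ennreal_mult power_int_add add: density_1)
  finally show ?thesis by simp
qed

lemma integral_shift:
  fixes f :: "(int \<Rightarrow> int) \<Rightarrow> complex"
  assumes [measurable]: "f \<in> borel_measurable M"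
  shows "(\<integral>\<omega>. f (shift n \<omega>) \<partial>M) = of_real (real p powi (- n)) * (\<integral>\<omega>. f \<omega> \<partial>M)"
proof -
  have "(\<integral>\<omega>. f (shift n \<omega>) \<partial>M) = (\<integral>\<omega>. f \<omega> \<partial>(distr M M (shift n)))"
    by (rule integral_distr[symmetric]) auto
  also have "\<dots> = (\<integral>\<omega>. (real p powi (- n)) *\<^sub>R f \<omega> \<partial>M)"
    unfolding distr_shift by (rule integral_density) auto
  finally show ?thesis by (simp add: scaleR_conv_of_real)
qed

lemma emeasure_shift_image:
  assumes "E \<in> sets M"
  shows "emeasure M (shift n ` E) = ennreal (real p powi n) * emeasure M E"
proof -
  have "shift n ` E = shift (- n) -` E \<inter> space M"
    using sets_M_subset[OF assms] by (fastforce simp: shift_image_eq)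
  then have "emeasure M (shift n ` E) = emeasure (distr M M (shift (- n))) E"
    using assms by (simp add: emeasure_distr)
  also have "\<dots> = ennreal (real p powi n) * emeasure M E"
    unfolding distr_shift using assms by (simp add: emeasure_density nn_integral_cmult_indicator)
  finally show ?thesis .
qed

lemma indicator_pairing_integrable:
  assumes "k \<in> V" "E \<in> sets M" "emeasure M E < \<infinity>"
  shows "integrable M (\<lambda>\<omega>. indicator E \<omega> * pairing p k \<omega>)"
proof (rule integrableI_bounded)
  have "(\<integral>\<^sup>+\<omega>. ennreal (norm (indicator E \<omega> * pairing p k \<omega>)) \<partial>M) = (\<integral>\<^sup>+\<omega>. indicator E \<omega> \<partial>M)"
    by (rule nn_integral_cong) (simp add: norm_mult split: split_indicator)
  then show "(\<integral>\<^sup>+\<omega>. ennreal (norm (indicator E \<omega> * pairing p k \<omega>)) \<partial>M) < \<infinity>" using assms by simp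
qed (use assms in measurable)

lemma integral_indicator_complex:
  assumes "E \<in> sets M"
  shows "(\<integral>\<omega>. indicator E \<omega> \<partial>M) = complex_of_real (measure M E)"
proof -
  have "(\<integral>\<omega>. indicator E \<omega> \<partial>M) = (\<integral>\<omega>. complex_of_real (indicator E \<omega>) \<partial>M)"
    by (rule Bochner_Integration.integral_cong) (auto split: split_indicator)
  then show ?thesis using sets_M_subset[OF assms] by (simp add: integral_complex_of_real Int_absorb2)
qed

text \<open>Translation to the centre contributes \<open>pairing p k w\<close>. On the subgroup
  \<open>nbhd p l\<close> the character is either trivial, giving the measure, or differs from 1 at
  some point \<open>u\<close> of it; translating by \<open>u\<close> then multiplies the integral by
  that value without changing it, so the integral is 0.\<close>

lemma integral_atom:
  assumes w: "w \<in> V" and k: "k \<in> V"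
  shows "(\<integral>\<omega>. indicator (cyl p w l) \<omega> * pairing p k \<omega> \<partial>M) =
    of_real (real p powi (- l)) * pairing p k w * indicator (nbhd p (- l)) k"
proof -
  define I where "I = (\<integral>\<omega>. indicator (nbhd p l) \<omega> * pairing p k \<omega> \<partial>M)"
  have trans: "(\<integral>\<omega>. indicator (cyl p x l) \<omega> * pairing p k \<omega> \<partial>M) = pairing p k x * I" if x: "x \<in> V" for x
  proof -
    have "(\<integral>\<omega>. indicator (cyl p x l) \<omega> * pairing p k \<omega> \<partial>M) =
        (\<integral>\<omega>. indicator (cyl p x l) (vadd p x \<omega>) * pairing p k (vadd p x \<omega>) \<partial>M)"
      using k x by (intro integral_vadd[symmetric]) (auto intro!: borel_measurable_times measurable_pairing borel_measurable_indicator)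
    also have "\<dots> = (\<integral>\<omega>. pairing p k x * (indicator (nbhd p l) \<omega> * pairing p k \<omega>) \<partial>M)"
    proof (rule Bochner_Integration.integral_cong)
      fix \<omega> assume "\<omega> \<in> space M"
      moreover from this have "vadd p x \<omega> \<in> cyl p x l \<longleftrightarrow> \<omega> \<in> nbhd p l"
        using x by (simp add: vadd_in_cyl nbhd_eq_cyl) (simp add: vminus_def)
      ultimately show "indicator (cyl p x l) (vadd p x \<omega>) * pairing p k (vadd p x \<omega>) =
          pairing p k x * (indicator (nbhd p l) \<omega> * pairing p k \<omega>)"
        using x k by (simp add: pairing_vadd_right indicator_def)
    qed simp
    finally show ?thesis by (simp add: I_def)
  qed
  have "I = of_real (real p powi (- l)) * indicator (nbhd p (- l)) k"
  proof (cases "k \<in> nbhd p (- l)")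
    case True
    have "I = (\<integral>\<omega>. indicator (nbhd p l) \<omega> \<partial>M)"
      unfolding I_def using pairing_eq_1[OF True]
      by (intro Bochner_Integration.integral_cong) (auto split: split_indicator)
    then show ?thesis
      using True by (simp add: integral_indicator_complex measure_def emeasure_nbhd)
  next
    case False
    then obtain u where u: "u \<in> nbhd p l" "pairing p k u \<noteq> 1"
      using nontrivial_character[OF k, of "- l"] by auto
    have uV: "u \<in> V" using u by (simp add: nbhd_def)
    have "cyl p u l = nbhd p l" using u cyl_eq by (simp add: nbhd_eq_cyl)
    then have "I = pairing p k u * I" using trans[OF uV] by (simp add: I_def)
    then have "I = 0" using u by simp
    then show ?thesis using False by simp
  qed
  then show ?thesis using trans[OF w] by (simp add: mult_ac)
qed

section \<open>Step functions\<close>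

abbreviation "step \<equiv> lspan (atoms p)"

lemma atom_in_atoms: "w \<in> V \<Longrightarrow> k \<in> V \<Longrightarrow> atom p w l k \<in> atoms p"
  by (auto simp: atoms_def)

lemma sqn_indicator_pairing:
  assumes "k \<in> V" "E \<in> sets M"
  shows "sqn M (\<lambda>\<omega>. indicator E \<omega> * pairing p k \<omega>) = emeasure M E"
proof -
  have "sqn M (\<lambda>\<omega>. indicator E \<omega> * pairing p k \<omega>) = sqn M (indicator E)"
    unfolding sqn_def by (simp add: norm_mult)
  then show ?thesis using assms by (simp add: sqn_indicator)
qed

lemma atoms_L2: "atoms p \<subseteq> L2 M"
  by (auto simp: atoms_def atom_def L2_iff sqn_indicator_pairing emeasure_cyl
      intro!: borel_measurable_times measurable_pairing borel_measurable_indicator)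

lemma atoms_integrable: "atoms p \<subseteq> {f. integrable M f}"
  by (auto simp: atoms_def atom_def intro!: indicator_pairing_integrable simp: emeasure_cyl)

lemma step_L2: "f \<in> step \<Longrightarrow> f \<in> L2 M"
  by (rule lspan_L2[OF _ atoms_L2])

lemma step_integrable: "f \<in> step \<Longrightarrow> integrable M f"
  by (rule lspan_integrable[OF _ atoms_integrable])

lemma step_measurable: "f \<in> step \<Longrightarrow> f \<in> borel_measurable M"
  using step_L2 by (auto simp: L2_def)

lemma indicator_cyl_step: "w \<in> V \<Longrightarrow> indicator (cyl p w l) \<in> step"
  using lspan_base[OF atom_in_atoms[of w "\<lambda>_. 0" l]] by (simp add: atom_def)

text \<open>Of two cylinders the finer one lies inside the other or misses it, and the frequencies
  add.\<close>

lemma atom_mult: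
  assumes "w \<in> V" "k \<in> V" "w' \<in> V" "k' \<in> V"
  shows "(\<lambda>\<omega>. atom p w l k \<omega> * atom p w' l' k' \<omega>) \<in> step"
proof -
  have *: "(\<lambda>\<omega>. atom p w l k \<omega> * atom p w' l' k' \<omega>) \<in> step"
    if "w \<in> V" "k \<in> V" "w' \<in> V" "k' \<in> V" "l \<ge> l'" for w k l w' k' l'
  proof -
    have "(\<lambda>\<omega>. atom p w l k \<omega> * atom p w' l' k' \<omega>) =
        (\<lambda>\<omega>. indicator (cyl p w l \<inter> cyl p w' l') \<omega> * pairing p (vadd p k k') \<omega>)"
    proof
      fix \<omega> show "atom p w l k \<omega> * atom p w' l' k' \<omega> =
          indicator (cyl p w l \<inter> cyl p w' l') \<omega> * pairing p (vadd p k k') \<omega>"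
        using that cyl_subset
        by (cases "\<omega> \<in> V") (auto simp: atom_def indicator_def pairing_vadd)
    qed
    also have "\<dots> \<in> step"
      using that lspan_base[OF atom_in_atoms[of w "vadd p k k'" l]]
      by (auto simp: cyl_Int atom_def lspan_zero)
    finally show ?thesis .
  qed
  show ?thesis
    using *[of w k w' k' l' l] *[of w' k' w k l l'] assms by (cases "l \<ge> l'") (auto simp: mult.commute)
qed

text \<open>Closure under products makes the sets with step indicators a ring: unions and
  differences are polynomials in the indicators.\<close>

lemma step_mult:
  assumes "f \<in> step" "g \<in> step"
  shows "(\<lambda>\<omega>. f \<omega> * g \<omega>) \<in> step"
proof (rule lspan_mult[OF assms(1)])
  fix a assume a: "a \<in> atoms p"
  have "(\<lambda>\<omega>. g \<omega> * a \<omega>) \<in> step"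
    by (rule lspan_mult[OF assms(2)]) (use a atom_mult in \<open>auto simp: atoms_def\<close>)
  then show "(\<lambda>\<omega>. a \<omega> * g \<omega>) \<in> step" by (simp add: mult.commute)
qed

lemma indicator_empty_step: "(indicator {} :: _ \<Rightarrow> complex) \<in> step"
proof -
  have "(indicator {} :: (int \<Rightarrow> int) \<Rightarrow> complex) = (\<lambda>_. 0)" by auto
  then show ?thesis by (simp only: lspan_zero)
qed

lemma step_set_Un:
  assumes "(indicator A :: _ \<Rightarrow> complex) \<in> step" "(indicator B :: _ \<Rightarrow> complex) \<in> step"
  shows "(indicator (A \<union> B) :: _ \<Rightarrow> complex) \<in> step"
proof -
  have "(\<lambda>x. (indicator A x + indicator B x) - indicator A x * indicator B x :: complex) \<in> step"
    by (intro lspan_diff lspan_add step_mult assms)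
  also have "(\<lambda>x. (indicator A x + indicator B x) - indicator A x * indicator B x :: complex) =
      indicator (A \<union> B)" by (auto simp: indicator_def)
  finally show ?thesis .
qed

lemma step_set_Diff:
  assumes "(indicator A :: _ \<Rightarrow> complex) \<in> step" "(indicator B :: _ \<Rightarrow> complex) \<in> step"
  shows "(indicator (A - B) :: _ \<Rightarrow> complex) \<in> step"
proof -
  have "(\<lambda>x. indicator A x - indicator A x * indicator B x :: complex) \<in> step"
    by (intro lspan_diff step_mult assms)
  also have "(\<lambda>x. indicator A x - indicator A x * indicator B x :: complex) = indicator (A - B)"
    by (auto simp: indicator_def)
  finally show ?thesis .
qed

section \<open>Approximation of measurable sets by step sets\<close>

definition step_approximable :: "(int \<Rightarrow> int) set \<Rightarrow> bool" where
  "step_approximable E \<longleftrightarrow> (\<forall>\<epsilon>>0. \<exists>D\<in>sets M. (indicator D :: _ \<Rightarrow> complex) \<in> step \<and>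
     emeasure M (sym_diff E D) < ennreal \<epsilon>)"

lemma emeasure_sym_diff_triangle:
  assumes "A \<in> sets M" "B \<in> sets M" "C \<in> sets M"
  shows "emeasure M (sym_diff A C) \<le> emeasure M (sym_diff A B) + emeasure M (sym_diff B C)"
proof -
  have "emeasure M (sym_diff A C) \<le> emeasure M (sym_diff A B \<union> sym_diff B C)"
    using assms by (intro emeasure_mono) auto
  also have "\<dots> \<le> emeasure M (sym_diff A B) + emeasure M (sym_diff B C)"
    using assms by (intro emeasure_subadditive) auto
  finally show ?thesis .
qed

lemma ennreal_halves_less: "a < ennreal (\<epsilon> / 2) \<Longrightarrow> b < ennreal (\<epsilon> / 2) \<Longrightarrow> \<epsilon> > 0 \<Longrightarrow> a + b < ennreal \<epsilon>"
  using add_strict_mono[of a "ennreal (\<epsilon> / 2)" b "ennreal (\<epsilon> / 2)"] by (simp flip: ennreal_plus)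

lemma step_approximable_limit:
  assumes "E \<in> sets M"
    and "\<And>\<epsilon>. \<epsilon> > 0 \<Longrightarrow> \<exists>D\<in>sets M. step_approximable D \<and> emeasure M (sym_diff E D) < ennreal \<epsilon>"
  shows "step_approximable E"
  unfolding step_approximable_def
proof (intro allI impI)
  fix \<epsilon> :: real assume e: "\<epsilon> > 0"
  obtain D where D: "D \<in> sets M" "step_approximable D" "emeasure M (sym_diff E D) < ennreal (\<epsilon> / 2)"
    using assms(2)[of "\<epsilon> / 2"] e by auto
  obtain D' where D': "D' \<in> sets M" "(indicator D' :: _ \<Rightarrow> complex) \<in> step"
      "emeasure M (sym_diff D D') < ennreal (\<epsilon> / 2)"
    using D(2) e by (auto simp: step_approximable_def dest: spec[of _ "\<epsilon> / 2"])
  have "emeasure M (sym_diff E D') < ennreal \<epsilon>"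
    using emeasure_sym_diff_triangle[OF assms(1) D(1) D'(1)] ennreal_halves_less[OF D(3) D'(3) e]
    by simp
  then show "\<exists>D\<in>sets M. (indicator D :: _ \<Rightarrow> complex) \<in> step \<and> emeasure M (sym_diff E D) < ennreal \<epsilon>"
    using D' by blast
qed

lemma step_approximable_Un:
  assumes "step_approximable E" "step_approximable F" "E \<in> sets M" "F \<in> sets M"
  shows "step_approximable (E \<union> F)"
  unfolding step_approximable_def
proof (intro allI impI)
  fix \<epsilon> :: real assume e: "\<epsilon> > 0"
  obtain D where D: "D \<in> sets M" "(indicator D :: _ \<Rightarrow> complex) \<in> step"
      "emeasure M (sym_diff E D) < ennreal (\<epsilon> / 2)"
    using assms(1) e by (auto simp: step_approximable_def dest: spec[of _ "\<epsilon> / 2"])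
  obtain D' where D': "D' \<in> sets M" "(indicator D' :: _ \<Rightarrow> complex) \<in> step"
      "emeasure M (sym_diff F D') < ennreal (\<epsilon> / 2)"
    using assms(2) e by (auto simp: step_approximable_def dest: spec[of _ "\<epsilon> / 2"])
  have "emeasure M (sym_diff (E \<union> F) (D \<union> D')) \<le> emeasure M (sym_diff E D \<union> sym_diff F D')"
    using assms D D' by (intro emeasure_mono) auto
  also have "\<dots> \<le> emeasure M (sym_diff E D) + emeasure M (sym_diff F D')"
    using assms D D' by (intro emeasure_subadditive) auto
  also have "\<dots> < ennreal \<epsilon>" using D D' e by (intro ennreal_halves_less)
  finally show "\<exists>D\<in>sets M. (indicator D :: _ \<Rightarrow> complex) \<in> step \<and>
      emeasure M (sym_diff (E \<union> F) D) < ennreal \<epsilon>"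
    using D D' step_set_Un[of D D'] by (intro bexI[of _ "D \<union> D'"]) auto
qed

lemma step_approximable_step: "(indicator D :: _ \<Rightarrow> complex) \<in> step \<Longrightarrow> D \<in> sets M \<Longrightarrow> step_approximable D"
  unfolding step_approximable_def by (intro allI impI bexI[of _ D]) auto

text \<open>Finite unions are approximable, and the remainders \<open>T n\<close> decrease to the
  empty set; finite total measure makes their measures tend to 0.\<close>

lemma step_approximable_UN:
  assumes "\<And>i::nat. step_approximable (E i)" "\<And>i. E i \<in> sets M" "emeasure M (\<Union>i. E i) < \<infinity>"
  shows "step_approximable (\<Union>i. E i)"
proof (rule step_approximable_limit)
  have fin: "step_approximable (\<Union>i<n. E i)" for n
  proof (induction n)
    case 0
    show ?case using step_approximable_step[OF indicator_empty_step] by simp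
  next
    case (Suc n)
    then have "step_approximable ((\<Union>i<n. E i) \<union> E n)"
      using assms by (intro step_approximable_Un) auto
    then show ?case by (simp add: lessThan_Suc Un_commute)
  qed
  fix \<epsilon> :: real assume e: "\<epsilon> > 0"
  define T where "T n = (\<Union>i. E i) - (\<Union>i<n. E i)" for n
  have "(\<lambda>n. emeasure M (T n)) \<longlonglongrightarrow> emeasure M (\<Inter>n. T n)"
  proof (rule Lim_emeasure_decseq)
    show "range T \<subseteq> sets M" using assms by (auto simp: T_def)
    show "decseq T" by (auto simp: T_def decseq_def)
    have "emeasure M (T n) \<le> emeasure M (\<Union>i. E i)" for n
      using assms by (intro emeasure_mono) (auto simp: T_def)
    then show "emeasure M (T n) \<noteq> \<infinity>" for n
      using assms(3) by (metis infinity_ennreal_def leD)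
  qed
  moreover have "(\<Inter>n. T n) = {}" by (auto simp: T_def)
  ultimately have "(\<lambda>n. emeasure M (T n)) \<longlonglongrightarrow> 0" by simp
  then have "eventually (\<lambda>n. emeasure M (T n) < ennreal \<epsilon>) sequentially"
    using e by (intro order_tendstoD(2)) auto
  then obtain n where "emeasure M (T n) < ennreal \<epsilon>"
    using eventually_happens'[OF sequentially_bot] by blast
  moreover have "sym_diff (\<Union>i. E i) (\<Union>i<n. E i) = T n" by (auto simp: T_def)
  ultimately show "\<exists>D\<in>sets M. step_approximable D \<and> emeasure M (sym_diff (\<Union>i. E i) D) < ennreal \<epsilon>"
    using fin[of n] assms by (intro bexI[of _ "\<Union>i<n. E i"]) auto
qed (use assms in auto)

text \<open>Dynkin induction from the cylinders. Cutting down to \<open>nbhd p m\<close> supplies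
  the finite measure that the union case requires and lets complements be taken inside a step
  set.\<close>

lemma step_approximable_Int_nbhd:
  assumes "E \<in> sets M"
  shows "step_approximable (E \<inter> nbhd p m)"
proof -
  have sub: "insert {} cyls \<subseteq> Pow V" using cyls_subset by auto
  have "E \<in> sigma_sets V (insert {} cyls)" using assms by (simp add: sets_M sigma_sets_insert_empty)
  then show ?thesis
  proof (induction rule: sigma_sets_induct_disjoint[OF Int_stable_cyls sub, consumes 1, case_names basic empty compl union])
    case (basic A)
    have "(\<lambda>x. indicator A x * indicator (nbhd p m) x) \<in> step"
      using basic indicator_cyl_step
      by (intro step_mult) (auto simp: cyls_def nbhd_eq_cyl lspan_zero)
    then have "(indicator (A \<inter> nbhd p m) :: _ \<Rightarrow> complex) \<in> step"
      by (simp add: indicator_inter_arith[abs_def])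
    then show ?case using basic by (intro step_approximable_step) (auto simp: cyls_def)
  next
    case empty
    show ?case using step_approximable_step[OF indicator_empty_step] by simp
  next
    case (compl A)
    then have A: "A \<in> sets M" by (simp add: sets_M sigma_sets_insert_empty)
    show ?case
      unfolding step_approximable_def
    proof (intro allI impI)
      fix \<epsilon> :: real assume "\<epsilon> > 0"
      then obtain D where D: "D \<in> sets M" "(indicator D :: _ \<Rightarrow> complex) \<in> step"
        "emeasure M (sym_diff (A \<inter> nbhd p m) D) < ennreal \<epsilon>"
        using compl by (auto simp: step_approximable_def)
      \<comment> \<open>Complementing both sets inside \<open>nbhd p m\<close> can only shrink their
        symmetric difference.\<close>
      have "emeasure M (sym_diff ((V - A) \<inter> nbhd p m) (nbhd p m - D)) \<le>
          emeasure M (sym_diff (A \<inter> nbhd p m) D)"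
      proof (rule emeasure_mono)
        show "sym_diff ((V - A) \<inter> nbhd p m) (nbhd p m - D) \<subseteq> sym_diff (A \<inter> nbhd p m) D"
          by (auto simp: nbhd_def)
        show "sym_diff (A \<inter> nbhd p m) D \<in> sets M"
          using A D(1) by (intro sets.Un sets.Diff sets.Int nbhd_sets)
      qed
      then show "\<exists>D\<in>sets M. (indicator D :: _ \<Rightarrow> complex) \<in> step \<and>
          emeasure M (sym_diff ((V - A) \<inter> nbhd p m) D) < ennreal \<epsilon>"
        using D step_set_Diff[of "nbhd p m" D] indicator_cyl_step[of "\<lambda>_. 0" m]
        by (intro bexI[of _ "nbhd p m - D"]) (auto simp: nbhd_eq_cyl)
    qed
  next
    case (union A)
    have A: "A i \<in> sets M" for i using union(2) by (auto simp: sets_M sigma_sets_insert_empty)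
    have "emeasure M (\<Union>i. A i \<inter> nbhd p m) \<le> emeasure M (nbhd p m)"
      by (intro emeasure_mono) auto
    also have "\<dots> < \<infinity>" by (simp add: emeasure_nbhd)
    finally have "step_approximable (\<Union>i. A i \<inter> nbhd p m)"
      using union A by (intro step_approximable_UN) auto
    then show ?case by simp
  qed
qed

lemma step_approximable_finite:
  assumes "E \<in> sets M" "emeasure M E < \<infinity>"
  shows "step_approximable E"
proof -
  have "E = (\<Union>i::nat. E \<inter> nbhd p (- int i))"
    using V_eq_Union_nbhd sets_M_subset[OF assms(1)] by blast
  moreover from this have "step_approximable (\<Union>i::nat. E \<inter> nbhd p (- int i))"
    using assms by (intro step_approximable_UN step_approximable_Int_nbhd) auto
  ultimately show ?thesis by simp
qed

lemma fin_inds_approx_step: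
  assumes "s \<in> lspan (fin_inds M)" "\<epsilon> > 0"
  shows "\<exists>t\<in>step. sqn M (\<lambda>x. s x - t x) < ennreal \<epsilon> \<and> (\<integral>\<^sup>+x. norm (s x - t x) \<partial>M) < ennreal \<epsilon>"
  using assms
proof (induction arbitrary: \<epsilon>)
  case lspan_zero
  then show ?case by (intro bexI[of _ "\<lambda>x. 0"]) (auto simp: sqn_def lspan.lspan_zero)
next
  case (lspan_step f g c)
  obtain A where A: "g = indicator A" "A \<in> sets M" "emeasure M A < \<infinity>"
    using lspan_step by (auto simp: fin_inds_def)
  \<comment> \<open>The denominator dominates both \<open>(cmod c)\<^sup>2\<close>, for the square
    norm, and \<open>cmod c\<close>, for the integral norm.\<close>
  define d where "d = \<epsilon> / (4 * (1 + (cmod c)\<^sup>2 + cmod c))"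
  have pos: "1 + (cmod c)\<^sup>2 + cmod c > 0" by (simp add: add_pos_nonneg)
  have d: "d > 0" using lspan_step.prems pos by (simp add: d_def)
  obtain t where t: "t \<in> step" "sqn M (\<lambda>x. f x - t x) < ennreal (\<epsilon> / 4)"
      "(\<integral>\<^sup>+x. norm (f x - t x) \<partial>M) < ennreal (\<epsilon> / 4)"
    using lspan_step.IH[of "\<epsilon> / 4"] lspan_step.prems by auto
  obtain D where D: "D \<in> sets M" "(indicator D :: _ \<Rightarrow> complex) \<in> step"
      "emeasure M (sym_diff A D) < ennreal d"
    using step_approximable_finite[OF A(2,3)] d by (auto simp: step_approximable_def)
  define v where "v = (\<lambda>x. t x + c * indicator D x)"
  have fm: "f \<in> borel_measurable M"
    using lspan_L2[OF lspan_step.hyps(1) fin_inds_L2] by (simp add: L2_def)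
  have tm: "t \<in> borel_measurable M" by (rule step_measurable[OF t(1)])
  have SD: "sym_diff A D \<in> sets M" using A D by auto
  have cd: "(cmod c)\<^sup>2 * d \<le> \<epsilon> / 4" "cmod c * d \<le> \<epsilon> / 4"
    using lspan_step.prems pos unfolding d_def by (auto simp: divide_simps intro!: mult_left_mono)
  have s1: "sqn M (\<lambda>x. g x - indicator D x) = emeasure M (sym_diff A D)"
    unfolding sqn_def A using SD nn_integral_indicator[OF SD, symmetric]
    by (subst nn_integral_indicator[OF SD, symmetric], intro nn_integral_cong) (auto simp: indicator_def)
  have n1: "(\<integral>\<^sup>+x. norm (g x - indicator D x) \<partial>M) = emeasure M (sym_diff A D)"
    unfolding A by (subst nn_integral_indicator[OF SD, symmetric], intro nn_integral_cong) (auto simp: indicator_def)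
  have eq: "(f x + c * g x) - v x = (f x - t x) + c * (g x - indicator D x)" for x
    by (simp add: v_def algebra_simps)
  have gm: "(\<lambda>x. g x - indicator D x) \<in> borel_measurable M" using A D by simp
  have "sqn M (\<lambda>x. (f x + c * g x) - v x) \<le>
      2 * sqn M (\<lambda>x. f x - t x) + 2 * (ennreal ((cmod c)\<^sup>2) * emeasure M (sym_diff A D))"
    unfolding eq s1[symmetric] using fm tm gm
    by (subst sqn_scale[symmetric], simp, intro sqn_add_le) auto
  also have "\<dots> < ennreal \<epsilon>"
  proof (rule ennreal_quarters_less[OF t(2) _ lspan_step.prems])
    have "ennreal ((cmod c)\<^sup>2) * emeasure M (sym_diff A D) \<le> ennreal ((cmod c)\<^sup>2) * ennreal d"
      using D by (intro mult_left_mono) auto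
    also have "\<dots> \<le> ennreal (\<epsilon> / 4)" using cd d by (simp flip: ennreal_mult add: ennreal_leI)
    finally show "ennreal ((cmod c)\<^sup>2) * emeasure M (sym_diff A D) \<le> ennreal (\<epsilon> / 4)" .
  qed
  finally have 1: "sqn M (\<lambda>x. (f x + c * g x) - v x) < ennreal \<epsilon>" .
  have "(\<integral>\<^sup>+x. norm ((f x + c * g x) - v x) \<partial>M) \<le>
      (\<integral>\<^sup>+x. ennreal (norm (f x - t x)) + ennreal (cmod c) * ennreal (norm (g x - indicator D x)) \<partial>M)"
    unfolding eq
  proof (intro nn_integral_mono)
    fix x
    show "ennreal (norm ((f x - t x) + c * (g x - indicator D x))) \<le>
        ennreal (norm (f x - t x)) + ennreal (cmod c) * ennreal (norm (g x - indicator D x))"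
      using norm_triangle_ineq[of "f x - t x" "c * (g x - indicator D x)"]
      by (simp flip: ennreal_plus ennreal_mult add: norm_mult ennreal_leI)
  qed
  also have "\<dots> = (\<integral>\<^sup>+x. norm (f x - t x) \<partial>M) + ennreal (cmod c) * emeasure M (sym_diff A D)"
    unfolding n1[symmetric] using fm tm gm by (simp add: nn_integral_add nn_integral_cmult)
  also have "\<dots> \<le> 2 * (\<integral>\<^sup>+x. norm (f x - t x) \<partial>M) + 2 * (ennreal (cmod c) * emeasure M (sym_diff A D))"
    by (intro add_mono) (simp_all add: mult_2)
  also have "\<dots> < ennreal \<epsilon>"
  proof (rule ennreal_quarters_less[OF t(3) _ lspan_step.prems])
    have "ennreal (cmod c) * emeasure M (sym_diff A D) \<le> ennreal (cmod c) * ennreal d"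
      using D by (intro mult_left_mono) auto
    also have "\<dots> \<le> ennreal (\<epsilon> / 4)" using cd d by (simp flip: ennreal_mult add: ennreal_leI)
    finally show "ennreal (cmod c) * emeasure M (sym_diff A D) \<le> ennreal (\<epsilon> / 4)" .
  qed
  finally have 2: "(\<integral>\<^sup>+x. norm ((f x + c * g x) - v x) \<partial>M) < ennreal \<epsilon>" .
  have "v \<in> step" unfolding v_def by (intro lspan_add lspan_scale t D)
  with 1 2 show ?case by blast
qed

lemma L2_approx_step:
  assumes f: "f \<in> L2 M" and e: "\<epsilon> > 0"
  shows "\<exists>t\<in>step. sqn M (\<lambda>x. f x - t x) < ennreal \<epsilon> \<and>
    (integrable M f \<longrightarrow> (\<integral>\<^sup>+x. norm (f x - t x) \<partial>M) < ennreal \<epsilon>)"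
proof -
  obtain s where s: "s \<in> lspan (fin_inds M)" "sqn M (\<lambda>x. f x - s x) < ennreal (\<epsilon> / 4)"
      "integrable M f \<longrightarrow> (\<integral>\<^sup>+x. norm (f x - s x) \<partial>M) < ennreal (\<epsilon> / 4)"
    using L2_approx_fin_inds[OF f, of "\<epsilon> / 4"] e by auto
  obtain t where t: "t \<in> step" "sqn M (\<lambda>x. s x - t x) < ennreal (\<epsilon> / 4)"
      "(\<integral>\<^sup>+x. norm (s x - t x) \<partial>M) < ennreal (\<epsilon> / 4)"
    using fin_inds_approx_step[OF s(1), of "\<epsilon> / 4"] e by auto
  have m: "f \<in> borel_measurable M" "s \<in> borel_measurable M" "t \<in> borel_measurable M"
    using f lspan_L2[OF s(1) fin_inds_L2] step_measurable[OF t(1)] by (auto simp: L2_def)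
  have "sqn M (\<lambda>x. f x - t x) \<le> 2 * sqn M (\<lambda>x. f x - s x) + 2 * sqn M (\<lambda>x. s x - t x)"
    by (intro sqn_triangle m)
  also have "\<dots> < ennreal \<epsilon>" using s t e by (intro ennreal_quarters_less) auto
  finally have 1: "sqn M (\<lambda>x. f x - t x) < ennreal \<epsilon>" .
  have 2: "(\<integral>\<^sup>+x. norm (f x - t x) \<partial>M) < ennreal \<epsilon>" if i: "integrable M f"
  proof -
    have "(\<integral>\<^sup>+x. norm (f x - t x) \<partial>M) \<le>
        (\<integral>\<^sup>+x. ennreal (norm (f x - s x)) + ennreal (norm (s x - t x)) \<partial>M)"
    proof (intro nn_integral_mono)
      fix x show "ennreal (norm (f x - t x)) \<le> ennreal (norm (f x - s x)) + ennreal (norm (s x - t x))"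
        using norm_triangle_ineq[of "f x - s x" "s x - t x"] by (simp flip: ennreal_plus add: ennreal_leI)
    qed
    also have "\<dots> = (\<integral>\<^sup>+x. norm (f x - s x) \<partial>M) + (\<integral>\<^sup>+x. norm (s x - t x) \<partial>M)"
      using m by (simp add: nn_integral_add)
    also have "\<dots> \<le> 2 * (\<integral>\<^sup>+x. norm (f x - s x) \<partial>M) + 2 * (\<integral>\<^sup>+x. norm (s x - t x) \<partial>M)"
      by (intro add_mono) (simp_all add: mult_2)
    also have "\<dots> < ennreal \<epsilon>" using s t e i by (intro ennreal_quarters_less) auto
    finally show ?thesis .
  qed
  show ?thesis using t(1) 1 2 by blast
qed

section \<open>The Fourier transform\<close>

abbreviation "ft \<equiv> inv_fourier p M"

lemma integrable_times_pairing:
  assumes "integrable M f" "x \<in> V"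
  shows "integrable M (\<lambda>\<omega>. f \<omega> * pairing p x \<omega>)"
proof (rule Bochner_Integration.integrable_bound[OF assms(1)])
  show "(\<lambda>\<omega>. f \<omega> * pairing p x \<omega>) \<in> borel_measurable M"
    using assms by (intro borel_measurable_times measurable_pairing) auto
qed (simp add: norm_mult)

lemma ft_add_scale:
  assumes "integrable M f" "integrable M g" "x \<in> V"
  shows "ft (\<lambda>\<omega>. f \<omega> + c * g \<omega>) x = ft f x + c * ft g x"
proof -
  have "ft (\<lambda>\<omega>. f \<omega> + c * g \<omega>) x =
      (\<integral>\<omega>. f \<omega> * pairing p x \<omega> + c * (g \<omega> * pairing p x \<omega>) \<partial>M)"
    by (simp add: inv_fourier_def algebra_simps)
  also have "\<dots> = ft f x + c * ft g x"
    using integrable_times_pairing assms by (simp add: inv_fourier_def)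
  finally show ?thesis .
qed

lemma ft_diff:
  assumes "integrable M f" "integrable M g" "x \<in> V"
  shows "ft (\<lambda>\<omega>. f \<omega> - g \<omega>) x = ft f x - ft g x"
  using ft_add_scale[OF assms, of "-1"] by simp

lemma ft_zero [simp]: "ft (\<lambda>\<omega>. 0) x = 0"
  by (simp add: inv_fourier_def)

text \<open>Characters have modulus 1. Convergence of integrands in the integral norm therefore
  gives pointwise convergence of transforms.\<close>

lemma norm_ft_le:
  assumes "integrable M f" "x \<in> V"
  shows "ennreal (norm (ft f x)) \<le> (\<integral>\<^sup>+\<omega>. norm (f \<omega>) \<partial>M)"
proof -
  have "ennreal (norm (ft f x)) \<le> (\<integral>\<^sup>+\<omega>. norm (f \<omega> * pairing p x \<omega>) \<partial>M)"
    unfolding inv_fourier_def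
    by (rule integral_norm_bound_ennreal) (rule integrable_times_pairing[OF assms])
  then show ?thesis by (simp add: norm_mult)
qed

lemma ft_sum:
  assumes "\<And>a. a \<in> F \<Longrightarrow> integrable M (f a)" "x \<in> V"
  shows "ft (\<lambda>\<omega>. \<Sum>a\<in>F. c a * f a \<omega>) x = (\<Sum>a\<in>F. c a * ft (f a) x)"
  using assms
proof (induction F rule: infinite_finite_induct)
  case (insert a F)
  then have "integrable M (\<lambda>\<omega>. \<Sum>a\<in>F. c a * f a \<omega>)" by auto
  then show ?case
    using insert ft_add_scale[of "\<lambda>\<omega>. \<Sum>a\<in>F. c a * f a \<omega>" "f a" x "c a"]
    by (simp add: add.commute)
qed auto

text \<open>The character of \<open>x\<close> merges with the frequency into
  \<open>vadd p k x\<close>. \<open>integral_atom\<close> confines this sum to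
  \<open>nbhd p (- l)\<close>, hence \<open>x\<close> to a cylinder around the inverse of
  \<open>k\<close>, and the old centre \<open>w\<close> becomes the frequency.\<close>

lemma ft_atom:
  assumes "w \<in> V" "k \<in> V" "x \<in> V"
  shows "ft (atom p w l k) x = of_real (real p powi (- l)) * pairing p k w *
    atom p (vminus p (\<lambda>_. 0) k) (- l) w x"
proof -
  have "ft (atom p w l k) x = (\<integral>\<omega>. indicator (cyl p w l) \<omega> * pairing p (vadd p k x) \<omega> \<partial>M)"
    unfolding inv_fourier_def atom_def
    by (rule Bochner_Integration.integral_cong) (use assms in \<open>simp_all add: pairing_vadd mult_ac\<close>)
  also have "\<dots> = of_real (real p powi (- l)) * pairing p (vadd p k x) w *
      indicator (nbhd p (- l)) (vadd p k x)"
    using assms by (intro integral_atom) auto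
  also have "indicator (nbhd p (- l)) (vadd p k x) =
      (indicator (cyl p (vminus p (\<lambda>_. 0) k) (- l)) x :: complex)"
    using assms by (simp add: nbhd_eq_cyl vadd_in_cyl indicator_def)
  finally show ?thesis
    using assms by (simp add: atom_def pairing_vadd pairing_commute[of p x])
qed

lemma ft_step:
  assumes "f \<in> step"
  shows "\<exists>s\<in>step. \<forall>x\<in>V. ft f x = s x"
  using assms
proof induction
  case lspan_zero
  show ?case by (intro bexI[of _ "\<lambda>x. 0"]) (auto simp: lspan.lspan_zero)
next
  case (lspan_step f g c)
  then obtain s where s: "s \<in> step" "\<forall>x\<in>V. ft f x = s x" by blast
  obtain w l k where g: "g = atom p w l k" "w \<in> V" "k \<in> V"
    using lspan_step by (auto simp: atoms_def)
  define d where "d = c * (of_real (real p powi (- l)) * pairing p k w)"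
  have "(\<lambda>x. s x + d * atom p (vminus p (\<lambda>_. 0) k) (- l) w x) \<in> step"
    using s g by (intro lspan.lspan_step atom_in_atoms) auto
  moreover have "ft (\<lambda>x. f x + c * g x) x = s x + d * atom p (vminus p (\<lambda>_. 0) k) (- l) w x"
    if x: "x \<in> V" for x
    using s x step_integrable[OF lspan_step.hyps(1)] atoms_integrable lspan_step.hyps(2)
    by (subst ft_add_scale) (auto simp: d_def g ft_atom)
  ultimately show ?case
    by (intro bexI[of _ "\<lambda>x. s x + d * atom p (vminus p (\<lambda>_. 0) k) (- l) w x"] ballI)
qed

text \<open>Position and frequency trade places under \<open>ft\<close>, so the atom with centre
  \<open>w\<close> and frequency \<open>k\<close> comes from one with centre \<open>k\<close> and
  frequency inverse to \<open>w\<close>. This surjectivity later brings arbitrary \<open>L2\<close>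
  functions within reach of transforms.\<close>

lemma step_eq_ft:
  assumes "s \<in> step"
  shows "\<exists>f\<in>step. \<forall>x\<in>V. s x = ft f x"
  using assms
proof induction
  case lspan_zero
  show ?case by (intro bexI[of _ "\<lambda>x. 0"]) (auto simp: lspan.lspan_zero)
next
  case (lspan_step s g c)
  then obtain f where f: "f \<in> step" "\<forall>x\<in>V. s x = ft f x" by blast
  obtain w l k where g: "g = atom p w l k" "w \<in> V" "k \<in> V"
    using lspan_step by (auto simp: atoms_def)
  define u where "u = vminus p (\<lambda>_. 0) w"
  have u: "u \<in> V" "vminus p (\<lambda>_. 0) u = w" using g by (simp_all add: u_def vminus_vminus_0)
  \<comment> \<open>The factor that \<open>ft_atom\<close> produces for
    \<open>atom p k (- l) u\<close>; it is nonzero and is divided out of the coefficient.\<close>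
  define e where "e = of_real (real p powi l) * pairing p u k"
  have e: "e \<noteq> 0" using p_pos norm_pairing[of p u k] by (auto simp: e_def simp del: norm_pairing)
  have at: "atom p k (- l) u \<in> atoms p" using u g by (intro atom_in_atoms)
  have "(\<lambda>x. f x + c / e * atom p k (- l) u x) \<in> step"
    using f at by (intro lspan.lspan_step)
  moreover have "s x + c * g x = ft (\<lambda>x. f x + c / e * atom p k (- l) u x) x" if x: "x \<in> V" for x
  proof -
    have "ft (\<lambda>x. f x + c / e * atom p k (- l) u x) x = ft f x + c / e * ft (atom p k (- l) u) x"
      using step_integrable[OF f(1)] atoms_integrable at x by (intro ft_add_scale) auto
    also have "ft (atom p k (- l) u) x = e * g x"
      using u g x by (simp add: ft_atom e_def)
    finally show ?thesis using e f x by simp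
  qed
  ultimately show ?case
    by (intro bexI[of _ "\<lambda>x. f x + c / e * atom p k (- l) u x"] ballI)
qed

lemma L2_cong: "(\<And>x. x \<in> V \<Longrightarrow> f x = g x) \<Longrightarrow> f \<in> L2 M \<longleftrightarrow> g \<in> L2 M"
  using measurable_cong[of M f g borel] sqn_cong[of M f g] by (simp add: L2_iff)

lemma L2_inner_cong:
  "(\<And>x. x \<in> V \<Longrightarrow> f x = f' x) \<Longrightarrow> (\<And>x. x \<in> V \<Longrightarrow> g x = g' x) \<Longrightarrow> L2_inner M f g = L2_inner M f' g'"
  unfolding L2_inner_def by (rule Bochner_Integration.integral_cong) auto

lemma ft_step_L2: "f \<in> step \<Longrightarrow> ft f \<in> L2 M"
  using ft_step[of f] L2_cong[of "ft f"] step_L2 by metis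

text \<open>With \<open>l' \<le> l\<close> the first cylinder lies inside the second or misses it,
  as its centre \<open>w\<close> decides; the frequencies subtract and \<open>integral_atom\<close>
  applies.\<close>

lemma inner_atoms:
  assumes "w \<in> V" "k \<in> V" "w' \<in> V" "k' \<in> V" "l' \<le> l"
  shows "L2_inner M (atom p w l k) (atom p w' l' k') = indicator (cyl p w' l') w *
    (of_real (real p powi (- l)) * pairing p (vminus p k k') w *
      indicator (nbhd p (- l)) (vminus p k k'))"
proof -
  have "L2_inner M (atom p w l k) (atom p w' l' k') =
      (\<integral>\<omega>. indicator (cyl p w' l') w * (indicator (cyl p w l) \<omega> * pairing p (vminus p k k') \<omega>) \<partial>M)"
    unfolding L2_inner_def
  proof (rule Bochner_Integration.integral_cong)
    fix \<omega> assume "\<omega> \<in> space M"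
    moreover have "\<omega> \<in> cyl p w l \<Longrightarrow> \<omega> \<in> cyl p w' l' \<longleftrightarrow> w \<in> cyl p w' l'"
      using assms by (auto simp: cyl_def)
    ultimately show "atom p w l k \<omega> * cnj (atom p w' l' k' \<omega>) =
        indicator (cyl p w' l') w * (indicator (cyl p w l) \<omega> * pairing p (vminus p k k') \<omega>)"
      using assms by (auto simp: atom_def pairing_vminus indicator_def)
  qed simp
  also have "\<dots> = indicator (cyl p w' l') w *
      (\<integral>\<omega>. indicator (cyl p w l) \<omega> * pairing p (vminus p k k') \<omega> \<partial>M)"
    by simp
  finally show ?thesis using assms by (simp add: integral_atom)
qed

lemma cnj_indicator: "cnj (indicator A x) = indicator A x"
  by (simp split: split_indicator)

text \<open>The two conditions in \<open>inner_atoms\<close>, on the centres and on the frequencies,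
  are interchanged by the transform, and the powers of \<open>p\<close> compensate.\<close>

lemma ft_inner_atoms:
  assumes "w \<in> V" "k \<in> V" "w' \<in> V" "k' \<in> V"
  shows "L2_inner M (ft (atom p w l k)) (ft (atom p w' l' k')) =
    L2_inner M (atom p w l k) (atom p w' l' k')"
proof -
  have *: "L2_inner M (ft (atom p w l k)) (ft (atom p w' l' k')) =
      L2_inner M (atom p w l k) (atom p w' l' k')"
    if V: "w \<in> V" "k \<in> V" "w' \<in> V" "k' \<in> V" and le: "l' \<le> l" for w k w' k' l l'
  proof -
    define nk where "nk = vminus p (\<lambda>_. 0) k"
    define nk' where "nk' = vminus p (\<lambda>_. 0) k'"
    have nV: "nk \<in> V" "nk' \<in> V" using V by (simp_all add: nk_def nk'_def)
    define c where "c = of_real (real p powi (- l)) * pairing p k w"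
    define c' where "c' = of_real (real p powi (- l')) * pairing p k' w'"
    have "L2_inner M (ft (atom p w l k)) (ft (atom p w' l' k')) =
        L2_inner M (\<lambda>x. c * atom p nk (- l) w x) (\<lambda>x. c' * atom p nk' (- l') w' x)"
      using V by (intro L2_inner_cong) (simp_all add: ft_atom c_def c'_def nk_def nk'_def)
    also have "\<dots> = c * cnj c' * L2_inner M (atom p nk (- l) w) (atom p nk' (- l') w')"
      unfolding L2_inner_def
      by (subst Bochner_Integration.integral_mult_right_zero[symmetric]) (simp add: mult_ac)
    \<comment> \<open>The transform negates levels and so reverses their order; conjugate symmetry
      restores the order that \<open>inner_atoms\<close> expects.\<close>
    also have "L2_inner M (atom p nk (- l) w) (atom p nk' (- l') w') =
        cnj (L2_inner M (atom p nk' (- l') w') (atom p nk (- l) w))"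
      by (rule L2_inner_commute)
    also have "L2_inner M (atom p nk' (- l') w') (atom p nk (- l) w) = indicator (cyl p nk (- l)) nk' *
        (of_real (real p powi l') * pairing p (vminus p w' w) nk' *
          indicator (nbhd p l') (vminus p w' w))"
      using V nV le by (subst inner_atoms) auto
    also have "indicator (cyl p nk (- l)) nk' = (indicator (nbhd p (- l)) (vminus p k k') :: complex)"
    proof -
      have "vadd p k nk' = vminus p k k'"
        by (simp add: nk'_def vadd_def vminus_def mod_simps)
      then have "nk' \<in> cyl p nk (- l) \<longleftrightarrow> vminus p k k' \<in> nbhd p (- l)"
        using V nV vadd_in_cyl[of k nk' "\<lambda>_. 0" "- l"] by (simp add: nk_def nbhd_eq_cyl)
      then show ?thesis by (simp add: indicator_def)
    qed
    also have "indicator (nbhd p l') (vminus p w' w) = (indicator (cyl p w' l') w :: complex)"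
    proof -
      have "vminus p w' w \<in> nbhd p l' \<longleftrightarrow> w' \<in> cyl p w l'"
        using V by (simp add: vminus_in_cyl_0 nbhd_eq_cyl)
      also have "\<dots> \<longleftrightarrow> w \<in> cyl p w' l'" using V by (auto simp: cyl_def)
      finally show ?thesis by (simp add: indicator_def)
    qed
    also have "pairing p (vminus p w' w) nk' = cnj (pairing p k' w') * pairing p k' w"
      using V nV unfolding nk'_def
      by (simp add: pairing_vminus pairing_vminus_right pairing_commute[of p w] pairing_commute[of p w']
          pairing_commute[of p _ "\<lambda>_. 0"])
    finally have "L2_inner M (ft (atom p w l k)) (ft (atom p w' l' k')) =
        indicator (cyl p w' l') w * indicator (nbhd p (- l)) (vminus p k k') *
        of_real (real p powi (- l)) * (of_real (real p powi (- l')) * of_real (real p powi l')) *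
        (pairing p k w * cnj (pairing p k' w)) * (pairing p k' w' * cnj (pairing p k' w'))"
      by (simp add: c_def c'_def cnj_indicator mult_ac del: mult_cancel_left mult_cancel_right)
    also have "of_real (real p powi (- l')) * of_real (real p powi l') = (1 :: complex)"
      using p_pos by (simp flip: of_real_mult add: power_int_minus)
    also have "pairing p k' w' * cnj (pairing p k' w') = 1" by simp
    finally show ?thesis using V le by (simp add: inner_atoms pairing_vminus mult_ac)
  qed
  show ?thesis
  proof (cases "l' \<le> l")
    case False
    then show ?thesis using *[of w' k' w k l l'] assms by (metis L2_inner_commute le_cases)
  qed (use * assms in auto)
qed

lemma ft_inner_step:
  assumes f: "f \<in> step" and g: "g \<in> step"
  shows "L2_inner M (ft f) (ft g) = L2_inner M f g"
proof -
  have atom_left: "L2_inner M (ft a) (ft g) = L2_inner M a g" if a: "a \<in> atoms p" for a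
    using g
  proof induction
    case (lspan_step g b c)
    have aL2: "ft a \<in> L2 M" "ft b \<in> L2 M" "a \<in> L2 M" "b \<in> L2 M"
      using a lspan_step.hyps atoms_L2 by (auto intro!: ft_step_L2 lspan_base)
    have "L2_inner M (ft a) (ft (\<lambda>x. g x + c * b x)) = L2_inner M (ft a) (\<lambda>x. ft g x + c * ft b x)"
      using step_integrable[OF lspan_step.hyps(1)] atoms_integrable lspan_step.hyps(2)
      by (intro L2_inner_cong refl ft_add_scale) auto
    also have "\<dots> = L2_inner M (ft a) (ft g) + cnj c * L2_inner M (ft a) (ft b)"
      using aL2 ft_step_L2[OF lspan_step.hyps(1)] by (intro L2_inner_add_right)
    also have "L2_inner M (ft a) (ft b) = L2_inner M a b"
      using a lspan_step.hyps(2) by (auto simp: atoms_def ft_inner_atoms)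
    also have "L2_inner M (ft a) (ft g) + cnj c * L2_inner M a b = L2_inner M a (\<lambda>x. g x + c * b x)"
      using aL2 step_L2[OF lspan_step.hyps(1)] lspan_step.IH by (simp add: L2_inner_add_right)
    finally show ?case .
  qed (simp add: L2_inner_def)
  show ?thesis
    using f
  proof induction
    case (lspan_step f b c)
    have bL2: "ft b \<in> L2 M" "b \<in> L2 M"
      using lspan_step.hyps atoms_L2 by (auto intro!: ft_step_L2 lspan_base)
    have "L2_inner M (ft (\<lambda>x. f x + c * b x)) (ft g) = L2_inner M (\<lambda>x. ft f x + c * ft b x) (ft g)"
      using step_integrable[OF lspan_step.hyps(1)] atoms_integrable lspan_step.hyps(2)
      by (intro L2_inner_cong refl ft_add_scale) auto
    also have "\<dots> = L2_inner M (ft f) (ft g) + c * L2_inner M (ft b) (ft g)"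
      using bL2 ft_step_L2[OF lspan_step.hyps(1)] ft_step_L2[OF g] by (intro L2_inner_add_left)
    also have "\<dots> = L2_inner M (\<lambda>x. f x + c * b x) g"
      using bL2 step_L2[OF lspan_step.hyps(1)] step_L2[OF g] lspan_step atom_left
      by (simp add: L2_inner_add_left)
    finally show ?case .
  qed (simp add: L2_inner_def)
qed

section \<open>Isometry for integrable, square-integrable functions\<close>

lemma sqn_eq_of_inner:
  assumes "f \<in> L2 M" "g \<in> L2 M" "L2_inner M f f = L2_inner M g g"
  shows "sqn M f = sqn M g"
  using assms unfolding L2_inner_self of_real_eq_iff by (simp add: sqn_eq_integral)

lemma inner_self_eq_of_sqn:
  assumes "f \<in> L2 M" "g \<in> L2 M" "sqn M f = sqn M g"
  shows "L2_inner M f f = L2_inner M g g"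
  using assms by (simp add: sqn_eq_integral L2_inner_self)

lemma sqn_ft_step: "f \<in> step \<Longrightarrow> sqn M (ft f) = sqn M f"
  by (intro sqn_eq_of_inner ft_step_L2 step_L2 ft_inner_step)

text \<open>Fatou's lemma along step functions converging in both \<open>L\<^sup>1\<close> and \<open>L\<^sup>2\<close>.\<close>

lemma ft_crude_bound:
  assumes g: "g \<in> L2 M" "integrable M g" and e: "\<epsilon> > 0"
  shows "ft g \<in> borel_measurable M" and "sqn M (ft g) \<le> 2 * sqn M g + 2 * ennreal \<epsilon>"
proof -
  \<comment> \<open>The cap \<open>\<epsilon>\<close> bounds the norms of all
    \<open>ft (s n)\<close> uniformly; the reciprocal makes them converge pointwise to
    \<open>ft g\<close>.\<close>
  define d where "d n = min \<epsilon> (inverse (real (Suc n)))" for n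
  have d: "d n > 0" for n using e by (simp add: d_def)
  have "\<exists>s. \<forall>n. s n \<in> step \<and> sqn M (\<lambda>x. g x - s n x) < ennreal (d n) \<and>
      (\<integral>\<^sup>+x. norm (g x - s n x) \<partial>M) < ennreal (d n)"
    by (rule choice) (use L2_approx_step[OF g(1) d] g(2) in blast)
  then obtain s where s: "\<And>n. s n \<in> step" "\<And>n. sqn M (\<lambda>x. g x - s n x) < ennreal (d n)"
      "\<And>n. (\<integral>\<^sup>+x. norm (g x - s n x) \<partial>M) < ennreal (d n)" by blast
  have lim: "(\<lambda>n. ft (s n) x) \<longlonglongrightarrow> ft g x" if x: "x \<in> V" for x
  proof -
    have "norm (ft (s n) x - ft g x) \<le> inverse (real (Suc n))" for n
    proof -
      have "ennreal (norm (ft g x - ft (s n) x)) \<le> (\<integral>\<^sup>+\<omega>. norm (g \<omega> - s n \<omega>) \<partial>M)"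
        using g step_integrable[OF s(1)] x norm_ft_le[of "\<lambda>\<omega>. g \<omega> - s n \<omega>" x] by (simp add: ft_diff)
      also have "\<dots> \<le> ennreal (d n)" using s(3) by (rule less_imp_le)
      finally have "norm (ft g x - ft (s n) x) \<le> d n" using d[of n] by (simp add: less_imp_le)
      then show ?thesis by (simp add: norm_minus_commute d_def)
    qed
    then have "(\<lambda>n. ft (s n) x - ft g x) \<longlonglongrightarrow> 0"
      by (intro Lim_null_comparison[OF _ LIMSEQ_inverse_real_of_nat]) auto
    then show ?thesis by (simp add: LIM_zero_iff)
  qed
  have sm: "ft (s n) \<in> borel_measurable M" for n using ft_step_L2[OF s(1)] by (simp add: L2_def)
  show m: "ft g \<in> borel_measurable M"
    by (rule borel_measurable_LIMSEQ_metric[of "\<lambda>n. ft (s n)", OF sm]) (use lim in simp)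
  have bound: "sqn M (ft (s n)) \<le> 2 * sqn M g + 2 * ennreal \<epsilon>" for n
  proof -
    have "sqn M (s n) \<le> 2 * sqn M g + 2 * sqn M (\<lambda>x. s n x - g x)"
      using sqn_add_le[of g M "\<lambda>x. s n x - g x"] g step_measurable[OF s(1)] by (simp add: L2_def)
    also have "\<dots> \<le> 2 * sqn M g + 2 * ennreal (d n)"
      using s(2)[of n] by (intro add_mono mult_left_mono) (auto simp: sqn_commute[of M "s n"])
    also have "\<dots> \<le> 2 * sqn M g + 2 * ennreal \<epsilon>"
      by (intro add_mono mult_left_mono ennreal_leI) (auto simp: d_def)
    finally show ?thesis by (simp add: sqn_ft_step[OF s(1)])
  qed
  have "sqn M (ft g) = (\<integral>\<^sup>+x. liminf (\<lambda>n. ennreal ((cmod (ft (s n) x))\<^sup>2)) \<partial>M)"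
    unfolding sqn_def
  proof (rule nn_integral_cong)
    fix x assume "x \<in> space M"
    then have "(\<lambda>n. ennreal ((cmod (ft (s n) x))\<^sup>2)) \<longlonglongrightarrow> ennreal ((cmod (ft g x))\<^sup>2)"
      using lim by (intro tendsto_intros) auto
    then show "ennreal ((cmod (ft g x))\<^sup>2) = liminf (\<lambda>n. ennreal ((cmod (ft (s n) x))\<^sup>2))"
      by (rule lim_imp_Liminf[OF sequentially_bot, symmetric])
  qed
  also have "\<dots> \<le> liminf (\<lambda>n. \<integral>\<^sup>+x. ennreal ((cmod (ft (s n) x))\<^sup>2) \<partial>M)"
    using sm by (intro nn_integral_liminf) measurable
  also have "\<dots> \<le> 2 * sqn M g + 2 * ennreal \<epsilon>"
    using bound by (intro Liminf_le) (auto simp: sqn_def)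
  finally show "sqn M (ft g) \<le> 2 * sqn M g + 2 * ennreal \<epsilon>" .
qed

text \<open>The crude bound is applied only to \<open>g - s\<close> with a step function
  \<open>s\<close>: whatever its constant, it makes \<open>ft s\<close> close to
  \<open>ft g\<close>. Norms of step functions are preserved exactly, and
  \<open>sqn_le_of_approx\<close> yields both inequalities.\<close>

theorem plancherel:
  assumes g: "g \<in> L2 M" "integrable M g"
  shows "sqn M (ft g) = sqn M g" and "ft g \<in> L2 M"
proof -
  have m: "ft g \<in> borel_measurable M" "g \<in> borel_measurable M"
    using ft_crude_bound(1)[OF g, of 1] g by (auto simp: L2_def)
  have ap: "\<exists>s\<in>step. sqn M (\<lambda>x. g x - s x) \<le> ennreal \<epsilon> \<and> sqn M (\<lambda>x. ft g x - ft s x) \<le> ennreal \<epsilon>"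
    if e: "\<epsilon> > 0" for \<epsilon>
  proof -
    obtain s where s: "s \<in> step" "sqn M (\<lambda>x. g x - s x) < ennreal (\<epsilon> / 4)"
      using L2_approx_step[OF g(1), of "\<epsilon> / 4"] e by auto
    have gs: "(\<lambda>x. g x - s x) \<in> L2 M" "integrable M (\<lambda>x. g x - s x)"
      using g step_L2[OF s(1)] step_integrable[OF s(1)] by (auto intro: L2_diff)
    have "sqn M (\<lambda>x. ft g x - ft s x) = sqn M (ft (\<lambda>x. g x - s x))"
      using g step_integrable[OF s(1)] by (intro sqn_cong) (simp add: ft_diff)
    also have "\<dots> \<le> 2 * sqn M (\<lambda>x. g x - s x) + 2 * ennreal (\<epsilon> / 4)"
      using e by (intro ft_crude_bound(2)[OF gs]) simp
    also have "\<dots> < ennreal \<epsilon>" using s e by (intro ennreal_quarters_less) auto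
    finally have "sqn M (\<lambda>x. ft g x - ft s x) \<le> ennreal \<epsilon>" by simp
    moreover have "sqn M (\<lambda>x. g x - s x) \<le> ennreal \<epsilon>"
      using s(2) e by (intro order_trans[OF less_imp_le[OF s(2)]] ennreal_leI) auto
    ultimately show ?thesis using s by blast
  qed
  have sm: "s \<in> borel_measurable M" "ft s \<in> borel_measurable M" if "s \<in> step" for s
    using step_measurable[OF that] ft_step_L2[OF that] by (auto simp: L2_def)
  show eq: "sqn M (ft g) = sqn M g"
  proof (rule antisym)
    show "sqn M (ft g) \<le> sqn M g"
    proof (rule sqn_le_of_approx[OF m])
      fix \<epsilon> :: real assume "\<epsilon> > 0"
      then obtain s where "s \<in> step" "sqn M (\<lambda>x. g x - s x) \<le> ennreal \<epsilon>"
        "sqn M (\<lambda>x. ft g x - ft s x) \<le> ennreal \<epsilon>" using ap by blast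
      then show "\<exists>f' g'. f' \<in> borel_measurable M \<and> g' \<in> borel_measurable M \<and>
          sqn M (\<lambda>x. ft g x - f' x) \<le> ennreal \<epsilon> \<and> sqn M (\<lambda>x. g x - g' x) \<le> ennreal \<epsilon> \<and>
          sqn M f' = sqn M g'"
        using sm sqn_ft_step by (intro exI[of _ "ft s"] exI[of _ s]) auto
    qed
    show "sqn M g \<le> sqn M (ft g)"
    proof (rule sqn_le_of_approx[OF m(2,1)])
      fix \<epsilon> :: real assume "\<epsilon> > 0"
      then obtain s where "s \<in> step" "sqn M (\<lambda>x. g x - s x) \<le> ennreal \<epsilon>"
        "sqn M (\<lambda>x. ft g x - ft s x) \<le> ennreal \<epsilon>" using ap by blast
      then show "\<exists>f' g'. f' \<in> borel_measurable M \<and> g' \<in> borel_measurable M \<and>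
          sqn M (\<lambda>x. g x - f' x) \<le> ennreal \<epsilon> \<and> sqn M (\<lambda>x. ft g x - g' x) \<le> ennreal \<epsilon> \<and>
          sqn M f' = sqn M g'"
        using sm sqn_ft_step by (intro exI[of _ "ft s"] exI[of _ s]) auto
    qed
  qed
  show "ft g \<in> L2 M" using eq g m by (simp add: L2_iff)
qed

text \<open>Polarization, since the norm of every \<open>f + c * g\<close> is preserved.\<close>

theorem parseval:
  assumes f: "f \<in> L2 M" "integrable M f" and g: "g \<in> L2 M" "integrable M g"
  shows "L2_inner M (ft f) (ft g) = L2_inner M f g"
proof -
  have N: "L2_inner M (\<lambda>x. ft f x + c * ft g x) (\<lambda>x. ft f x + c * ft g x) =
      L2_inner M (\<lambda>x. f x + c * g x) (\<lambda>x. f x + c * g x)" for c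
  proof -
    have fg: "(\<lambda>x. f x + c * g x) \<in> L2 M" "integrable M (\<lambda>x. f x + c * g x)"
      using f g by (auto intro: L2_add L2_scale)
    have "L2_inner M (\<lambda>x. ft f x + c * ft g x) (\<lambda>x. ft f x + c * ft g x) =
        L2_inner M (ft (\<lambda>x. f x + c * g x)) (ft (\<lambda>x. f x + c * g x))"
      using f g by (intro L2_inner_cong) (simp_all add: ft_add_scale)
    also have "\<dots> = L2_inner M (\<lambda>x. f x + c * g x) (\<lambda>x. f x + c * g x)"
      using plancherel[OF fg] fg by (intro inner_self_eq_of_sqn)
    finally show ?thesis .
  qed
  have "4 * L2_inner M (ft f) (ft g) = 4 * L2_inner M f g"
    unfolding L2_inner_polarization[OF plancherel(2)[OF f] plancherel(2)[OF g]]
      L2_inner_polarization[OF f(1) g(1)] N ..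
  then show ?thesis by simp
qed

section \<open>Translation congruence\<close>

definition trig_polys :: "((int \<Rightarrow> int) \<Rightarrow> complex) set" where
  "trig_polys = lspan (pairing p ` H p)"

text \<open>Agreement is asked on \<open>V\<close> alone because multiplicativity of the pairing is
  available only there.\<close>

definition is_trig :: "((int \<Rightarrow> int) \<Rightarrow> complex) \<Rightarrow> bool" where
  "is_trig f \<longleftrightarrow> (\<exists>T\<in>trig_polys. \<forall>\<omega>\<in>V. f \<omega> = T \<omega>)"

lemma is_trig_cong: "is_trig f \<Longrightarrow> (\<And>\<omega>. \<omega> \<in> V \<Longrightarrow> g \<omega> = f \<omega>) \<Longrightarrow> is_trig g"
  by (auto simp: is_trig_def)

lemma is_trigI: "T \<in> trig_polys \<Longrightarrow> (\<And>\<omega>. \<omega> \<in> V \<Longrightarrow> f \<omega> = T \<omega>) \<Longrightarrow> is_trig f"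
  by (auto simp: is_trig_def)

lemma is_trigE:
  assumes "is_trig f"
  obtains T where "T \<in> trig_polys" "\<And>\<omega>. \<omega> \<in> V \<Longrightarrow> f \<omega> = T \<omega>"
  using assms by (auto simp: is_trig_def)

lemma is_trig_add:
  assumes "is_trig f" "is_trig g"
  shows "is_trig (\<lambda>\<omega>. f \<omega> + g \<omega>)"
proof -
  obtain S where S: "S \<in> trig_polys" "\<And>\<omega>. \<omega> \<in> V \<Longrightarrow> f \<omega> = S \<omega>" using assms(1) by (rule is_trigE) blast
  obtain T where T: "T \<in> trig_polys" "\<And>\<omega>. \<omega> \<in> V \<Longrightarrow> g \<omega> = T \<omega>" using assms(2) by (rule is_trigE) blast
  have "(\<lambda>\<omega>. S \<omega> + T \<omega>) \<in> trig_polys"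
    using S(1) T(1) unfolding trig_polys_def by (rule lspan_add)
  then show ?thesis by (rule is_trigI) (simp add: S T)
qed

lemma is_trig_scale:
  assumes "is_trig f"
  shows "is_trig (\<lambda>\<omega>. c * f \<omega>)"
proof -
  obtain S where S: "S \<in> trig_polys" "\<And>\<omega>. \<omega> \<in> V \<Longrightarrow> f \<omega> = S \<omega>" using assms by (rule is_trigE) blast
  have "(\<lambda>\<omega>. c * S \<omega>) \<in> trig_polys"
    using S(1) unfolding trig_polys_def by (rule lspan_scale)
  then show ?thesis by (rule is_trigI) (simp add: S)
qed

lemma is_trig_zero: "is_trig (\<lambda>\<omega>. 0)"
  by (rule is_trigI[of "\<lambda>\<omega>. 0"]) (simp_all add: trig_polys_def lspan_zero)

lemma is_trig_pairing: "h \<in> H p \<Longrightarrow> is_trig (pairing p h)"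
  unfolding is_trig_def trig_polys_def by (intro bexI[of _ "pairing p h"] lspan_base) auto

lemma is_trig_const: "is_trig (\<lambda>\<omega>. c)"
  using is_trig_scale[OF is_trig_pairing[OF zero_in_H], of c] by simp

lemma is_trig_sum: "(\<And>a. a \<in> A \<Longrightarrow> is_trig (f a)) \<Longrightarrow> is_trig (\<lambda>\<omega>. \<Sum>a\<in>A. f a \<omega>)"
  by (induction A rule: infinite_finite_induct) (auto simp: is_trig_zero is_trig_add)

lemma is_trig_mult:
  assumes "is_trig f" "is_trig g"
  shows "is_trig (\<lambda>\<omega>. f \<omega> * g \<omega>)"
proof -
  obtain S T where S: "S \<in> trig_polys" "\<forall>\<omega>\<in>V. f \<omega> = S \<omega>" and T: "T \<in> trig_polys" "\<forall>\<omega>\<in>V. g \<omega> = T \<omega>"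
    using assms unfolding is_trig_def by blast
  have base: "is_trig (\<lambda>\<omega>. pairing p h \<omega> * T \<omega>)" if h: "h \<in> H p" for h
    using T(1) unfolding trig_polys_def
  proof induction
    case (lspan_step T a c)
    then obtain k where k: "k \<in> H p" "a = pairing p k" by auto
    have "is_trig (\<lambda>\<omega>. pairing p h \<omega> * T \<omega> + c * pairing p (vadd p h k) \<omega>)"
      using lspan_step h k by (intro is_trig_add is_trig_scale is_trig_pairing vadd_in_H)
    then show ?case
      by (rule is_trig_cong) (use h k H_subset_V in \<open>auto simp: pairing_vadd algebra_simps subset_iff\<close>)
  qed (simp add: is_trig_zero)
  have "is_trig (\<lambda>\<omega>. S \<omega> * T \<omega>)"
    using S(1) unfolding trig_polys_def
  proof induction
    case (lspan_step S a c)
    then have "is_trig (\<lambda>\<omega>. S \<omega> * T \<omega> + c * (a \<omega> * T \<omega>))"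
      using base by (intro is_trig_add is_trig_scale) auto
    then show ?case by (simp add: algebra_simps)
  qed (simp add: is_trig_zero)
  then show ?thesis by (rule is_trig_cong) (use S T in simp)
qed

lemma is_trig_prod: "(\<And>a. a \<in> A \<Longrightarrow> is_trig (f a)) \<Longrightarrow> is_trig (\<lambda>\<omega>. \<Prod>a\<in>A. f a \<omega>)"
  by (induction A rule: infinite_finite_induct) (auto simp: is_trig_const is_trig_mult)

text \<open>A geometric sum: \<open>ep p n\<close> is a \<open>p\<close>-th root of unity.\<close>

lemma sum_ep: "(\<Sum>a<p. ep p (int a * n)) = (if int p dvd n then of_nat p else 0)"
proof -
  have pow: "ep p (int a * n) = ep p n ^ a" for a
    by (induction a) (simp_all add: distrib_right ep_add)
  show ?thesis
  proof (cases "int p dvd n")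
    case True
    then show ?thesis using p_pos by (simp add: pow ep_eq_1_iff[THEN iffD2])
  next
    case False
    then have "ep p n \<noteq> 1" using p_pos by (simp add: ep_eq_1_iff)
    moreover have "ep p n ^ p = 1" using p_pos pow[of p] by (simp add: ep_eq_1_iff flip: pow)
    ultimately show ?thesis using False by (simp add: pow geometric_sum)
  qed
qed

text \<open>The digit condition \<open>\<omega> j = b\<close> is detected by averaging over the characters
  \<open>a \<mapsto> ep p (a * (\<omega> j - b))\<close> of \<open>\<int>/p\<close>; for \<open>j > 0\<close> these are pairings with elements of \<open>H\<close>.\<close>

lemma is_trig_digit:
  assumes "j > 0" "0 \<le> b" "b < int p"
  shows "is_trig (\<lambda>\<omega>. if \<omega> j = b then 1 else 0)"
proof -
  define f where "f \<omega> = (\<Sum>a<p. ep p (- (int a * b)) / of_nat p * pairing p (single (1 - j) (int a)) \<omega>)"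
    for \<omega>
  have "single (1 - j) (int a) \<in> H p" if "a < p" for a
    using that assms by (simp add: H_def) (simp add: single_def)
  then have "is_trig f"
    unfolding f_def by (intro is_trig_sum is_trig_scale is_trig_pairing) auto
  then show ?thesis
  proof (rule is_trig_cong)
    fix \<omega> assume \<omega>: "\<omega> \<in> V"
    have "f \<omega> = (\<Sum>a<p. ep p (int a * (\<omega> j - b)) / of_nat p)"
      unfolding f_def
    proof (rule sum.cong)
      fix a
      have "pairing p (single (1 - j) (int a)) \<omega> = ep p (\<omega> j * int a)"
        by (simp add: pairing_commute[of p _ \<omega>] pairing_single)
      then show "ep p (- (int a * b)) / of_nat p * pairing p (single (1 - j) (int a)) \<omega> =
          ep p (int a * (\<omega> j - b)) / of_nat p"
        by (simp add: algebra_simps flip: ep_add)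
    qed simp
    also have "\<dots> = (if int p dvd \<omega> j - b then 1 else 0)"
      using p_pos by (simp add: sum_ep flip: sum_divide_distrib)
    also have "int p dvd \<omega> j - b \<longleftrightarrow> \<omega> j = b"
      using vilenkin_ltD[OF \<omega>, of j] assms by (auto simp: mod_eq_dvd_iff[symmetric])
    finally show "(if \<omega> j = b then 1 else 0) = f \<omega>" by simp
  qed
qed

text \<open>Reduced points have zero digits at nonpositive places. Either \<open>w\<close> conflicts
  with this and the indicator vanishes, or membership amounts to the digit conditions at places 1 to
  \<open>l\<close>, whose indicators multiply.\<close>

lemma is_trig_cyl_frac:
  assumes "w \<in> V"
  shows "is_trig (\<lambda>\<omega>. indicator (cyl p w l) (frac_part \<omega>))"
proof (cases "\<forall>j\<le>min l 0. w j = 0")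
  case True
  have "is_trig (\<lambda>\<omega>. \<Prod>j\<in>{1..l}. if \<omega> j = w j then 1 else 0)"
    using vilenkin_ltD[OF assms] by (intro is_trig_prod is_trig_digit) auto
  then show ?thesis
  proof (rule is_trig_cong)
    fix \<omega> assume \<omega>: "\<omega> \<in> V"
    have "frac_part \<omega> \<in> cyl p w l \<longleftrightarrow> (\<forall>j\<in>{1..l}. \<omega> j = w j)"
    proof
      assume "frac_part \<omega> \<in> cyl p w l"
      then have e: "\<forall>j\<le>l. frac_part \<omega> j = w j" by (simp add: cyl_def)
      show "\<forall>j\<in>{1..l}. \<omega> j = w j"
      proof
        fix j assume "j \<in> {1..l}"
        then show "\<omega> j = w j" using e[rule_format, of j] by (simp add: frac_part_def)
      qed
    next
      assume e: "\<forall>j\<in>{1..l}. \<omega> j = w j"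
      have "frac_part \<omega> j = w j" if "j \<le> l" for j
        using e True that by (auto simp: frac_part_def)
      then show "frac_part \<omega> \<in> cyl p w l" using \<omega> by (simp add: cyl_def)
    qed
    then show "indicator (cyl p w l) (frac_part \<omega>) = (\<Prod>j\<in>{1..l}. if \<omega> j = w j then 1 else 0 :: complex)"
      by (auto simp: indicator_def)
  qed
next
  case False
  then obtain j where j: "j \<le> l" "j \<le> 0" "w j \<noteq> 0" by auto
  have "frac_part \<omega> \<notin> cyl p w l" for \<omega>
  proof
    assume "frac_part \<omega> \<in> cyl p w l"
    then have "frac_part \<omega> j = w j" using j by (simp add: cyl_def)
    then show False using j by (simp add: frac_part_def)
  qed
  then show ?thesis by (simp add: is_trig_zero)
qed

text \<open>On reduced points a frequency \<open>k\<close> acts through \<open>int_part k\<close>,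
  an element of \<open>H p\<close>.\<close>

lemma is_trig_step_frac: "s \<in> step \<Longrightarrow> is_trig (\<lambda>\<omega>. s (frac_part \<omega>))"
proof (induction rule: lspan.induct)
  case (lspan_step f g c)
  obtain w l k where g: "g = atom p w l k" "w \<in> V" "k \<in> V"
    using lspan_step by (auto simp: atoms_def)
  have "is_trig (\<lambda>\<omega>. f (frac_part \<omega>) +
      c * (indicator (cyl p w l) (frac_part \<omega>) * pairing p (int_part k) \<omega>))"
    using lspan_step g
    by (intro is_trig_add is_trig_scale is_trig_mult is_trig_cyl_frac is_trig_pairing int_part_in_H)
  then show ?case
    by (rule is_trig_cong) (use g in \<open>simp add: atom_def pairing_frac_part_int_part\<close>)
qed (simp add: is_trig_zero)

text \<open>\<open>H_perp\<close>-translation congruence to \<open>nbhd p 0\<close>, expressed through measures only: reduction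
  modulo \<open>H_perp\<close> maps the measure restricted to the set to the one restricted to \<open>nbhd p 0\<close>.\<close>

definition frac_uniform :: "(int \<Rightarrow> int) set \<Rightarrow> bool" where
  "frac_uniform \<Omega> \<longleftrightarrow> (\<forall>X\<in>sets M. X \<subseteq> nbhd p 0 \<longrightarrow> emeasure M (\<Omega> \<inter> frac_part -` X) = emeasure M X)"

lemma frac_uniformD:
  "frac_uniform \<Omega> \<Longrightarrow> X \<in> sets M \<Longrightarrow> X \<subseteq> nbhd p 0 \<Longrightarrow>
    emeasure M (\<Omega> \<inter> frac_part -` X) = emeasure M X"
  by (simp add: frac_uniform_def)

lemma frac_vimage_sets: "X \<in> sets M \<Longrightarrow> \<Omega> \<in> sets M \<Longrightarrow> \<Omega> \<inter> frac_part -` X \<in> sets M"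
proof -
  assume "X \<in> sets M" "\<Omega> \<in> sets M"
  moreover from this have "\<Omega> \<inter> frac_part -` X = \<Omega> \<inter> (frac_part -` X \<inter> space M)"
    using sets_M_subset[of \<Omega>] by auto
  ultimately show ?thesis using measurable_sets[OF measurable_frac_part] by simp
qed

lemma frac_uniform_Int:
  assumes "frac_uniform \<Omega>" "\<Omega> \<in> sets M" "X \<in> sets M"
  shows "emeasure M (\<Omega> \<inter> frac_part -` X) = emeasure M (nbhd p 0 \<inter> X)"
proof -
  have "\<Omega> \<inter> frac_part -` X = \<Omega> \<inter> frac_part -` (nbhd p 0 \<inter> X)"
    using sets_M_subset[OF assms(2)] frac_part_in_nbhd by auto
  moreover have "emeasure M (\<Omega> \<inter> frac_part -` (nbhd p 0 \<inter> X)) = emeasure M (nbhd p 0 \<inter> X)"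
    using assms by (intro frac_uniformD sets.Int nbhd_sets) auto
  ultimately show ?thesis by (simp only:)
qed

lemma frac_uniform_emeasure:
  assumes "frac_uniform \<Omega>" "\<Omega> \<in> sets M"
  shows "emeasure M \<Omega> = 1"
proof -
  have "\<Omega> \<inter> frac_part -` nbhd p 0 = \<Omega>"
    using sets_M_subset[OF assms(2)] frac_part_in_nbhd by auto
  then show ?thesis using frac_uniform_Int[OF assms nbhd_sets[of 0]] by (simp add: emeasure_nbhd)
qed

lemma emeasure_density_indicator:
  "A \<in> sets M \<Longrightarrow> X \<in> sets M \<Longrightarrow> emeasure (density M (indicator A)) X = emeasure M (A \<inter> X)"
  by (subst emeasure_density) (auto simp flip: indicator_inter_arith)

lemma emeasure_frac_distr:
  assumes "\<Omega> \<in> sets M" "X \<in> sets M"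
  shows "emeasure (distr (density M (indicator \<Omega>)) M frac_part) X = emeasure M (\<Omega> \<inter> frac_part -` X)"
proof -
  have "emeasure (distr (density M (indicator \<Omega>)) M frac_part) X =
      emeasure (density M (indicator \<Omega>)) (frac_part -` X \<inter> V)"
    using assms measurable_frac_part by (subst emeasure_distr) auto
  also have "\<dots> = emeasure M (\<Omega> \<inter> (frac_part -` X \<inter> V))"
    using assms measurable_sets[OF measurable_frac_part assms(2)]
    by (intro emeasure_density_indicator) auto
  also have "\<Omega> \<inter> (frac_part -` X \<inter> V) = \<Omega> \<inter> frac_part -` X"
    using sets_M_subset[OF assms(1)] by auto
  finally show ?thesis .
qed

text \<open>As an equation between image measures the notion is open to change of variables and to
  uniqueness on cylinders.\<close>

lemma frac_uniform_iff_distr: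
  assumes "\<Omega> \<in> sets M"
  shows "frac_uniform \<Omega> \<longleftrightarrow>
    distr (density M (indicator \<Omega>)) M frac_part = density M (indicator (nbhd p 0))"
proof
  assume u: "frac_uniform \<Omega>"
  show "distr (density M (indicator \<Omega>)) M frac_part = density M (indicator (nbhd p 0))"
    by (rule measure_eqI)
       (use assms u in \<open>simp_all add: emeasure_frac_distr emeasure_density_indicator frac_uniform_Int\<close>)
next
  assume d: "distr (density M (indicator \<Omega>)) M frac_part = density M (indicator (nbhd p 0))"
  show "frac_uniform \<Omega>"
    unfolding frac_uniform_def
  proof (intro ballI impI)
    fix X assume X: "X \<in> sets M" "X \<subseteq> nbhd p 0"
    then show "emeasure M (\<Omega> \<inter> frac_part -` X) = emeasure M X"
      using emeasure_frac_distr[OF assms X(1)] emeasure_density_indicator[OF nbhd_sets X(1), of 0]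
      by (simp add: d Int_absorb1)
  qed
qed

lemma integral_density_indicator:
  fixes f :: "(int \<Rightarrow> int) \<Rightarrow> complex"
  assumes "A \<in> sets M" "f \<in> borel_measurable M"
  shows "(\<integral>\<omega>. f \<omega> \<partial>density M (indicator A)) = (\<integral>\<omega>. indicator A \<omega> * f \<omega> \<partial>M)"
proof -
  have "density M (indicator A) = density M (\<lambda>x. ennreal (indicator A x))"
    by (intro arg_cong[where f = "density M"] ext) (simp split: split_indicator)
  then have "(\<integral>\<omega>. f \<omega> \<partial>density M (indicator A)) = (\<integral>\<omega>. indicator A \<omega> *\<^sub>R f \<omega> \<partial>M)"
    using assms by (simp add: integral_density)
  also have "\<dots> = (\<integral>\<omega>. indicator A \<omega> * f \<omega> \<partial>M)"
    by (rule Bochner_Integration.integral_cong) (auto split: split_indicator)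
  finally show ?thesis .
qed

lemma H_nbhd: "h \<in> H p \<Longrightarrow> h \<in> nbhd p 0 \<longleftrightarrow> h = (\<lambda>_. 0)"
  by (auto simp: H_def nbhd_def fun_eq_iff) (meson not_le)

lemma integral_nbhd_pairing:
  assumes "h \<in> H p"
  shows "(\<integral>\<omega>. indicator (nbhd p 0) \<omega> * pairing p h \<omega> \<partial>M) = (if h = (\<lambda>_. 0) then 1 else 0)"
  using integral_atom[of "\<lambda>_. 0" h 0] assms H_subset_V H_nbhd[OF assms]
  by (auto simp: nbhd_eq_cyl[symmetric] subset_iff)

text \<open>Characters from \<open>H p\<close> depend on the reduction only, so the integral can be
  moved to \<open>nbhd p 0\<close>.\<close>

lemma frac_uniform_integral:
  assumes u: "frac_uniform \<Omega>" and \<Omega>: "\<Omega> \<in> sets M" and h: "h \<in> H p"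
  shows "(\<integral>\<omega>. indicator \<Omega> \<omega> * pairing p h \<omega> \<partial>M) = (if h = (\<lambda>_. 0) then 1 else 0)"
proof -
  have hV: "h \<in> V" using h H_subset_V by auto
  have m: "pairing p h \<in> borel_measurable M" using hV by (rule measurable_pairing)
  have "(\<integral>\<omega>. indicator \<Omega> \<omega> * pairing p h \<omega> \<partial>M) = (\<integral>\<omega>. indicator \<Omega> \<omega> * pairing p h (frac_part \<omega>) \<partial>M)"
    using h by (intro Bochner_Integration.integral_cong) (simp_all add: pairing_frac_part)
  also have "\<dots> = (\<integral>\<omega>. pairing p h (frac_part \<omega>) \<partial>density M (indicator \<Omega>))"
    using \<Omega> measurable_compose[OF measurable_frac_part m]
    by (intro integral_density_indicator[symmetric])
  also have "\<dots> = (\<integral>\<omega>. pairing p h \<omega> \<partial>distr (density M (indicator \<Omega>)) M frac_part)"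
    using m measurable_frac_part by (intro integral_distr[symmetric]) auto
  also have "\<dots> = (\<integral>\<omega>. pairing p h \<omega> \<partial>density M (indicator (nbhd p 0)))"
    using u \<Omega> by (simp add: frac_uniform_iff_distr)
  also have "\<dots> = (\<integral>\<omega>. indicator (nbhd p 0) \<omega> * pairing p h \<omega> \<partial>M)"
    using m by (intro integral_density_indicator) auto
  finally show ?thesis using integral_nbhd_pairing[OF h] by simp
qed

text \<open>By linearity the coefficients fix the integrals over \<open>\<Omega>\<close> of all
  trigonometric polynomials, among them the cylinder indicators of the reduced point; an image
  measure is determined by its values on cylinders.\<close>

lemma frac_uniformI:
  assumes \<Omega>: "\<Omega> \<in> sets M" "emeasure M \<Omega> < \<infinity>"
    and int: "\<And>h. h \<in> H p \<Longrightarrow>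
      (\<integral>\<omega>. indicator \<Omega> \<omega> * pairing p h \<omega> \<partial>M) = (if h = (\<lambda>_. 0) then 1 else 0)"
  shows "frac_uniform \<Omega>"
proof -
  \<comment> \<open>Integrability is carried through the induction because additivity of the
    integral depends on it.\<close>
  have trig: "integrable M (\<lambda>\<omega>. indicator \<Omega> \<omega> * T \<omega>) \<and>
      integrable M (\<lambda>\<omega>. indicator (nbhd p 0) \<omega> * T \<omega>) \<and>
      (\<integral>\<omega>. indicator \<Omega> \<omega> * T \<omega> \<partial>M) = (\<integral>\<omega>. indicator (nbhd p 0) \<omega> * T \<omega> \<partial>M)"
    if "T \<in> trig_polys" for T
    using that unfolding trig_polys_def
  proof induction
    case (lspan_step f g c)
    obtain h where h: "g = pairing p h" "h \<in> H p" using lspan_step by auto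
    have hV: "h \<in> V" using h H_subset_V by auto
    have i: "integrable M (\<lambda>\<omega>. indicator \<Omega> \<omega> * pairing p h \<omega>)"
        "integrable M (\<lambda>\<omega>. indicator (nbhd p 0) \<omega> * pairing p h \<omega>)"
      using \<Omega> hV by (auto intro!: indicator_pairing_integrable simp: emeasure_nbhd)
    have e: "A * (f \<omega> + c * g \<omega>) = A * f \<omega> + c * (A * pairing p h \<omega>)" for A \<omega>
      by (simp add: h algebra_simps)
    show ?case
      unfolding e using lspan_step.IH i int[OF h(2)] integral_nbhd_pairing[OF h(2)] by simp
  qed simp
  have "distr (density M (indicator \<Omega>)) M frac_part = density M (indicator (nbhd p 0))"
  proof (rule measure_eqI_cyl_finite)
    fix w l assume w: "w \<in> V"
    obtain T where T: "T \<in> trig_polys" "\<forall>\<omega>\<in>V. indicator (cyl p w l) (frac_part \<omega>) = T \<omega>"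
      using is_trig_cyl_frac[OF w, of l] by (auto simp: is_trig_def)
    have A: "(\<integral>\<omega>. indicator A \<omega> * T \<omega> \<partial>M) = complex_of_real (measure M (A \<inter> frac_part -` cyl p w l))"
      if "A \<in> sets M" for A
    proof -
      have "(\<integral>\<omega>. indicator A \<omega> * T \<omega> \<partial>M) = (\<integral>\<omega>. indicator (A \<inter> frac_part -` cyl p w l) \<omega> \<partial>M)"
        by (rule Bochner_Integration.integral_cong)
           (use T(2) in \<open>auto simp: indicator_def split: if_splits\<close>)
      then show ?thesis using that w by (simp add: integral_indicator_complex frac_vimage_sets)
    qed
    have fin: "emeasure M (A \<inter> frac_part -` cyl p w l) < \<infinity>" if "A \<in> sets M" "emeasure M A < \<infinity>" for A
      using that by (meson emeasure_mono inf_le1 le_less_trans)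
    have "measure M (\<Omega> \<inter> frac_part -` cyl p w l) = measure M (nbhd p 0 \<inter> frac_part -` cyl p w l)"
      using trig[OF T(1)] A[OF \<Omega>(1)] A[OF nbhd_sets[of 0]] by simp
    then have "emeasure M (\<Omega> \<inter> frac_part -` cyl p w l) = emeasure M (nbhd p 0 \<inter> frac_part -` cyl p w l)"
      using fin[OF \<Omega>] fin[OF nbhd_sets[of 0]]
      by (simp add: emeasure_eq_ennreal_measure emeasure_nbhd less_top)
    also have "nbhd p 0 \<inter> frac_part -` cyl p w l = nbhd p 0 \<inter> cyl p w l"
      by (auto simp: frac_part_idem)
    finally show "emeasure (distr (density M (indicator \<Omega>)) M frac_part) (cyl p w l) =
        emeasure (density M (indicator (nbhd p 0))) (cyl p w l)"
      using \<Omega> w by (simp add: emeasure_frac_distr emeasure_density_indicator)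
  next
    fix w l assume w: "w \<in> V"
    have "emeasure M (nbhd p 0 \<inter> cyl p w l) \<le> emeasure M (nbhd p 0)"
      by (intro emeasure_mono) auto
    then show "emeasure (density M (indicator (nbhd p 0))) (cyl p w l) < \<infinity>"
      using w by (simp add: emeasure_density_indicator emeasure_nbhd) (meson ennreal_one_less_top le_less_trans)
  qed auto
  then show ?thesis using \<Omega> by (simp add: frac_uniform_iff_distr)
qed

text \<open>At nonpositive places the digits have to cancel, so at most one element of
  \<open>H p\<close> carries \<open>\<omega>\<close> into \<open>nbhd p 0\<close>.\<close>

lemma vadd_in_nbhd_imp:
  assumes "h \<in> H p" "\<omega> \<in> V" "vadd p h \<omega> \<in> nbhd p 0"
  shows "h = vminus p (\<lambda>_. 0) (int_part \<omega>)"
proof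
  fix j show "h j = vminus p (\<lambda>_. 0) (int_part \<omega>) j"
  proof (cases "j > 0")
    case True
    then show ?thesis using assms by (simp add: H_def vminus_def int_part_def)
  next
    case False
    then have "(h j + \<omega> j) mod int p = 0" using assms by (simp add: nbhd_def vadd_def)
    then have "int p dvd h j + \<omega> j" by (simp add: dvd_eq_mod_eq_0)
    then have "h j mod int p = (- \<omega> j) mod int p" by (simp add: mod_eq_dvd_iff)
    moreover have "h j mod int p = h j" using assms H_subset_V by (intro vilenkin_mod) auto
    ultimately show ?thesis using False by (simp add: vminus_def int_part_def)
  qed
qed

lemma frac_part_eq_vadd:
  assumes "\<omega> \<in> V"
  shows "frac_part \<omega> = vadd p (vminus p (\<lambda>_. 0) (int_part \<omega>)) \<omega>"
  using vilenkin_mod[OF assms]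
  by (auto simp: frac_part_def vadd_def vminus_def int_part_def mod_simps)

lemma frac_part_of_vadd:
  assumes "h \<in> H p" "\<omega> \<in> V" "vadd p h \<omega> \<in> nbhd p 0"
  shows "frac_part \<omega> = vadd p h \<omega>"
  using frac_part_eq_vadd[OF assms(2)] vadd_in_nbhd_imp[OF assms] by simp

lemma neg_int_part_in_H: "\<omega> \<in> V \<Longrightarrow> vminus p (\<lambda>_. 0) (int_part \<omega>) \<in> H p"
  by (intro vminus_in_H int_part_in_H zero_in_H)

lemma vadd_image_sets_H: "h \<in> H p \<Longrightarrow> E \<in> sets M \<Longrightarrow> vadd p h ` E \<in> sets M"
  using vadd_image_sets H_subset_V by blast

text \<open>Pulling the overlap \<open>?X\<close> back by \<open>h\<close> and by \<open>k\<close>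
  yields two disjoint parts of \<open>\<Omega>\<close>, each of the measure of \<open>?X\<close> and
  each reducing into \<open>?X\<close>. Uniformity bounds twice this measure by the measure itself,
  which is finite.\<close>

lemma frac_uniform_disjoint:
  assumes u: "frac_uniform \<Omega>" and \<Omega>: "\<Omega> \<in> sets M" and h: "h \<in> H p" "k \<in> H p" "h \<noteq> k"
  shows "emeasure M (vadd p h ` \<Omega> \<inter> vadd p k ` \<Omega> \<inter> nbhd p 0) = 0" (is "emeasure M ?X = 0")
proof -
  have X: "?X \<in> sets M" using \<Omega> h by (intro sets.Int vadd_image_sets_H nbhd_sets)
  have V: "h \<in> V" "k \<in> V" using h H_subset_V by auto
  define R where "R g = {\<omega> \<in> V. vadd p g \<omega> \<in> ?X}" for g
  have R: "R g \<in> sets M" "emeasure M (R g) = emeasure M ?X" "R g \<subseteq> \<Omega> \<inter> frac_part -` ?X"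
    if g: "g = h \<or> g = k" for g
  proof -
    have gH: "g \<in> H p" and gV: "g \<in> V" using g h V by auto
    have "R g = vadd p g -` ?X \<inter> space M" by (auto simp: R_def)
    then show Rs: "R g \<in> sets M"
      using measurable_sets[OF measurable_vadd[OF gV] X] by (simp del: vimage_Int)
    have "vadd p g ` R g = ?X"
    proof (intro equalityI subsetI)
      fix y assume y: "y \<in> ?X"
      then have "y \<in> V" using X sets_M_subset by blast
      then show "y \<in> vadd p g ` R g"
        using y gV by (intro image_eqI[of _ _ "vminus p y g"]) (simp_all add: R_def vadd_vminus)
    qed (auto simp: R_def)
    then show "emeasure M (R g) = emeasure M ?X" using emeasure_vadd[OF gV Rs] by simp
    show "R g \<subseteq> \<Omega> \<inter> frac_part -` ?X"
    proof
      fix \<omega> assume "\<omega> \<in> R g"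
      then have w: "\<omega> \<in> V" "vadd p g \<omega> \<in> ?X" by (auto simp: R_def)
      then have "vadd p g \<omega> \<in> vadd p g ` \<Omega>" using g by auto
      then have "\<omega> \<in> \<Omega>"
        using inj_on_image_mem_iff[OF vadd_inj[OF gV]] w sets_M_subset[OF \<Omega>] by blast
      moreover have "frac_part \<omega> = vadd p g \<omega>" using w gH by (intro frac_part_of_vadd) auto
      ultimately show "\<omega> \<in> \<Omega> \<inter> frac_part -` ?X" using w by simp
    qed
  qed
  have disj: "R h \<inter> R k = {}"
  proof (rule equals0I)
    fix \<omega> assume "\<omega> \<in> R h \<inter> R k"
    then show False
      using vadd_in_nbhd_imp[OF h(1), of \<omega>] vadd_in_nbhd_imp[OF h(2), of \<omega>] h(3) by (auto simp: R_def)
  qed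
  have "emeasure M ?X + emeasure M ?X = emeasure M (R h \<union> R k)"
    using R[of h] R[of k] disj by (simp add: plus_emeasure[symmetric])
  also have "\<dots> \<le> emeasure M (\<Omega> \<inter> frac_part -` ?X)"
    using R[of h] R[of k] X \<Omega> by (intro emeasure_mono frac_vimage_sets) auto
  also have "\<dots> = emeasure M ?X" using u X by (intro frac_uniformD) auto
  finally have le: "emeasure M ?X + emeasure M ?X \<le> emeasure M ?X" .
  have "emeasure M ?X \<le> emeasure M (nbhd p 0)" by (intro emeasure_mono) auto
  then have "emeasure M ?X < \<infinity>" by (simp add: emeasure_nbhd) (meson ennreal_one_less_top le_less_trans)
  then obtain r where "emeasure M ?X = ennreal r" "r \<ge> 0" by (cases "emeasure M ?X") auto
  with le show ?thesis by (simp flip: ennreal_plus)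
qed

text \<open>A point of \<open>\<Omega>\<close> reduces into a translate of \<open>\<Omega>\<close>,
  never into the uncovered set, so uniformity assigns that set measure 0.\<close>

lemma frac_uniform_cover:
  assumes u: "frac_uniform \<Omega>" and \<Omega>: "\<Omega> \<in> sets M"
  shows "emeasure M (nbhd p 0 - (\<Union>h\<in>H p. vadd p h ` \<Omega>)) = 0" (is "emeasure M ?X = 0")
proof -
  have X: "?X \<in> sets M"
    using \<Omega> countable_H by (intro sets.Diff nbhd_sets sets.countable_UN') (auto intro: vadd_image_sets_H)
  have "\<Omega> \<inter> frac_part -` ?X = {}"
  proof (rule equals0I)
    fix \<omega> assume w: "\<omega> \<in> \<Omega> \<inter> frac_part -` ?X"
    then have "\<omega> \<in> V" using sets_M_subset[OF \<Omega>] by auto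
    then have "frac_part \<omega> \<in> vadd p (vminus p (\<lambda>_. 0) (int_part \<omega>)) ` \<Omega>"
        "vminus p (\<lambda>_. 0) (int_part \<omega>) \<in> H p"
      using w by (auto simp: frac_part_eq_vadd intro: neg_int_part_in_H)
    then show False using w by auto
  qed
  moreover have "emeasure M (\<Omega> \<inter> frac_part -` ?X) = emeasure M ?X"
    using u X by (intro frac_uniformD) auto
  ultimately show ?thesis by simp
qed

lemma frac_uniform_imp_congruent:
  assumes u: "frac_uniform \<Omega>" and \<Omega>: "\<Omega> \<in> sets M"
  shows "ae_H_perp_congruent p M \<Omega> (nbhd p 0)"
proof -
  \<comment> \<open>Each point of \<open>\<Omega>\<close> has exactly one translation by
    \<open>H p\<close> into \<open>nbhd p 0\<close>, so these pieces partition
    \<open>\<Omega>\<close> exactly; their translates may overlap, but only in null sets.\<close>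
  define P where "P h = {\<omega> \<in> \<Omega>. vadd p h \<omega> \<in> nbhd p 0}" for h
  have OV: "\<Omega> \<subseteq> V" by (rule sets_M_subset[OF \<Omega>])
  have P_sets: "P h \<in> sets M" if "h \<in> H p" for h
  proof -
    have "P h = \<Omega> \<inter> (vadd p h -` nbhd p 0 \<inter> space M)" using OV by (auto simp: P_def)
    then show ?thesis
      using \<Omega> that H_subset_V measurable_sets[OF measurable_vadd, of h "nbhd p 0"] by auto
  qed
  have P_image: "vadd p h ` P h = vadd p h ` \<Omega> \<inter> nbhd p 0" for h by (auto simp: P_def)
  have P_Un: "(\<Union>h\<in>H p. P h) = \<Omega>"
  proof (intro equalityI subsetI)
    fix \<omega> assume w: "\<omega> \<in> \<Omega>"
    then have "\<omega> \<in> V" using OV by auto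
    then show "\<omega> \<in> (\<Union>h\<in>H p. P h)"
      using w frac_part_in_nbhd[of \<omega>] neg_int_part_in_H[of \<omega>] by (auto simp: P_def frac_part_eq_vadd)
  qed (auto simp: P_def)
  have "ae_partition M (H p) P \<Omega>"
    unfolding ae_partition_def P_Un
  proof (intro conjI ballI impI)
    fix h k assume hk: "h \<in> H p" "k \<in> H p" "h \<noteq> k"
    have "P h \<inter> P k = {}"
    proof (rule equals0I)
      fix \<omega> assume "\<omega> \<in> P h \<inter> P k"
      then show False
        using vadd_in_nbhd_imp[OF hk(1), of \<omega>] vadd_in_nbhd_imp[OF hk(2), of \<omega>] hk(3) OV
        by (auto simp: P_def)
    qed
    then show "P h \<inter> P k \<in> null_sets M" by simp
  qed (use P_sets in auto)
  moreover have "ae_partition M (H p) (\<lambda>h. vadd p h ` P h) (nbhd p 0)"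
    unfolding ae_partition_def P_image
  proof (intro conjI ballI impI)
    show "vadd p h ` \<Omega> \<inter> nbhd p 0 \<in> sets M" if "h \<in> H p" for h
      using that \<Omega> by (intro sets.Int vadd_image_sets_H nbhd_sets)
    fix h k assume hk: "h \<in> H p" "k \<in> H p" "h \<noteq> k"
    have "vadd p h ` \<Omega> \<inter> nbhd p 0 \<inter> (vadd p k ` \<Omega> \<inter> nbhd p 0) = vadd p h ` \<Omega> \<inter> vadd p k ` \<Omega> \<inter> nbhd p 0"
      by auto
    then show "vadd p h ` \<Omega> \<inter> nbhd p 0 \<inter> (vadd p k ` \<Omega> \<inter> nbhd p 0) \<in> null_sets M"
      using frac_uniform_disjoint[OF u \<Omega> hk] \<Omega> hk
      by (auto intro!: null_setsI sets.Int vadd_image_sets_H)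
  next
    have "sym_diff (\<Union>h\<in>H p. vadd p h ` \<Omega> \<inter> nbhd p 0) (nbhd p 0) =
        nbhd p 0 - (\<Union>h\<in>H p. vadd p h ` \<Omega>)" by auto
    moreover have "nbhd p 0 - (\<Union>h\<in>H p. vadd p h ` \<Omega>) \<in> sets M"
      using \<Omega> countable_H by (intro sets.Diff nbhd_sets sets.countable_UN') (auto intro: vadd_image_sets_H)
    ultimately show "sym_diff (\<Union>h\<in>H p. vadd p h ` \<Omega> \<inter> nbhd p 0) (nbhd p 0) \<in> null_sets M"
      using frac_uniform_cover[OF u \<Omega>] by (auto intro: null_setsI)
  qed
  ultimately show ?thesis unfolding ae_H_perp_congruent_def H_perp_eq_H by blast
qed

text \<open>Outside a null set the indicator of \<open>S\<close> is the sum of the indicators of the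
  pieces. This sum is an integral for counting measure on a countable set and may be exchanged with
  the integral over \<open>M\<close>.\<close>

lemma ae_partition_emeasure:
  assumes P: "ae_partition M I P S" and I: "countable I" and S: "S \<in> sets M" and Y: "Y \<in> sets M"
  shows "emeasure M (S \<inter> Y) = (\<integral>\<^sup>+a. emeasure M (P a \<inter> Y) \<partial>count_space I)"
proof -
  define N where "N = (\<Union>a\<in>I. \<Union>b\<in>I. if a = b then {} else P a \<inter> P b) \<union> sym_diff (\<Union>a\<in>I. P a) S"
  have Ps: "P a \<in> sets M" if "a \<in> I" for a using P that by (simp add: ae_partition_def)
  have "(\<Union>a\<in>I. \<Union>b\<in>I. if a = b then {} else P a \<inter> P b) \<in> null_sets M"
    using P I by (intro null_sets_UN') (auto simp: ae_partition_def)
  moreover have "sym_diff (\<Union>a\<in>I. P a) S \<in> null_sets M"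
    using P unfolding ae_partition_def by blast
  ultimately have N: "N \<in> null_sets M" unfolding N_def by (rule null_sets.Un)
  have "emeasure M (S \<inter> Y) = (\<integral>\<^sup>+x. indicator (S \<inter> Y) x \<partial>M)" using S Y by simp
  also have "\<dots> = (\<integral>\<^sup>+x. \<integral>\<^sup>+a. indicator (P a \<inter> Y) x \<partial>count_space I \<partial>M)"
  proof (rule nn_integral_cong_AE, rule AE_I'[OF N])
    show "{x \<in> space M. indicator (S \<inter> Y) x \<noteq> (\<integral>\<^sup>+a. indicator (P a \<inter> Y) x \<partial>count_space I)} \<subseteq> N"
    proof (rule subsetI, rule ccontr)
      fix x assume x: "x \<in> {x \<in> space M. indicator (S \<inter> Y) x \<noteq> (\<integral>\<^sup>+a. indicator (P a \<inter> Y) x \<partial>count_space I)}"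
        and xN: "x \<notin> N"
      have "(\<integral>\<^sup>+a. indicator (P a \<inter> Y) x \<partial>count_space I) = (indicator (S \<inter> Y) x :: ennreal)"
      proof (cases "x \<in> S \<inter> Y")
        case True
        then obtain b where b: "b \<in> I" "x \<in> P b" using xN by (auto simp: N_def)
        have uniq: "a = b" if "a \<in> I" "x \<in> P a" for a
        proof (rule ccontr)
          assume "a \<noteq> b"
          then have "x \<in> N" unfolding N_def using b that by auto
          then show False using xN by simp
        qed
        have "(\<integral>\<^sup>+a. indicator (P a \<inter> Y) x \<partial>count_space I) = (\<integral>\<^sup>+a. indicator {b} a \<partial>count_space I)"
        proof (rule nn_integral_cong)
          fix a assume "a \<in> space (count_space I)"
          then have "x \<in> P a \<longleftrightarrow> a = b" using uniq[of a] b(2) by auto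
          then show "indicator (P a \<inter> Y) x = (indicator {b} a :: ennreal)"
            using True by (simp add: indicator_def)
        qed
        then show ?thesis using True b by simp
      next
        case False
        have "(\<integral>\<^sup>+a. indicator (P a \<inter> Y) x \<partial>count_space I) = (\<integral>\<^sup>+a. 0 \<partial>count_space I)"
        proof (rule nn_integral_cong)
          fix a assume "a \<in> space (count_space I)"
          then have "x \<notin> P a \<inter> Y" using False xN by (auto simp: N_def)
          then show "indicator (P a \<inter> Y) x = (0 :: ennreal)" by (rule indicator_eq_0_iff[THEN iffD2])
        qed
        then show ?thesis using False by simp
      qed
      then show False using x by simp
    qed
  qed
  also have "\<dots> = (\<integral>\<^sup>+a. \<integral>\<^sup>+x. indicator (P a \<inter> Y) x \<partial>M \<partial>count_space I)"
    using Ps Y I by (intro nn_integral_count_space_nn_integral borel_measurable_indicator) auto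
  also have "\<dots> = (\<integral>\<^sup>+a. emeasure M (P a \<inter> Y) \<partial>count_space I)"
    using Ps Y by (intro nn_integral_cong) auto
  finally show ?thesis .
qed

text \<open>Translation by \<open>h\<close> in \<open>H p\<close> preserves both measure and
  reduction, so each piece contributes as much as its translate, and inside \<open>nbhd p 0\<close>
  reduction is the identity. Summing over both partitions gives the claim.\<close>

lemma congruent_imp_frac_uniform:
  assumes c: "ae_H_perp_congruent p M \<Omega> (nbhd p 0)" and \<Omega>: "\<Omega> \<in> sets M"
  shows "frac_uniform \<Omega>"
  unfolding frac_uniform_def
proof (intro ballI impI)
  fix X assume X: "X \<in> sets M" "X \<subseteq> nbhd p 0"
  obtain P where P: "ae_partition M (H p) P \<Omega>"
      and Q: "ae_partition M (H p) (\<lambda>h. vadd p h ` P h) (nbhd p 0)"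
    using c unfolding ae_H_perp_congruent_def H_perp_eq_H by blast
  have Y: "V \<inter> frac_part -` X \<in> sets M"
    using X by (intro frac_vimage_sets) (metis sets.top space_M)+
  have piece: "emeasure M (P h \<inter> (V \<inter> frac_part -` X)) = emeasure M (vadd p h ` P h \<inter> X)" if h: "h \<in> H p" for h
  proof -
    have hV: "h \<in> V" using h H_subset_V by auto
    have Ph: "P h \<in> sets M" using P h by (simp add: ae_partition_def)
    have Qh: "vadd p h ` P h \<in> sets M" using Q h by (simp add: ae_partition_def)
    have "emeasure M (P h \<inter> (V \<inter> frac_part -` X)) = emeasure M (vadd p h ` (P h \<inter> (V \<inter> frac_part -` X)))"
      using emeasure_vadd[OF hV] Ph Y by simp
    also have "vadd p h ` (P h \<inter> (V \<inter> frac_part -` X)) = vadd p h ` P h \<inter> (V \<inter> frac_part -` X)"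
      using sets_M_subset[OF Ph] hV h by (auto simp: frac_part_vadd subset_iff)
    also have "emeasure M \<dots> = emeasure M (vadd p h ` P h \<inter> X)"
    \<comment> \<open>The translated piece may leave \<open>nbhd p 0\<close>, but only in a null
      set, and the two sets can differ only there.\<close>
    proof (rule emeasure_eq_AE)
      define N where "N = sym_diff (\<Union>h\<in>H p. vadd p h ` P h) (nbhd p 0)"
      have "N \<in> null_sets M" using Q by (simp add: ae_partition_def N_def)
      then show "AE x in M. x \<in> vadd p h ` P h \<inter> (V \<inter> frac_part -` X) \<longleftrightarrow> x \<in> vadd p h ` P h \<inter> X"
      proof (rule AE_I')
        show "{x \<in> space M. \<not> (x \<in> vadd p h ` P h \<inter> (V \<inter> frac_part -` X) \<longleftrightarrow> x \<in> vadd p h ` P h \<inter> X)} \<subseteq> N"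
        proof
          fix x assume x: "x \<in> {x \<in> space M. \<not> (x \<in> vadd p h ` P h \<inter> (V \<inter> frac_part -` X) \<longleftrightarrow> x \<in> vadd p h ` P h \<inter> X)}"
          then have "x \<in> vadd p h ` P h" by auto
          moreover from this have "x \<notin> nbhd p 0" using x frac_part_idem[of x p] by auto
          ultimately show "x \<in> N" using h by (auto simp: N_def)
        qed
      qed
      show "vadd p h ` P h \<inter> (V \<inter> frac_part -` X) \<in> sets M" "vadd p h ` P h \<inter> X \<in> sets M"
        using Qh X Y by auto
    qed
    finally show ?thesis .
  qed
  have "\<Omega> \<inter> frac_part -` X = \<Omega> \<inter> (V \<inter> frac_part -` X)" using sets_M_subset[OF \<Omega>] by auto
  then have "emeasure M (\<Omega> \<inter> frac_part -` X) =
      (\<integral>\<^sup>+h. emeasure M (P h \<inter> (V \<inter> frac_part -` X)) \<partial>count_space (H p))"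
    using ae_partition_emeasure[OF P countable_H \<Omega> Y] by simp
  also have "\<dots> = (\<integral>\<^sup>+h. emeasure M (vadd p h ` P h \<inter> X) \<partial>count_space (H p))"
    using piece by (intro nn_integral_cong) simp
  also have "\<dots> = emeasure M (nbhd p 0 \<inter> X)"
    using ae_partition_emeasure[OF Q countable_H nbhd_sets X(1)] by simp
  also have "nbhd p 0 \<inter> X = X" using X by auto
  finally show "emeasure M (\<Omega> \<inter> frac_part -` X) = emeasure M X" .
qed

text \<open>Reduction modulo \<open>H_perp\<close> is injective almost everywhere on \<open>\<Omega>\<close>.\<close>

lemma frac_uniform_reconstruct:
  assumes u: "frac_uniform \<Omega>" and \<Omega>: "\<Omega> \<in> sets M" and F: "F \<in> sets M" "F \<subseteq> \<Omega>"
  shows "\<exists>F'\<in>sets M. emeasure M (sym_diff F (\<Omega> \<inter> frac_part -` F')) = 0"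
proof -
  \<comment> \<open>The image of \<open>F\<close> under reduction, written with countably many
    translates so that measurability is evident.\<close>
  define F' where "F' = (\<Union>h\<in>H p. vadd p h ` F \<inter> nbhd p 0)"
  \<comment> \<open>Points of \<open>nbhd p 0\<close> reached from \<open>\<Omega>\<close> by two
    different translations: only over these can reduction identify points of
    \<open>\<Omega>\<close>.\<close>
  define Z where "Z = (\<Union>h\<in>H p. \<Union>k\<in>H p. if h = k then {} else vadd p h ` \<Omega> \<inter> vadd p k ` \<Omega> \<inter> nbhd p 0)"
  have OV: "\<Omega> \<subseteq> V" by (rule sets_M_subset[OF \<Omega>])
  have F': "F' \<in> sets M"
    unfolding F'_def using F countable_H
    by (intro sets.countable_UN' sets.Int nbhd_sets) (auto intro: vadd_image_sets_H)
  have Z: "Z \<in> null_sets M"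
    unfolding Z_def using countable_H frac_uniform_disjoint[OF u \<Omega>] \<Omega>
    by (intro null_sets_UN') (auto intro!: null_setsI sets.Int vadd_image_sets_H)
  have "Z \<subseteq> nbhd p 0" by (auto simp: Z_def)
  then have nul: "emeasure M (\<Omega> \<inter> frac_part -` Z) = 0"
    using frac_uniformD[OF u, of Z] null_setsD1[OF Z] null_setsD2[OF Z] by simp
  have "sym_diff F (\<Omega> \<inter> frac_part -` F') \<subseteq> \<Omega> \<inter> frac_part -` Z"
  proof
    fix \<omega> assume w: "\<omega> \<in> sym_diff F (\<Omega> \<inter> frac_part -` F')"
    then have wO: "\<omega> \<in> \<Omega>" and wV: "\<omega> \<in> V" using F OV by auto
    define k where "k = vminus p (\<lambda>_. 0) (int_part \<omega>)"
    have k: "k \<in> H p" "frac_part \<omega> = vadd p k \<omega>" "frac_part \<omega> \<in> nbhd p 0"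
      using wV by (simp_all add: k_def neg_int_part_in_H frac_part_eq_vadd[symmetric] frac_part_in_nbhd)
    have "\<omega> \<notin> F"
    proof
      assume "\<omega> \<in> F"
      then have "frac_part \<omega> \<in> F'" using k by (auto simp: F'_def)
      then show False using w wO \<open>\<omega> \<in> F\<close> by auto
    qed
    then have "frac_part \<omega> \<in> F'" using w by auto
    then obtain h \<omega>' where h: "h \<in> H p" "\<omega>' \<in> F" "frac_part \<omega> = vadd p h \<omega>'"
      by (auto simp: F'_def)
    have "h \<noteq> k"
    proof
      assume "h = k"
      then have "vadd p k \<omega>' = vadd p k \<omega>" using h k by simp
      moreover have "\<omega>' \<in> V" "k \<in> V" using h k F OV H_subset_V by auto
      ultimately have "\<omega>' = \<omega>" using vadd_inj[of k] wV by (auto dest: inj_onD)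
      then show False using h \<open>\<omega> \<notin> F\<close> by simp
    qed
    moreover have "frac_part \<omega> \<in> vadd p h ` \<Omega>" using h F by auto
    moreover have "frac_part \<omega> \<in> vadd p k ` \<Omega>" using k wO by auto
    ultimately have "frac_part \<omega> \<in> Z" unfolding Z_def using h(1) k by auto
    then show "\<omega> \<in> \<Omega> \<inter> frac_part -` Z" using wO by simp
  qed
  moreover have "\<Omega> \<inter> frac_part -` Z \<in> sets M" using Z \<Omega> by (intro frac_vimage_sets) auto
  ultimately have "emeasure M (sym_diff F (\<Omega> \<inter> frac_part -` F')) \<le> 0"
    using nul emeasure_mono by metis
  then show ?thesis using F' by auto
qed

text \<open>Up to a null set \<open>F\<close> consists of the points of \<open>\<Omega>\<close>
  whose reduction lies in some \<open>F'\<close>. A step set close to \<open>F'\<close> inside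
  \<open>nbhd p 0\<close> becomes, after reduction, a trigonometric polynomial, and uniformity
  transports the measure of the error.\<close>

lemma frac_uniform_dense:
  assumes u: "frac_uniform \<Omega>" and \<Omega>: "\<Omega> \<in> sets M" and F: "F \<in> sets M" "F \<subseteq> \<Omega>" and e: "\<epsilon> > 0"
  shows "\<exists>T\<in>trig_polys. sqn M (\<lambda>\<omega>. indicator F \<omega> - indicator \<Omega> \<omega> * T \<omega>) < ennreal \<epsilon>"
proof -
  obtain F' where F': "F' \<in> sets M" "emeasure M (sym_diff F (\<Omega> \<inter> frac_part -` F')) = 0"
    using frac_uniform_reconstruct[OF u \<Omega> F] by blast
  have "step_approximable (F' \<inter> nbhd p 0)" by (rule step_approximable_Int_nbhd[OF F'(1)])
  then obtain D where D: "D \<in> sets M" "(indicator D :: _ \<Rightarrow> complex) \<in> step"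
      "emeasure M (sym_diff (F' \<inter> nbhd p 0) D) < ennreal \<epsilon>"
    using e by (auto simp: step_approximable_def)
  obtain T where T: "T \<in> trig_polys" "\<forall>\<omega>\<in>V. indicator D (frac_part \<omega>) = T \<omega>"
    using is_trig_step_frac[OF D(2)] by (auto simp: is_trig_def)
  define E where "E = \<Omega> \<inter> frac_part -` D"
  define E' where "E' = \<Omega> \<inter> frac_part -` F'"
  have E: "E \<in> sets M" "E' \<in> sets M" unfolding E_def E'_def using D F' \<Omega> by (auto intro: frac_vimage_sets)
  have "sqn M (\<lambda>\<omega>. indicator F \<omega> - indicator \<Omega> \<omega> * T \<omega>) = sqn M (indicator (sym_diff F E))"
  proof -
    have "cmod (indicator F \<omega> - indicator \<Omega> \<omega> * T \<omega>) = cmod (indicator (sym_diff F E) \<omega>)"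
      if "\<omega> \<in> V" for \<omega>
      using T(2)[rule_format, OF that, symmetric] by (auto simp: E_def indicator_def)
    then show ?thesis unfolding sqn_def by (intro nn_integral_cong) simp
  qed
  also have "\<dots> = emeasure M (sym_diff F E)" using F E by (intro sqn_indicator) auto
  also have "\<dots> \<le> emeasure M (sym_diff F E') + emeasure M (sym_diff E' E)"
    by (rule emeasure_sym_diff_triangle[OF F(1) E(2,1)])
  also have "\<dots> = emeasure M (sym_diff E' E)" using F' by (simp add: E'_def)
  also have "sym_diff E' E = \<Omega> \<inter> frac_part -` sym_diff F' D" by (auto simp: E_def E'_def)
  also have "emeasure M \<dots> = emeasure M (nbhd p 0 \<inter> sym_diff F' D)"
    using D F' by (intro frac_uniform_Int[OF u \<Omega>]) auto
  also have "\<dots> \<le> emeasure M (sym_diff (F' \<inter> nbhd p 0) D)"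
  proof (rule emeasure_mono)
    show "sym_diff (F' \<inter> nbhd p 0) D \<in> sets M"
      using D F' by (intro sets.Un sets.Diff sets.Int nbhd_sets)
  qed auto
  also have "\<dots> < ennreal \<epsilon>" by (rule D(3))
  finally show ?thesis using T(1) by blast
qed

section \<open>Multiwavelets on the Fourier side\<close>

definition wavelet_hat :: "(int \<Rightarrow> int) set \<Rightarrow> int \<Rightarrow> (int \<Rightarrow> int) \<Rightarrow> (int \<Rightarrow> int) \<Rightarrow> complex" where
  "wavelet_hat \<Omega> j h = (\<lambda>\<omega>. of_real (real p powr (- real_of_int j / 2)) *
     (indicator (shift j ` \<Omega>) \<omega> * cnj (pairing p h (shift (- j) \<omega>))))"

lemma cnj_pairing: "h \<in> V \<Longrightarrow> \<omega> \<in> V \<Longrightarrow> cnj (pairing p h \<omega>) = pairing p (vminus p (\<lambda>_. 0) h) \<omega>"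
  by (simp add: pairing_vminus)

lemma powr_half_square:
  "complex_of_real (real p powr (- real_of_int j / 2)) * complex_of_real (real p powr (- real_of_int j / 2)) =
   complex_of_real (real p powi (- j))"
proof -
  have "real p powr (- real_of_int j / 2) * real p powr (- real_of_int j / 2) = real p powr real_of_int (- j)"
    by (simp flip: powr_add)
  also have "\<dots> = real p powi (- j)" using p_pos by (intro powr_real_of_int') auto
  finally show ?thesis by (simp only: flip: of_real_mult)
qed

lemma shift_mem_image: "\<omega> \<in> shift j ` \<Omega> \<longleftrightarrow> shift (- j) \<omega> \<in> \<Omega>"
  by (simp add: shift_image_eq)

lemma wavelet_hat_eq:
  assumes "h \<in> V" "\<omega> \<in> V"
  shows "wavelet_hat \<Omega> j h \<omega> = of_real (real p powr (- real_of_int j / 2)) *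
    (indicator (shift j ` \<Omega>) \<omega> * pairing p (vminus p (\<lambda>_. 0) (shift (- j) h)) \<omega>)"
  using assms by (simp add: wavelet_hat_def cnj_pairing pairing_shift[symmetric])

lemma emeasure_shift_finite:
  "\<Omega> \<in> sets M \<Longrightarrow> emeasure M \<Omega> < \<infinity> \<Longrightarrow> emeasure M (shift j ` \<Omega>) < \<infinity>"
  by (simp add: emeasure_shift_image ennreal_mult_less_top)

lemma wavelet_hat_L2_integrable:
  assumes "\<Omega> \<in> sets M" "emeasure M \<Omega> < \<infinity>" "h \<in> V"
  shows "wavelet_hat \<Omega> j h \<in> L2 M" "integrable M (wavelet_hat \<Omega> j h)"
proof -
  define k where "k = vminus p (\<lambda>_. 0) (shift (- j) h)"
  define f where "f = (\<lambda>\<omega>. indicator (shift j ` \<Omega>) \<omega> * pairing p k \<omega>)"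
  have k: "k \<in> V" using assms by (simp add: k_def)
  have i: "integrable M f"
    unfolding f_def using assms k
    by (intro indicator_pairing_integrable shift_image_sets emeasure_shift_finite)
  have "f \<in> L2 M"
    using i assms k emeasure_shift_finite[OF assms(1,2), of j]
    by (auto simp: L2_iff f_def sqn_indicator_pairing shift_image_sets)
  have eq: "wavelet_hat \<Omega> j h \<omega> = of_real (real p powr (- real_of_int j / 2)) * f \<omega>" if "\<omega> \<in> V" for \<omega>
    using wavelet_hat_eq[OF assms(3) that] by (simp add: f_def k_def)
  show "wavelet_hat \<Omega> j h \<in> L2 M"
    using L2_scale[OF \<open>f \<in> L2 M\<close>]
      L2_cong[of "wavelet_hat \<Omega> j h" "\<lambda>\<omega>. of_real (real p powr (- real_of_int j / 2)) * f \<omega>"] eq by blast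
  have "integrable M (\<lambda>\<omega>. of_real (real p powr (- real_of_int j / 2)) * f \<omega>)" using i by simp
  then show "integrable M (wavelet_hat \<Omega> j h)"
    using Bochner_Integration.integrable_cong[of M M "wavelet_hat \<Omega> j h"] eq by simp
qed

text \<open>Substitution of \<open>shift j \<omega>\<close> in the Fourier integral: dilation of the
  argument becomes dilation of \<open>\<Omega> i\<close>, translation by \<open>h\<close> becomes
  modulation.\<close>

lemma multiwavelet_eq_ft:
  assumes \<Omega>: "\<Omega> i \<in> sets M" and h: "h \<in> V" and x: "x \<in> V"
  shows "multiwavelet p M \<Omega> (i, j, h) x = ft (wavelet_hat (\<Omega> i) j h) x"
proof -
  define c where "c = complex_of_real (real p powr (- real_of_int j / 2))"
  define k where "k = vminus p (\<lambda>_. 0) (shift (- j) h)"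
  have k: "k \<in> V" using h by (simp add: k_def)
  have E: "shift j ` \<Omega> i \<in> sets M" using \<Omega> by (rule shift_image_sets)
  define F where "F = (\<lambda>\<omega>. c * (indicator (shift j ` \<Omega> i) \<omega> * pairing p k \<omega>) * pairing p x \<omega>)"
  have F: "F \<in> borel_measurable M"
    unfolding F_def using E k x
    by (intro borel_measurable_times measurable_pairing borel_measurable_indicator) auto
  have 1: "ft (wavelet_hat (\<Omega> i) j h) x = (\<integral>\<omega>. F \<omega> \<partial>M)"
    unfolding inv_fourier_def F_def
    by (rule Bochner_Integration.integral_cong) (use h in \<open>simp_all add: wavelet_hat_eq c_def k_def\<close>)
  \<comment> \<open>The substitution contributes \<open>p\<close> to the power \<open>- j\<close>,
    which is \<open>c * c\<close>; one factor cancels against the \<open>c\<close> inside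
    \<open>F\<close>, the other against the normalization of the wavelet.\<close>
  have "complex_of_real (real p powi (- j)) * (\<integral>\<omega>. F \<omega> \<partial>M) = (\<integral>\<omega>. F (shift j \<omega>) \<partial>M)"
    using integral_shift[OF F] by simp
  also have "\<dots> = (\<integral>\<omega>. c * (indicator (\<Omega> i) \<omega> * pairing p (vminus p (shift j x) h) \<omega>) \<partial>M)"
  proof (rule Bochner_Integration.integral_cong)
    fix \<omega> assume "\<omega> \<in> space M"
    then have w: "\<omega> \<in> V" by simp
    have "pairing p k (shift j \<omega>) = cnj (pairing p h \<omega>)"
      using w h by (simp add: k_def pairing_vminus pairing_shift)
    moreover have "pairing p x (shift j \<omega>) = pairing p (shift j x) \<omega>" by (simp add: pairing_shift)
    ultimately show "F (shift j \<omega>) = c * (indicator (\<Omega> i) \<omega> * pairing p (vminus p (shift j x) h) \<omega>)"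
      using w h x by (simp add: F_def shift_mem_image indicator_def pairing_vminus)
  qed simp
  also have "\<dots> = c * ft (indicator (\<Omega> i)) (vminus p (shift j x) h)"
    by (simp add: inv_fourier_def)
  finally have "c * (c * (\<integral>\<omega>. F \<omega> \<partial>M)) = c * ft (indicator (\<Omega> i)) (vminus p (shift j x) h)"
    using powr_half_square[of j] by (simp add: c_def mult.assoc[symmetric])
  moreover have "c \<noteq> 0" using p_pos by (simp add: c_def)
  ultimately have cF: "c * (\<integral>\<omega>. F \<omega> \<partial>M) = ft (indicator (\<Omega> i)) (vminus p (shift j x) h)" by simp
  have "complex_of_real (real p powr (real_of_int j / 2)) * c = 1"
    using p_pos by (simp add: c_def flip: of_real_mult powr_add)
  then show ?thesis
    unfolding 1 multiwavelet_def by (simp add: mult.assoc[symmetric] flip: cF)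
qed

text \<open>A substitution returns to scale 0, its factor cancelling the normalization. The
  characters enter conjugated, hence the order in \<open>vminus p k h\<close>.\<close>

lemma wavelet_hat_inner_same:
  assumes \<Omega>: "\<Omega> \<in> sets M" and h: "h \<in> V" "k \<in> V"
  shows "L2_inner M (wavelet_hat \<Omega> j h) (wavelet_hat \<Omega> j k) = (\<integral>\<omega>. indicator \<Omega> \<omega> * pairing p (vminus p k h) \<omega> \<partial>M)"
proof -
  define G where "G = (\<lambda>\<omega>. indicator \<Omega> \<omega> * pairing p (vminus p k h) \<omega>)"
  have G: "G \<in> borel_measurable M"
    unfolding G_def using \<Omega> h
    by (intro borel_measurable_times measurable_pairing borel_measurable_indicator) auto
  have "L2_inner M (wavelet_hat \<Omega> j h) (wavelet_hat \<Omega> j k) = (\<integral>\<omega>. complex_of_real (real p powi (- j)) * G (shift (- j) \<omega>) \<partial>M)"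
    unfolding L2_inner_def
  proof (rule Bochner_Integration.integral_cong)
    fix \<omega> assume "\<omega> \<in> space M"
    then have w: "shift (- j) \<omega> \<in> V" by simp
    have "wavelet_hat \<Omega> j h \<omega> * cnj (wavelet_hat \<Omega> j k \<omega>) =
        (complex_of_real (real p powr (- real_of_int j / 2)) * complex_of_real (real p powr (- real_of_int j / 2))) *
        (indicator \<Omega> (shift (- j) \<omega>) * (pairing p k (shift (- j) \<omega>) * cnj (pairing p h (shift (- j) \<omega>))))"
      by (auto simp: wavelet_hat_def shift_mem_image indicator_def)
    then show "wavelet_hat \<Omega> j h \<omega> * cnj (wavelet_hat \<Omega> j k \<omega>) = complex_of_real (real p powi (- j)) * G (shift (- j) \<omega>)"
      unfolding powr_half_square using w h by (simp add: G_def pairing_vminus)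
  qed simp
  also have "\<dots> = complex_of_real (real p powi (- j)) * (complex_of_real (real p powi j) * (\<integral>\<omega>. G \<omega> \<partial>M))"
    using integral_shift[OF G, of "- j"] by simp
  also have "\<dots> = (\<integral>\<omega>. G \<omega> \<partial>M)"
    using p_pos by (simp add: power_int_minus)
  finally show ?thesis by (simp add: G_def)
qed

lemma sqn_shift:
  assumes [measurable]: "f \<in> borel_measurable M"
  shows "sqn M (\<lambda>\<omega>. f (shift n \<omega>)) = ennreal (real p powi (- n)) * sqn M f"
proof -
  have "sqn M (\<lambda>\<omega>. f (shift n \<omega>)) = (\<integral>\<^sup>+\<omega>. ennreal ((cmod (f \<omega>))\<^sup>2) \<partial>distr M M (shift n))"
    unfolding sqn_def by (rule nn_integral_distr[symmetric]) auto
  also have "\<dots> = ennreal (real p powi (- n)) * sqn M f"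
    unfolding distr_shift sqn_def by (simp add: nn_integral_density nn_integral_cmult)
  finally show ?thesis .
qed

lemma trig_polys_measurable: "T \<in> trig_polys \<Longrightarrow> T \<in> borel_measurable M"
  unfolding trig_polys_def
proof (induction rule: lspan.induct)
  case (lspan_step f g c)
  then have "g \<in> borel_measurable M" using H_subset_V by (auto intro: measurable_pairing)
  then show ?case using lspan_step by simp
qed simp

lemma trig_poly_in_lspan_wavelet_hat:
  assumes "T \<in> trig_polys"
  shows "\<exists>s\<in>lspan (wavelet_hat \<Omega> j ` H p). \<forall>\<omega>\<in>V. s \<omega> = indicator (shift j ` \<Omega>) \<omega> * T (shift (- j) \<omega>)"
  using assms unfolding trig_polys_def
proof induction
  case lspan_zero
  show ?case by (intro bexI[of _ "\<lambda>x. 0"]) (auto simp: lspan.lspan_zero)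
next
  case (lspan_step T g c)
  then obtain s where s: "s \<in> lspan (wavelet_hat \<Omega> j ` H p)"
      "\<forall>\<omega>\<in>V. s \<omega> = indicator (shift j ` \<Omega>) \<omega> * T (shift (- j) \<omega>)" by blast
  obtain h where h: "g = pairing p h" "h \<in> H p" using lspan_step by auto
  \<comment> \<open>Wavelets carry conjugated characters, so the character of \<open>h\<close> comes
    from the index inverse to \<open>h\<close>.\<close>
  define k where "k = vminus p (\<lambda>_. 0) h"
  define d where "d = complex_of_real (real p powr (- real_of_int j / 2))"
  have d: "d \<noteq> 0" using p_pos by (simp add: d_def)
  have k: "k \<in> H p" using h by (simp add: k_def vminus_in_H)
  have hV: "h \<in> V" "k \<in> V" using h k H_subset_V by auto
  have "(\<lambda>\<omega>. s \<omega> + c / d * wavelet_hat \<Omega> j k \<omega>) \<in> lspan (wavelet_hat \<Omega> j ` H p)"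
    using s k by (intro lspan.lspan_step) auto
  moreover have "s \<omega> + c / d * wavelet_hat \<Omega> j k \<omega> =
      indicator (shift j ` \<Omega>) \<omega> * (T (shift (- j) \<omega>) + c * g (shift (- j) \<omega>))" if w: "\<omega> \<in> V" for \<omega>
  proof -
    have "cnj (pairing p k (shift (- j) \<omega>)) = pairing p h (shift (- j) \<omega>)"
      using hV w by (simp add: k_def pairing_vminus)
    then have "wavelet_hat \<Omega> j k \<omega> = d * (indicator (shift j ` \<Omega>) \<omega> * g (shift (- j) \<omega>))"
      by (simp add: wavelet_hat_def d_def h)
    then show ?thesis using s w d by (simp add: algebra_simps)
  qed
  ultimately show ?case by (intro bexI[of _ "\<lambda>\<omega>. s \<omega> + c / d * wavelet_hat \<Omega> j k \<omega>"] ballI)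
qed

text \<open>Undoing the dilation reduces the claim to \<open>frac_uniform_dense\<close> at scale
  0.\<close>

lemma indicator_in_l2cl_wavelet_hat:
  assumes u: "frac_uniform \<Omega>" and \<Omega>: "\<Omega> \<in> sets M" and F: "F \<in> sets M" "F \<subseteq> shift j ` \<Omega>"
  shows "(indicator F :: _ \<Rightarrow> complex) \<in> l2cl M (wavelet_hat \<Omega> j ` H p)"
  unfolding l2cl_def
proof (intro CollectI conjI allI impI)
  show "(indicator F :: _ \<Rightarrow> complex) \<in> borel_measurable M" using F by simp
  fix \<epsilon> :: real assume e: "\<epsilon> > 0"
  define F0 where "F0 = shift (- j) ` F"
  have F0: "F0 \<in> sets M" unfolding F0_def using F by (intro shift_image_sets)
  have "F0 \<subseteq> \<Omega>"
    using F(2) by (auto simp: F0_def shift_mem_image subset_iff)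
  \<comment> \<open>Composition with \<open>shift (- j)\<close> multiplies squared norms by
    \<open>p\<close> to the power \<open>j\<close>, which this tolerance absorbs.\<close>
  define d where "d = \<epsilon> * real p powi (- j)"
  have d: "d > 0" using e p_pos by (simp add: d_def)
  obtain T where T: "T \<in> trig_polys" "sqn M (\<lambda>\<omega>. indicator F0 \<omega> - indicator \<Omega> \<omega> * T \<omega>) < ennreal d"
    using frac_uniform_dense[OF u \<Omega> F0 \<open>F0 \<subseteq> \<Omega>\<close> d] by blast
  obtain s where s: "s \<in> lspan (wavelet_hat \<Omega> j ` H p)"
      "\<forall>\<omega>\<in>V. s \<omega> = indicator (shift j ` \<Omega>) \<omega> * T (shift (- j) \<omega>)"
    using trig_poly_in_lspan_wavelet_hat[OF T(1)] by blast
  define g where "g = (\<lambda>\<omega>. indicator F0 \<omega> - indicator \<Omega> \<omega> * T \<omega>)"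
  have g: "g \<in> borel_measurable M"
    unfolding g_def using F0 \<Omega> trig_polys_measurable[OF T(1)] by simp
  have "sqn M (\<lambda>\<omega>. indicator F \<omega> - s \<omega>) = sqn M (\<lambda>\<omega>. g (shift (- j) \<omega>))"
  proof (rule sqn_cong)
    fix \<omega> assume "\<omega> \<in> space M"
    moreover have "shift (- j) \<omega> \<in> F0 \<longleftrightarrow> \<omega> \<in> F" by (simp add: F0_def shift_mem_image)
    ultimately show "indicator F \<omega> - s \<omega> = g (shift (- j) \<omega>)"
      using s(2) by (simp add: g_def indicator_def shift_mem_image)
  qed
  also have "\<dots> = ennreal (real p powi j) * sqn M g" using sqn_shift[OF g, of "- j"] by simp
  also have "\<dots> < ennreal (real p powi j) * ennreal d"
    using T(2) p_pos unfolding g_def by (intro ennreal_mult_strict_left_mono) auto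
  also have "\<dots> = ennreal \<epsilon>"
    using p_pos e by (simp flip: ennreal_mult add: d_def power_int_minus)
  finally show "\<exists>s\<in>lspan (wavelet_hat \<Omega> j ` H p). sqn M (\<lambda>x. indicator F x - s x) < ennreal \<epsilon>" using s(1) by blast
qed

lemma multiwavelet_set_imp_finite:
  assumes mw: "multiwavelet_set p M M \<Omega>" and i: "i \<in> {1..p - 1}" and \<Omega>: "\<Omega> i \<in> sets M"
  shows "emeasure M (\<Omega> i) < \<infinity>"
proof (rule ccontr)
  assume inf: "\<not> emeasure M (\<Omega> i) < \<infinity>"
  have zero: "ft (indicator (\<Omega> i)) x = 0" if x: "x \<in> V" for x
    unfolding inv_fourier_def
  proof (rule not_integrable_integral_eq, rule notI)
    \<comment> \<open>Characters have modulus 1, so integrability at a single \<open>x\<close> would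
      already make the measure of \<open>\<Omega> i\<close> finite.\<close>
    assume "integrable M (\<lambda>\<omega>. indicator (\<Omega> i) \<omega> * pairing p x \<omega>)"
    then have "integrable M (\<lambda>\<omega>. norm (indicator (\<Omega> i) \<omega> * pairing p x \<omega>))"
      by (rule integrable_norm)
    moreover have "(\<lambda>\<omega>. norm (indicator (\<Omega> i) \<omega> * pairing p x \<omega>)) = (indicator (\<Omega> i) :: _ \<Rightarrow> real)"
      by (auto simp: norm_mult indicator_def)
    ultimately have "integrable M (indicator (\<Omega> i) :: _ \<Rightarrow> real)" by simp
    then show False
      using inf sets_M_subset[OF \<Omega>] by (simp add: integrable_indicator_iff Int_absorb2)
  qed
  let ?a = "(i, 0 :: int, (\<lambda>_. 0) :: int \<Rightarrow> int)"
  have z: "multiwavelet p M \<Omega> ?a x = 0" if "x \<in> V" for x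
    using that zero by (simp add: multiwavelet_def)
  have "L2_inner M (multiwavelet p M \<Omega> ?a) (multiwavelet p M \<Omega> ?a) = L2_inner M (\<lambda>_. 0) (\<lambda>_. 0)"
    by (intro L2_inner_cong z)
  moreover have "L2_inner M (multiwavelet p M \<Omega> ?a) (multiwavelet p M \<Omega> ?a) = 1"
    using mw i unfolding multiwavelet_set_def L2_orthonormal_basis_def by simp
  ultimately show False by (simp add: L2_inner_def)
qed

section \<open>Transfer of the basis property to the Fourier side\<close>

definition wavelet_family :: "(nat \<Rightarrow> (int \<Rightarrow> int) set) \<Rightarrow> nat \<times> int \<times> (int \<Rightarrow> int) \<Rightarrow> (int \<Rightarrow> int) \<Rightarrow> complex" where
  "wavelet_family \<Omega> = (\<lambda>(i, j, h). wavelet_hat (\<Omega> i) j h)"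

abbreviation wavelet_index :: "(nat \<times> int \<times> (int \<Rightarrow> int)) set" where
  "wavelet_index \<equiv> {1..p - 1} \<times> UNIV \<times> H p"

text \<open>Finite measure follows from either side of the characterization, by different arguments;
  it is assumed here so that both directions can use these results.\<close>

context
  fixes \<Omega> :: "nat \<Rightarrow> (int \<Rightarrow> int) set"
  assumes Om: "\<And>i. i \<in> {1..p - 1} \<Longrightarrow> \<Omega> i \<in> sets M"
    and Om_fin: "\<And>i. i \<in> {1..p - 1} \<Longrightarrow> emeasure M (\<Omega> i) < \<infinity>"
begin

lemma wavelet_family_L2: "a \<in> wavelet_index \<Longrightarrow> wavelet_family \<Omega> a \<in> L2 M"
  and wavelet_family_integrable: "a \<in> wavelet_index \<Longrightarrow> integrable M (wavelet_family \<Omega> a)"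
  using Om Om_fin H_subset_V by (auto simp: wavelet_family_def intro!: wavelet_hat_L2_integrable)

lemma wavelet_family_ft:
  assumes "a \<in> wavelet_index" "x \<in> V"
  shows "multiwavelet p M \<Omega> a x = ft (wavelet_family \<Omega> a) x"
proof -
  obtain i j h where a: "a = (i, j, h)" "i \<in> {1..p - 1}" "h \<in> H p" using assms(1) by auto
  then show ?thesis
    using multiwavelet_eq_ft[of \<Omega> i h x j] Om[OF a(2)] assms(2) H_subset_V by (auto simp: wavelet_family_def)
qed

lemma sqn_ft_diff_sum:
  assumes f: "f \<in> L2 M" "integrable M f" and F: "F \<subseteq> wavelet_index"
  shows "sqn M (\<lambda>x. ft f x - (\<Sum>a\<in>F. c a * multiwavelet p M \<Omega> a x)) =
    sqn M (\<lambda>x. f x - (\<Sum>a\<in>F. c a * wavelet_family \<Omega> a x))"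
proof -
  define s where "s = (\<lambda>x. \<Sum>a\<in>F. c a * wavelet_family \<Omega> a x)"
  have s: "s \<in> L2 M" "integrable M s"
    unfolding s_def using F
    by (auto intro!: L2_sum wavelet_family_L2 Bochner_Integration.integrable_sum integrable_mult_right wavelet_family_integrable
        simp del: mem_Sigma_iff)
  have "sqn M (\<lambda>x. ft f x - (\<Sum>a\<in>F. c a * multiwavelet p M \<Omega> a x)) = sqn M (ft (\<lambda>x. f x - s x))"
  proof (rule sqn_cong)
    fix x assume "x \<in> space M"
    then have x: "x \<in> V" by simp
    have "ft s x = (\<Sum>a\<in>F. c a * ft (wavelet_family \<Omega> a) x)"
      unfolding s_def using F x wavelet_family_integrable by (intro ft_sum) auto
    also have "\<dots> = (\<Sum>a\<in>F. c a * multiwavelet p M \<Omega> a x)"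
      using F x wavelet_family_ft by (intro sum.cong) auto
    finally show "ft f x - (\<Sum>a\<in>F. c a * multiwavelet p M \<Omega> a x) = ft (\<lambda>x. f x - s x) x"
      using f s x by (simp add: ft_diff)
  qed
  also have "\<dots> = sqn M (\<lambda>x. f x - s x)"
    using f s by (intro plancherel(1)) (auto intro: L2_diff)
  finally show ?thesis by (simp add: s_def)
qed

lemma multiwavelet_L2: "a \<in> wavelet_index \<Longrightarrow> multiwavelet p M \<Omega> a \<in> L2 M"
  using L2_cong[of "multiwavelet p M \<Omega> a" "ft (wavelet_family \<Omega> a)"] wavelet_family_ft[of a]
    plancherel(2)[OF wavelet_family_L2 wavelet_family_integrable] by blast

lemma multiwavelet_inner:
  assumes "a \<in> wavelet_index" "b \<in> wavelet_index"
  shows "L2_inner M (multiwavelet p M \<Omega> a) (multiwavelet p M \<Omega> b) =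
    L2_inner M (wavelet_family \<Omega> a) (wavelet_family \<Omega> b)"
proof -
  have "L2_inner M (multiwavelet p M \<Omega> a) (multiwavelet p M \<Omega> b) =
      L2_inner M (ft (wavelet_family \<Omega> a)) (ft (wavelet_family \<Omega> b))"
    using assms by (intro L2_inner_cong wavelet_family_ft)
  then show ?thesis using assms wavelet_family_L2 wavelet_family_integrable by (simp add: parseval)
qed

text \<open>Density concerns all of \<open>L2\<close> on the group side but only integrable
  functions on the Fourier side, where \<open>ft\<close> makes sense. In one direction a function is
  transformed and approximated; in the other it is first replaced by a step function, which is a
  transform.\<close>

lemma multiwavelet_set_iff_fourier:
  "multiwavelet_set p M M \<Omega> \<longleftrightarrow>
    (\<forall>a\<in>wavelet_index. \<forall>b\<in>wavelet_index. L2_inner M (wavelet_family \<Omega> a) (wavelet_family \<Omega> b) = (if a = b then 1 else 0)) \<and>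
    (\<forall>f\<in>L2 M. integrable M f \<longrightarrow> f \<in> l2cl M (wavelet_family \<Omega> ` wavelet_index))"
    (is "_ \<longleftrightarrow> ?orth \<and> ?dense")
proof -
  let ?psi = "multiwavelet p M \<Omega>"
  let ?complete = "\<forall>f\<in>L2 M. \<forall>\<epsilon>>0. \<exists>F c. finite F \<and> F \<subseteq> wavelet_index \<and>
    L2_norm M (\<lambda>x. f x - (\<Sum>a\<in>F. c a * ?psi a x)) < \<epsilon>"
  have psi_sum: "(\<lambda>x. \<Sum>a\<in>F. c a * ?psi a x) \<in> L2 M" if "F \<subseteq> wavelet_index" for F c
    using that multiwavelet_L2 by (intro L2_sum) blast
  have "?complete \<longleftrightarrow> ?dense"
  proof
    assume C: ?complete
    show ?dense
    proof (intro ballI impI)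
      fix f assume f: "f \<in> L2 M" "integrable M f"
      show "f \<in> l2cl M (wavelet_family \<Omega> ` wavelet_index)"
        unfolding l2cl_def
      proof (intro CollectI conjI allI impI)
        show "f \<in> borel_measurable M" using f by auto
        fix \<epsilon> :: real assume e: "\<epsilon> > 0"
        have "0 < sqrt \<epsilon>" using e by simp
        from C[rule_format, OF plancherel(2)[OF f] this]
        obtain F c where F: "finite F" "F \<subseteq> wavelet_index"
            "L2_norm M (\<lambda>x. ft f x - (\<Sum>a\<in>F. c a * ?psi a x)) < sqrt \<epsilon>" by (elim exE conjE)
        have "sqn M (\<lambda>x. ft f x - (\<Sum>a\<in>F. c a * ?psi a x)) < ennreal ((sqrt \<epsilon>)\<^sup>2)"
          using F(3) e plancherel(2)[OF f] psi_sum[OF F(2)]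
          by (subst L2_norm_less_iff[symmetric]) (auto intro: L2_diff)
        then have "sqn M (\<lambda>x. f x - (\<Sum>a\<in>F. c a * wavelet_family \<Omega> a x)) < ennreal \<epsilon>"
          using e unfolding sqn_ft_diff_sum[OF f F(2)] by simp
        moreover have "(\<lambda>x. \<Sum>a\<in>F. c a * wavelet_family \<Omega> a x) \<in> lspan (wavelet_family \<Omega> ` wavelet_index)"
          using F(2) by (intro lspan_sum lspan_base) blast
        ultimately show "\<exists>s\<in>lspan (wavelet_family \<Omega> ` wavelet_index). sqn M (\<lambda>x. f x - s x) < ennreal \<epsilon>" ..
      qed
    qed
  next
    assume D: ?dense
    show ?complete
    proof (intro ballI allI impI)
      fix f and \<epsilon> :: real assume f: "f \<in> L2 M" and e: "\<epsilon> > 0"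
      define d where "d = \<epsilon>\<^sup>2"
      have d: "d > 0" using e by (simp add: d_def)
      obtain s where s: "s \<in> step" "sqn M (\<lambda>x. f x - s x) < ennreal (d / 4)"
        using L2_approx_step[OF f, of "d / 4"] d by auto
      \<comment> \<open>The step function is pulled back to the Fourier side, where the density
        assumption applies.\<close>
      obtain t where t: "t \<in> step" "\<forall>x\<in>V. s x = ft t x" using step_eq_ft[OF s(1)] by blast
      have tL: "t \<in> L2 M" "integrable M t" using t step_L2 step_integrable by auto
      obtain v where v: "v \<in> lspan (wavelet_family \<Omega> ` wavelet_index)" "sqn M (\<lambda>x. t x - v x) < ennreal (d / 4)"
        using D tL l2clD[of t M _ "d / 4"] d by auto
      obtain F c where F: "finite F" "F \<subseteq> wavelet_index" "v = (\<lambda>x. \<Sum>a\<in>F. c a * wavelet_family \<Omega> a x)"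
        using lspan_image_eq_sum[OF v(1)] by blast
      let ?S = "\<lambda>x. \<Sum>a\<in>F. c a * ?psi a x"
      have "sqn M (\<lambda>x. s x - ?S x) = sqn M (\<lambda>x. ft t x - ?S x)"
        using t by (intro sqn_cong) simp
      then have sS: "sqn M (\<lambda>x. s x - ?S x) < ennreal (d / 4)"
        using v(2) unfolding sqn_ft_diff_sum[OF tL F(2)] F(3) by simp
      have "sqn M (\<lambda>x. f x - ?S x) \<le> 2 * sqn M (\<lambda>x. f x - s x) + 2 * sqn M (\<lambda>x. s x - ?S x)"
        using f step_L2[OF s(1)] psi_sum[OF F(2)] by (intro sqn_triangle) (auto simp: L2_def)
      also have "\<dots> < ennreal d" using s sS d by (intro ennreal_quarters_less) auto
      finally have "L2_norm M (\<lambda>x. f x - ?S x) < \<epsilon>"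
        using f psi_sum[OF F(2)] e by (subst L2_norm_less_iff) (auto intro: L2_diff simp: d_def)
      then show "\<exists>F c. finite F \<and> F \<subseteq> wavelet_index \<and> L2_norm M (\<lambda>x. f x - (\<Sum>a\<in>F. c a * ?psi a x)) < \<epsilon>"
        using F(1,2) by (intro exI[of _ F] exI[of _ c] conjI)
    qed
  qed
  moreover have "(\<forall>a\<in>wavelet_index. \<forall>b\<in>wavelet_index. L2_inner M (?psi a) (?psi b) = (if a = b then 1 else 0)) \<longleftrightarrow> ?orth"
    using multiwavelet_inner by (intro ball_cong refl) simp
  moreover have "\<forall>a\<in>wavelet_index. ?psi a \<in> L2 M" using multiwavelet_L2 by blast
  ultimately show ?thesis
    unfolding multiwavelet_set_def L2_orthonormal_basis_def by argo
qed

end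

section \<open>The characterization\<close>

text \<open>A function in the closures of two mutually orthogonal spans is orthogonal to itself. In
  estimates: \<open>s\<close> and \<open>t\<close> are both close to the indicator, hence to each
  other, and by Pythagoras their squared norms are bounded by that of \<open>s - t\<close>.\<close>

lemma zero_of_two_approximations:
  assumes X: "X \<in> sets M" and S: "S \<subseteq> L2 M" "T \<subseteq> L2 M"
    and orth: "\<And>s t. s \<in> S \<Longrightarrow> t \<in> T \<Longrightarrow> L2_inner M s t = 0"
    and cl: "(indicator X :: _ \<Rightarrow> complex) \<in> l2cl M S" "(indicator X :: _ \<Rightarrow> complex) \<in> l2cl M T"
  shows "emeasure M X = 0"
proof (rule ennreal_eq_0I)
  fix \<epsilon> :: real assume e: "\<epsilon> > 0"
  define f where "f = (indicator X :: _ \<Rightarrow> complex)"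
  \<comment> \<open>Accuracy \<open>d / 4\<close> makes the squared norm of \<open>s - t\<close>
    less than \<open>d\<close>; then \<open>s\<close> and the error both stay within a quarter of
    \<open>\<epsilon>\<close>.\<close>
  define d where "d = \<epsilon> / 4"
  have d: "d > 0" using e by (simp add: d_def)
  have f: "f \<in> borel_measurable M" using X by (simp add: f_def)
  obtain s where s: "s \<in> lspan S" "sqn M (\<lambda>x. f x - s x) < ennreal (d / 4)"
    using l2clD[OF cl(1), of "d / 4"] d by (auto simp: f_def)
  obtain t where t: "t \<in> lspan T" "sqn M (\<lambda>x. f x - t x) < ennreal (d / 4)"
    using l2clD[OF cl(2), of "d / 4"] d by (auto simp: f_def)
  have sL: "s \<in> L2 M" and tL: "t \<in> L2 M" using lspan_L2[OF s(1) S(1)] lspan_L2[OF t(1) S(2)] .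
  have m: "s \<in> borel_measurable M" "t \<in> borel_measurable M" using sL tL by (auto simp: L2_def)
  have "L2_inner M s b = 0" if b: "b \<in> T" for b
    using S(2) b orth by (intro lspan_inner_zero[OF s(1) S(1)]) auto
  then have "L2_inner M b s = 0" if "b \<in> T" for b
    using that by (subst L2_inner_commute) simp
  then have "L2_inner M t s = 0" by (intro lspan_inner_zero[OF t(1) S(2) sL])
  then have "L2_inner M s t = 0" by (subst L2_inner_commute) simp
  then have "sqn M s + sqn M t = sqn M (\<lambda>x. s x - t x)"
    using sL tL by (simp add: sqn_diff_orthogonal)
  also have "\<dots> \<le> 2 * sqn M (\<lambda>x. s x - f x) + 2 * sqn M (\<lambda>x. f x - t x)"
    by (intro sqn_triangle m f)
  also have "\<dots> < ennreal d"
    using s(2) t(2) d by (intro ennreal_quarters_less) (auto simp: sqn_commute[of M s])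
  finally have "sqn M s \<le> ennreal d" by (metis add_increasing2 order_refl zero_le le_less_trans less_imp_le)
  moreover have "sqn M f \<le> 2 * sqn M (\<lambda>x. f x - s x) + 2 * sqn M s"
    using sqn_add_le[of "\<lambda>x. f x - s x" M s] f m by simp
  moreover have "sqn M (\<lambda>x. f x - s x) < ennreal (\<epsilon> / 4)"
    using s(2) by (rule less_le_trans) (use e in \<open>auto simp: d_def intro!: ennreal_leI\<close>)
  ultimately have "sqn M f < ennreal \<epsilon>"
    using ennreal_quarters_less[of "sqn M (\<lambda>x. f x - s x)" \<epsilon> "sqn M s"] e
    by (auto simp: d_def intro: le_less_trans)
  then show "emeasure M X \<le> ennreal \<epsilon>" using X by (simp add: f_def sqn_indicator)
qed

context
  fixes \<Omega> :: "nat \<Rightarrow> (int \<Rightarrow> int) set"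
  assumes Om: "\<And>i. i \<in> {1..p - 1} \<Longrightarrow> \<Omega> i \<in> sets M"
begin

lemma shift_Om_sets: "i \<in> {1..p - 1} \<Longrightarrow> shift n ` \<Omega> i \<in> sets M"
  using Om by (intro shift_image_sets)

lemma wavelet_hat_subset_wavelet_family: "i \<in> {1..p - 1} \<Longrightarrow> wavelet_hat (\<Omega> i) j ` H p \<subseteq> wavelet_family \<Omega> ` wavelet_index"
  by (auto simp: wavelet_family_def intro!: image_eqI[of _ _ "(i, j, _)"])

lemma shift_Om_countable_Un_sets:
  "(\<Union>a\<in>UNIV \<times> {1..p - 1}. case a of (n, i) \<Rightarrow> shift n ` \<Omega> i) \<in> sets M"
proof (rule sets.countable_UN')
  show "countable ((UNIV :: int set) \<times> {1..p - 1})" by simp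
qed (auto intro: shift_Om_sets)

lemma multiwavelet_set_imp_conditions:
  assumes mw: "multiwavelet_set p M M \<Omega>"
  shows "ae_partition M (UNIV \<times> {1..p - 1}) (\<lambda>(n, i). shift n ` \<Omega> i) V"
    and "i \<in> {1..p - 1} \<Longrightarrow> ae_H_perp_congruent p M (\<Omega> i) (nbhd p 0)"
proof -
  have fin: "emeasure M (\<Omega> i) < \<infinity>" if "i \<in> {1..p - 1}" for i
    using multiwavelet_set_imp_finite[OF mw that Om[OF that]] .
  have orth: "L2_inner M (wavelet_family \<Omega> a) (wavelet_family \<Omega> b) = (if a = b then 1 else 0)"
    if "a \<in> wavelet_index" "b \<in> wavelet_index" for a b
    using mw that multiwavelet_set_iff_fourier[where \<Omega> = \<Omega>, OF Om fin] by blast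
  have dense: "f \<in> l2cl M (wavelet_family \<Omega> ` wavelet_index)" if "f \<in> L2 M" "integrable M f" for f
    using mw that multiwavelet_set_iff_fourier[where \<Omega> = \<Omega>, OF Om fin] by blast
  \<comment> \<open>Orthonormality at scale 0 suffices: the Fourier coefficient at \<open>h\<close>
    is the inner product of the wavelets with translations 0 and \<open>h\<close>.\<close>
  have uni: "frac_uniform (\<Omega> i)" if i: "i \<in> {1..p - 1}" for i
  proof (rule frac_uniformI[OF Om[OF i] fin[OF i]])
    fix h assume h: "h \<in> H p"
    then have hV: "h \<in> V" using H_subset_V by auto
    have "vminus p h (\<lambda>_. 0) = h" using hV by (auto simp: vminus_def vilenkin_mod)
    then have "(\<integral>\<omega>. indicator (\<Omega> i) \<omega> * pairing p h \<omega> \<partial>M) = L2_inner M (wavelet_hat (\<Omega> i) 0 (\<lambda>_. 0)) (wavelet_hat (\<Omega> i) 0 h)"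
      using wavelet_hat_inner_same[OF Om[OF i], of "\<lambda>_. 0" h 0] hV by simp
    also have "\<dots> = L2_inner M (wavelet_family \<Omega> (i, 0, \<lambda>_. 0)) (wavelet_family \<Omega> (i, 0, h))"
      by (simp add: wavelet_family_def)
    also have "\<dots> = (if h = (\<lambda>_. 0) then 1 else 0)"
      using i h by (subst orth) auto
    finally show "(\<integral>\<omega>. indicator (\<Omega> i) \<omega> * pairing p h \<omega> \<partial>M) = (if h = (\<lambda>_. 0) then 1 else 0)" .
  qed
  show "i \<in> {1..p - 1} \<Longrightarrow> ae_H_perp_congruent p M (\<Omega> i) (nbhd p 0)"
    using frac_uniform_imp_congruent[OF uni Om] .
  have wavelet_L2: "wavelet_hat (\<Omega> i) j ` H p \<subseteq> L2 M" if "i \<in> {1..p - 1}" for i j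
    using that Om fin H_subset_V by (auto intro!: wavelet_hat_L2_integrable)
  \<comment> \<open>The overlap is a subset of both dilated sets, so its indicator is approximable
    by each of two systems that are orthogonal to each other.\<close>
  have disj: "emeasure M (shift n ` \<Omega> i \<inter> shift m ` \<Omega> k) = 0"
    if i: "i \<in> {1..p - 1}" and k: "k \<in> {1..p - 1}" and ne: "(n, i) \<noteq> (m, k)" for n m i k
  proof (rule zero_of_two_approximations)
    show X: "shift n ` \<Omega> i \<inter> shift m ` \<Omega> k \<in> sets M"
      using i k by (intro sets.Int shift_Om_sets)
    show "wavelet_hat (\<Omega> i) n ` H p \<subseteq> L2 M" "wavelet_hat (\<Omega> k) m ` H p \<subseteq> L2 M" using wavelet_L2 i k by auto
    show "(indicator (shift n ` \<Omega> i \<inter> shift m ` \<Omega> k) :: _ \<Rightarrow> complex) \<in> l2cl M (wavelet_hat (\<Omega> i) n ` H p)"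
      by (rule indicator_in_l2cl_wavelet_hat[OF uni[OF i] Om[OF i] X]) simp
    show "(indicator (shift n ` \<Omega> i \<inter> shift m ` \<Omega> k) :: _ \<Rightarrow> complex) \<in> l2cl M (wavelet_hat (\<Omega> k) m ` H p)"
      by (rule indicator_in_l2cl_wavelet_hat[OF uni[OF k] Om[OF k] X]) simp
    fix s t assume "s \<in> wavelet_hat (\<Omega> i) n ` H p" "t \<in> wavelet_hat (\<Omega> k) m ` H p"
    then obtain h h' where h: "h \<in> H p" "h' \<in> H p" "s = wavelet_family \<Omega> (i, n, h)" "t = wavelet_family \<Omega> (k, m, h')"
      by (auto simp: wavelet_family_def)
    then show "L2_inner M s t = 0" using i k ne orth[of "(i, n, h)" "(k, m, h')"] by auto
  qed
  define W where "W = (\<Union>a\<in>UNIV \<times> {1..p - 1}. case a of (n, i) \<Rightarrow> shift n ` \<Omega> i)"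
  have W: "W \<in> sets M" unfolding W_def by (rule shift_Om_countable_Un_sets)
  \<comment> \<open>Cut down to finite measure, the uncovered part has an indicator that lies in the
    closure of the family and yet is orthogonal to all of it.\<close>
  have Z0: "emeasure M ((V - W) \<inter> nbhd p m) = 0" for m
  proof (rule ennreal_eq_0I)
    fix \<epsilon> :: real assume e: "\<epsilon> > 0"
    define Z where "Z = (V - W) \<inter> nbhd p m"
    have "V \<in> sets M" using sets.top[of M] by simp
    then have Z: "Z \<in> sets M" unfolding Z_def using W by (intro sets.Int sets.Diff nbhd_sets)
    have "emeasure M Z \<le> emeasure M (nbhd p m)" using Z by (intro emeasure_mono) (auto simp: Z_def)
    also have "\<dots> < \<infinity>" by (simp add: emeasure_nbhd)
    finally have "(indicator Z :: _ \<Rightarrow> complex) \<in> fin_inds M" using Z by (auto simp: fin_inds_def)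
    then have zL: "(indicator Z :: _ \<Rightarrow> complex) \<in> L2 M" "integrable M (indicator Z :: _ \<Rightarrow> complex)"
      using fin_inds_L2 fin_inds_integrable by auto
    obtain s where s: "s \<in> lspan (wavelet_family \<Omega> ` wavelet_index)" "sqn M (\<lambda>x. indicator Z x - s x) < ennreal \<epsilon>"
      using l2clD[OF dense[OF zL] e] by blast
    have famL2: "wavelet_family \<Omega> ` wavelet_index \<subseteq> L2 M" using wavelet_family_L2[where \<Omega> = \<Omega>, OF Om fin] by blast
    have "L2_inner M s (indicator Z) = 0"
    proof (rule lspan_inner_zero[OF s(1) famL2 zL(1)])
      fix g assume "g \<in> wavelet_family \<Omega> ` wavelet_index"
      then obtain i j h where g: "g = wavelet_hat (\<Omega> i) j h" "i \<in> {1..p - 1}" by (auto simp: wavelet_family_def)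
      have "(\<lambda>x. g x * cnj (indicator Z x)) = (\<lambda>_. 0)"
      proof
        fix x
        show "g x * cnj (indicator Z x) = 0"
        proof (cases "x \<in> Z")
          case True
          then have "x \<notin> shift j ` \<Omega> i" using g(2) by (auto simp: Z_def W_def)
          then show ?thesis by (simp add: g wavelet_hat_def)
        qed simp
      qed
      then show "L2_inner M g (indicator Z) = 0" by (simp add: L2_inner_def)
    qed
    then have "L2_inner M (indicator Z) s = 0" by (subst L2_inner_commute) simp
    then have "sqn M (\<lambda>x. indicator Z x - s x) = sqn M (indicator Z) + sqn M s"
      by (rule sqn_diff_orthogonal[OF zL(1) lspan_L2[OF s(1) famL2]])
    then have "sqn M (indicator Z) \<le> sqn M (\<lambda>x. indicator Z x - s x)" by simp
    then show "emeasure M ((V - W) \<inter> nbhd p m) \<le> ennreal \<epsilon>"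
      using s(2) Z unfolding Z_def by (simp add: sqn_indicator)
  qed
  have VW: "V - W \<in> sets M" using sets.compl_sets[OF W] by simp
  have "V - W = (\<Union>i::nat. (V - W) \<inter> nbhd p (- int i))"
    using V_eq_Union_nbhd by blast
  moreover have "(\<Union>i::nat. (V - W) \<inter> nbhd p (- int i)) \<in> null_sets M"
    using Z0 VW by (intro null_sets_UN null_setsI sets.Int nbhd_sets)
  ultimately have "V - W \<in> null_sets M" by simp
  moreover have "sym_diff W V = V - W" using sets_M_subset[OF W] by auto
  ultimately have cover: "sym_diff W V \<in> null_sets M" by simp
  show "ae_partition M (UNIV \<times> {1..p - 1}) (\<lambda>(n, i). shift n ` \<Omega> i) V"
    unfolding ae_partition_def
  proof (intro conjI ballI impI)
    show "sym_diff (\<Union>a\<in>UNIV \<times> {1..p - 1}. case a of (n, i) \<Rightarrow> shift n ` \<Omega> i) V \<in> null_sets M"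
      using cover by (simp add: W_def)
    fix a assume a: "a \<in> (UNIV :: int set) \<times> {1..p - 1}"
    then show "(case a of (n, i) \<Rightarrow> shift n ` \<Omega> i) \<in> sets M" by (auto intro: shift_Om_sets)
    fix b assume b: "b \<in> (UNIV :: int set) \<times> {1..p - 1}" and ne: "a \<noteq> b"
    show "(case a of (n, i) \<Rightarrow> shift n ` \<Omega> i) \<inter> (case b of (n, i) \<Rightarrow> shift n ` \<Omega> i) \<in> null_sets M"
      using a b ne by (auto intro!: null_setsI disj sets.Int shift_Om_sets)
  qed
qed

lemma conditions_imp_multiwavelet_set:
  assumes part: "ae_partition M (UNIV \<times> {1..p - 1}) (\<lambda>(n, i). shift n ` \<Omega> i) V"
    and cong: "\<And>i. i \<in> {1..p - 1} \<Longrightarrow> ae_H_perp_congruent p M (\<Omega> i) (nbhd p 0)"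
  shows "multiwavelet_set p M M \<Omega>"
proof -
  have uni: "frac_uniform (\<Omega> i)" if "i \<in> {1..p - 1}" for i
    using congruent_imp_frac_uniform[OF cong[OF that] Om[OF that]] .
  have fin: "emeasure M (\<Omega> i) < \<infinity>" if "i \<in> {1..p - 1}" for i
    using frac_uniform_emeasure[OF uni[OF that] Om[OF that]] by simp
  have orth: "L2_inner M (wavelet_family \<Omega> a) (wavelet_family \<Omega> b) = (if a = b then 1 else 0)"
    if ab: "a \<in> wavelet_index" "b \<in> wavelet_index" for a b
  proof -
    obtain i n h where a: "a = (i, n, h)" "i \<in> {1..p - 1}" "h \<in> H p" using ab(1) by auto
    obtain k m h' where b: "b = (k, m, h')" "k \<in> {1..p - 1}" "h' \<in> H p" using ab(2) by auto
    have hV: "h \<in> V" "h' \<in> V" using a b H_subset_V by auto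
    show ?thesis
    proof (cases "(n, i) = (m, k)")
      case True
      have "L2_inner M (wavelet_family \<Omega> a) (wavelet_family \<Omega> b) =
          (\<integral>\<omega>. indicator (\<Omega> i) \<omega> * pairing p (vminus p h' h) \<omega> \<partial>M)"
        using True a b hV Om by (simp add: wavelet_family_def wavelet_hat_inner_same)
      also have "\<dots> = (if vminus p h' h = (\<lambda>_. 0) then 1 else 0)"
        using a b by (intro frac_uniform_integral uni Om vminus_in_H)
      also have "\<dots> = (if a = b then 1 else 0)"
        using True a b hV by (auto simp: vminus_eq_0_iff)
      finally show ?thesis .
    next
      case False
      \<comment> \<open>Functions belonging to different dilated sets have a product supported in
        this overlap.\<close>
      let ?N = "shift n ` \<Omega> i \<inter> shift m ` \<Omega> k"
      have "?N \<in> null_sets M"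
        using part False a(2) b(2) unfolding ae_partition_def
        by (auto dest!: bspec[of _ _ "(n, i)"] bspec[of _ _ "(m, k)"])
      then have "AE \<omega> in M. wavelet_hat (\<Omega> i) n h \<omega> * cnj (wavelet_hat (\<Omega> k) m h' \<omega>) = 0"
        by (rule AE_I') (auto simp: wavelet_hat_def indicator_def)
      then have "L2_inner M (wavelet_family \<Omega> a) (wavelet_family \<Omega> b) = 0"
        unfolding L2_inner_def a b wavelet_family_def by (simp add: integral_eq_zero_AE)
      then show ?thesis using False a b by auto
    qed
  qed
  have famL2: "wavelet_family \<Omega> ` wavelet_index \<subseteq> L2 M" using wavelet_family_L2[where \<Omega> = \<Omega>, OF Om fin] by blast
  have "fin_inds M \<subseteq> l2cl M (wavelet_family \<Omega> ` wavelet_index)"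
  proof
    fix f :: "(int \<Rightarrow> int) \<Rightarrow> complex" assume "f \<in> fin_inds M"
    then obtain F where F: "f = indicator F" "F \<in> sets M" "emeasure M F < \<infinity>" by (auto simp: fin_inds_def)
    define K where "K = (UNIV :: int set) \<times> {1..p - 1}"
    \<comment> \<open>The dilated sets arranged in one sequence, so that \<open>F\<close> is
      exhausted up to a null set by the increasing \<open>D n\<close>.\<close>
    define E where "E n = (case from_nat_into K n of (m, i) \<Rightarrow> shift m ` \<Omega> i)" for n
    have K: "countable K" "K \<noteq> {}" using p_gt_1 by (auto simp: K_def)
    have E_ex: "\<exists>m i. i \<in> {1..p - 1} \<and> E n = shift m ` \<Omega> i" for n
    proof -
      obtain m i where mi: "from_nat_into K n = (m, i)" by (cases "from_nat_into K n")
      then have "i \<in> {1..p - 1}" using from_nat_into[OF K(2), of n] by (simp add: K_def)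
      then show ?thesis using mi by (auto simp: E_def)
    qed
    have Es: "E n \<in> sets M" for n using E_ex[of n] shift_Om_sets by auto
    have UnE: "(\<Union>n. E n) = (\<Union>a\<in>K. case a of (m, i) \<Rightarrow> shift m ` \<Omega> i)"
    proof -
      have "(\<Union>n. E n) = (\<Union>a\<in>range (from_nat_into K). case a of (m, i) \<Rightarrow> shift m ` \<Omega> i)"
        by (simp add: E_def)
      then show ?thesis using K by (simp add: range_from_nat_into)
    qed
    define D where "D n = F \<inter> (\<Union>i<n. E i)" for n
    have D: "D n \<in> sets M" for n unfolding D_def using F(2) Es by (intro sets.Int sets.finite_UN) auto
    have Dcl: "(indicator (D n) :: _ \<Rightarrow> complex) \<in> l2cl M (wavelet_family \<Omega> ` wavelet_index)" for n
    proof (induction n)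
      case 0
      have "(\<lambda>_. 0) \<in> l2cl M (wavelet_family \<Omega> ` wavelet_index)"
        using lspan_subset_l2cl[OF famL2] lspan_zero by blast
      moreover have "(indicator (D 0) :: (int \<Rightarrow> int) \<Rightarrow> complex) = (\<lambda>_. 0)" by (auto simp: D_def)
      ultimately show ?case by simp
    next
      case (Suc n)
      obtain m i where mi: "i \<in> {1..p - 1}" "E n = shift m ` \<Omega> i" using E_ex by blast
      \<comment> \<open>The increment lies in the single dilated set \<open>E n\<close>, where
        density is known; being disjoint from \<open>D n\<close>, it adds its indicator to that of
        \<open>D n\<close>.\<close>
      have "(indicator (F \<inter> E n - D n) :: _ \<Rightarrow> complex) \<in> l2cl M (wavelet_hat (\<Omega> i) m ` H p)"
      proof (rule indicator_in_l2cl_wavelet_hat[OF uni[OF mi(1)] Om[OF mi(1)]])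
        show "F \<inter> E n - D n \<in> sets M" using F(2) D Es by (intro sets.Diff sets.Int)
      qed (use mi in auto)
      then have new: "(indicator (F \<inter> E n - D n) :: _ \<Rightarrow> complex) \<in> l2cl M (wavelet_family \<Omega> ` wavelet_index)"
        using l2cl_mono[OF wavelet_hat_subset_wavelet_family[OF mi(1)]] by blast
      have "(indicator (D (Suc n)) :: (int \<Rightarrow> int) \<Rightarrow> complex) =
          (\<lambda>x. indicator (D n) x + 1 * indicator (F \<inter> E n - D n) x)"
        by (auto simp: D_def indicator_def lessThan_Suc)
      then show ?case using l2cl_add_scale[OF Suc new famL2, of 1] by simp
    qed
    define R where "R n = F - D n" for n
    have "(\<lambda>n. emeasure M (R n)) \<longlonglongrightarrow> emeasure M (\<Inter>n. R n)"
    proof (rule Lim_emeasure_decseq)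
      show "range R \<subseteq> sets M" using F(2) D by (auto simp: R_def)
      show "decseq R"
        unfolding decseq_def
      proof (intro allI impI)
        fix m n :: nat assume "m \<le> n"
        then have "(\<Union>i<m. E i) \<subseteq> (\<Union>i<n. E i)" by (intro UN_mono) auto
        then show "R n \<subseteq> R m" unfolding R_def D_def by blast
      qed
      have "emeasure M (R n) \<le> emeasure M F" for n using F(2) by (intro emeasure_mono) (auto simp: R_def)
      then show "emeasure M (R n) \<noteq> \<infinity>" for n using F(3) by (metis infinity_ennreal_def leD)
    qed
    moreover have "emeasure M (\<Inter>n. R n) = 0"
    proof -
      let ?N = "sym_diff (\<Union>a\<in>K. case a of (m, i) \<Rightarrow> shift m ` \<Omega> i) V"
      have "?N \<in> null_sets M" using part unfolding ae_partition_def K_def by blast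
      moreover have "(\<Inter>n. R n) \<subseteq> ?N"
        unfolding UnE[symmetric] using sets_M_subset[OF F(2)] by (auto simp: R_def D_def)
      moreover have "(\<Inter>n. R n) \<in> sets M" using F(2) D by (intro sets.countable_INT) (auto simp: R_def)
      ultimately show ?thesis by (metis null_setsD1 null_sets_subset)
    qed
    ultimately have lim: "(\<lambda>n. emeasure M (R n)) \<longlonglongrightarrow> 0" by simp
    show "f \<in> l2cl M (wavelet_family \<Omega> ` wavelet_index)"
      unfolding F(1)
    proof (rule indicator_in_l2clI[OF F(2) famL2])
      fix \<epsilon> :: real assume "\<epsilon> > 0"
      then have "eventually (\<lambda>n. emeasure M (R n) < ennreal \<epsilon>) sequentially"
        using lim by (intro order_tendstoD(2)) auto
      then obtain n where "emeasure M (R n) < ennreal \<epsilon>"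
        using eventually_happens'[OF sequentially_bot] by blast
      moreover have "sym_diff F (D n) = R n" by (auto simp: R_def D_def)
      ultimately show "\<exists>D\<in>sets M. (indicator D :: _ \<Rightarrow> complex) \<in> l2cl M (wavelet_family \<Omega> ` wavelet_index) \<and>
          emeasure M (sym_diff F D) < ennreal \<epsilon>"
        using D Dcl by (intro bexI[of _ "D n"]) auto
    qed
  qed
  then have "L2 M \<subseteq> l2cl M (wavelet_family \<Omega> ` wavelet_index)" by (rule L2_subset_l2cl[OF famL2])
  then show ?thesis using multiwavelet_set_iff_fourier[where \<Omega> = \<Omega>, OF Om fin] orth by blast
qed

end

end

text \<open>Both measures give a cylinder of level \<open>l\<close> the same power of
  \<open>p\<close>. Identifying them turns the Fourier transform into a map of one function space
  into itself.\<close>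

lemma normalized_haar_unique:
  assumes "prime p" "normalized_haar p \<mu>" "normalized_haar p \<nu>"
  shows "\<mu> = \<nu>"
proof -
  interpret mu: vilenkin_haar p \<mu> by unfold_locales fact+
  interpret nu: vilenkin_haar p \<nu> by unfold_locales fact+
  show ?thesis by (rule nu.measure_eqI_cyl) (simp_all add: mu.sets_M nu.sets_M mu.emeasure_cyl nu.emeasure_cyl)
qed

theorem theorem3p4:
  fixes p :: nat
    and \<mu> \<nu> :: "(int \<Rightarrow> int) measure"
    and \<Omega> :: "nat \<Rightarrow> (int \<Rightarrow> int) set"
  assumes "prime p"
    and "normalized_haar p \<mu>"
    and "normalized_haar p \<nu>"
    and "\<And>i. i \<in> {1..p - 1} \<Longrightarrow> \<Omega> i \<in> sets \<nu>"
  shows "multiwavelet_set p \<mu> \<nu> \<Omega> \<longleftrightarrow>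
    ae_partition \<nu> (UNIV \<times> {1..p - 1}) (\<lambda>(n, i). shift n ` \<Omega> i) (vilenkin p) \<and>
    (\<forall>i\<in>{1..p - 1}. ae_H_perp_congruent p \<nu> (\<Omega> i) (nbhd p 0))"
proof -
  interpret vilenkin_haar p \<nu> by unfold_locales fact+
  have "\<mu> = \<nu>" using assms(1-3) by (rule normalized_haar_unique)
  then show ?thesis
    using multiwavelet_set_imp_conditions[where \<Omega> = \<Omega>, OF assms(4)]
      conditions_imp_multiwavelet_set[where \<Omega> = \<Omega>, OF assms(4)]
    by blast
qed

end
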